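(* Let $G$ be a finite simple graph. Then $E(G)<2\chi(G)$ if and only if $G$ is the disjoint union of some (possibly zero) isolated vertices and one of the following graphs: (i) the complete graph $K_n$ for some $n\geq 1$; (ii) the graph $B_n$ for some $n\geq 1$; (iii) the graph $A_{n,t}$ where either $n\leq 7$ and $(n,t)\neq(7,4)$, or $n\geq 8$ and $t\in\{1,2,n-1\}$; (iv) the graph $H_5$.
   Context: The energy $E(G)$ is the sum of the absolute values of all eigenvalues of the adjacency matrix of $G$, and $\chi(G)$ is its chromatic number. For $1\leq t\leq n-1$, $A_{n,t}$ is the graph obtained from the complete graph $K_n$ by adding one new vertex adjacent to exactly $t$ vertices of $K_n$. $B_n$ is the graph of order $n+2$ obtained from $K_n$ by adding two new pendant vertices, both adjacent to the same vertex of $K_n$. $H_5$ is the graph on $5$ vertices consisting of a triangle together with two pendant vertices attached to two different vertices of the triangle. *)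

theory Defs
  imports
    "Jordan_Normal_Form.Spectral_Radius"
    "Graph_Theory.Graph_Theory"
begin

text \<open>
  Finite simple graphs are taken from \<open>Graph_Theory\<close>: \<open>pair_graph G\<close> says that \<open>G\<close> is finite,
  loop-free and symmetric. An undirected edge \<open>uv\<close> is represented by the two arcs \<open>(u, v)\<close> and
  \<open>(v, u)\<close>. The graph without vertices is admitted.
\<close>

section \<open>Energy\<close>

definition adj_mat :: "'a pair_pre_digraph \<Rightarrow> 'a list \<Rightarrow> complex mat" where
  "adj_mat G vs =
    mat (length vs) (length vs) (\<lambda>(i, j). if (vs ! i, vs ! j) \<in> parcs G then 1 else 0)"

definition adjacency_matrix :: "'a pair_pre_digraph \<Rightarrow> complex mat" where
  "adjacency_matrix G = adj_mat G (SOME vs. distinct vs \<and> set vs = pverts G)"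

text \<open>Eigenvalues are counted with multiplicity. By \<open>char_poly_adjacency_matrix\<close> below, the choice
  of the vertex enumeration in \<open>adjacency_matrix\<close> is irrelevant.\<close>

definition energy :: "'a pair_pre_digraph \<Rightarrow> real" where
  "energy G = (let A = adjacency_matrix G in
    \<Sum>\<mu>\<in>spectrum A. real (order \<mu> (char_poly A)) * cmod \<mu>)"

lemma sum_delta_index:
  fixes f :: "nat \<Rightarrow> complex"
  assumes "bij_betw p {..<n} {..<n}" "i < n"
  shows "(\<Sum>k = 0..<n. (if k = p i then 1 else 0) * f k) = f (p i)"
    and "(\<Sum>k = 0..<n. f k * (if k = p i then 1 else 0)) = f (p i)"
proof -
  have "p i < n" using assms by (auto simp: bij_betw_def)
  then show "(\<Sum>k = 0..<n. (if k = p i then 1 else 0) * f k) = f (p i)"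
    and "(\<Sum>k = 0..<n. f k * (if k = p i then 1 else 0)) = f (p i)"
    by (simp_all add: if_distrib if_distribR sum.delta cong: if_cong)
qed

lemma char_poly_adj_mat_cong:
  assumes vs: "distinct vs" and ws: "distinct ws" and eq: "set vs = set ws"
  shows "char_poly (adj_mat G vs) = char_poly (adj_mat G ws)"
proof -
  define n where "n = length ws"
  have len: "length vs = n"
    using vs ws eq unfolding n_def by (metis distinct_card)
  have bv: "bij_betw ((!) vs) {..<n} (set vs)" and bw: "bij_betw ((!) ws) {..<n} (set vs)"
    using vs ws eq len n_def by (auto intro!: bij_betw_nth)
  define p where "p = inv_into {..<n} ((!) ws) \<circ> (!) vs"
  have bp: "bij_betw p {..<n} {..<n}"
    unfolding p_def by (rule bij_betw_trans[OF bv bij_betw_inv_into[OF bw]])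
  have wp: "ws ! p i = vs ! i" if "i < n" for i
    unfolding p_def o_def using that bv bw
    by (intro bij_betw_inv_into_right[OF bw]) (auto simp: bij_betw_def)
  have pn: "p i < n" if "i < n" for i using bp that by (auto simp: bij_betw_def)
  have inj: "p i = p j \<longleftrightarrow> i = j" if "i < n" "j < n" for i j
    using bp that by (auto simp: bij_betw_def inj_on_def)
  define P :: "complex mat" where "P = mat n n (\<lambda>(i, k). if k = p i then 1 else 0)"
  define Q :: "complex mat" where "Q = mat n n (\<lambda>(k, i). if k = p i then 1 else 0)"
  have PQ: "P * Q = 1\<^sub>m n"
    by (rule eq_matI)
      (auto simp: P_def Q_def scalar_prod_def sum_delta_index[OF bp] inj)
  have QP: "Q * P = 1\<^sub>m n"
    by (rule mat_mult_left_right_inverse[OF _ _ PQ]) (auto simp: P_def Q_def)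
  have PA: "P * adj_mat G ws
      = mat n n (\<lambda>(i, j). if (vs ! i, ws ! j) \<in> parcs G then 1 else 0)"
    unfolding adj_mat_def P_def n_def[symmetric]
    by (rule eq_matI) (auto simp: scalar_prod_def sum_delta_index[OF bp] wp pn)
  have PAQ: "adj_mat G vs = P * adj_mat G ws * Q"
    unfolding PA unfolding adj_mat_def Q_def len
    by (rule eq_matI) (auto simp: scalar_prod_def sum_delta_index[OF bp] wp pn)
  have "similar_mat (adj_mat G vs) (adj_mat G ws)"
    by (rule similar_matI[OF _ PQ QP PAQ]) (auto simp: adj_mat_def P_def Q_def len n_def)
  then show ?thesis by (rule char_poly_similar)
qed

lemma char_poly_adjacency_matrix:
  assumes "distinct vs" "set vs = pverts G"
  shows "char_poly (adjacency_matrix G) = char_poly (adj_mat G vs)"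
proof -
  let ?P = "\<lambda>vs. distinct vs \<and> set vs = pverts G"
  have "?P (SOME vs. ?P vs)" using assms by (intro someI[of ?P vs]) simp
  then show ?thesis
    unfolding adjacency_matrix_def using assms by (intro char_poly_adj_mat_cong) auto
qed

section \<open>Chromatic number\<close>

definition proper_coloring :: "'a pair_pre_digraph \<Rightarrow> nat \<Rightarrow> ('a \<Rightarrow> nat) \<Rightarrow> bool" where
  "proper_coloring G k c \<longleftrightarrow>
    (\<forall>v\<in>pverts G. c v < k) \<and> (\<forall>(u, v)\<in>parcs G. c u \<noteq> c v)"

definition chromatic_number :: "'a pair_pre_digraph \<Rightarrow> nat" where
  "chromatic_number G = (LEAST k. \<exists>c. proper_coloring G k c)"

section \<open>Isomorphism and disjoint union\<close>

abbreviation graph_iso :: "'a pair_pre_digraph \<Rightarrow> 'b pair_pre_digraph \<Rightarrow> bool" where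
  "graph_iso G H \<equiv> digraph_iso (with_proj G) (with_proj H)"

definition disjoint_union ::
  "'a pair_pre_digraph \<Rightarrow> 'b pair_pre_digraph \<Rightarrow> ('a + 'b) pair_pre_digraph" where
  "disjoint_union G H =
    \<lparr> pverts = pverts G <+> pverts H,
      parcs = map_prod Inl Inl ` parcs G \<union> map_prod Inr Inr ` parcs H \<rparr>"

section \<open>The graphs of the classification\<close>

definition edges :: "(nat \<times> nat) set \<Rightarrow> nat rel" where
  "edges E = E \<union> E\<inverse>"

definition isolated_vertices :: "nat \<Rightarrow> nat pair_pre_digraph" where
  "isolated_vertices k = \<lparr> pverts = {..<k}, parcs = {} \<rparr>"

definition complete_graph :: "nat \<Rightarrow> nat pair_pre_digraph" where
  "complete_graph n =
    \<lparr> pverts = {..<n}, parcs = {(u, v). u < n \<and> v < n \<and> u \<noteq> v} \<rparr>"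

text \<open>In \<open>graph_A\<close> and \<open>graph_B\<close> the clique is on \<open>{..<n}\<close>; the new vertices are \<open>n\<close>, respectively
  \<open>n\<close> and \<open>n + 1\<close>. The intended parameters are \<open>1 \<le> t \<le> n - 1\<close>, respectively \<open>n \<ge> 1\<close>.\<close>

definition graph_A :: "nat \<Rightarrow> nat \<Rightarrow> nat pair_pre_digraph" where
  "graph_A n t =
    \<lparr> pverts = insert n (pverts (complete_graph n)),
      parcs = parcs (complete_graph n) \<union> edges {(n, i) |i. i < t} \<rparr>"

definition graph_B :: "nat \<Rightarrow> nat pair_pre_digraph" where
  "graph_B n =
    \<lparr> pverts = pverts (complete_graph n) \<union> {n, n + 1},
      parcs = parcs (complete_graph n) \<union> edges {(n, 0), (n + 1, 0)} \<rparr>"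

definition graph_H5 :: "nat pair_pre_digraph" where
  "graph_H5 =
    \<lparr> pverts = {..<5},
      parcs = edges {(0, 1), (0, 2), (1, 2), (0, 3), (1, 4)} \<rparr>"

end

theory Submission
  imports Defs
begin

text \<open>
  The eigenvalues sum to zero, so half the energy is the sum of the positive ones, which is the
  maximum of \<open>\<langle>A, X\<rangle>\<close> over \<open>0 \<le> X \<le> I\<close>. This maximum \<open>P\<close> is superadditive over disjoint induced
  subgraphs, and every family of orthogonal test vectors bounds it from below.

  Suppose \<open>P < \<chi>\<close>. Then there is a clique of order \<open>\<chi>\<close>: a minimal counterexample is colour-critical
  and not complete, so two nonadjacent vertices have private neighbours \<open>a\<close> and \<open>b\<close>. If \<open>a\<close> and \<open>b\<close> are
  nonadjacent, an induced \<open>2K\<^sub>2\<close> gives a test vector orthogonal to the all-ones vector, and both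
  together yield \<open>P \<ge> \<chi>\<close>. Otherwise there is an induced path on four vertices with \<open>P \<ge> 2\<close>; by minimality
  the rest of the graph contains a clique \<open>Q\<close> of order \<open>\<chi> - 2\<close>, small certificates show that the
  path and \<open>Q\<close> exhaust the graph, and recolouring leaves only a clique of order \<open>\<chi>\<close> or an induced
  \<open>C\<^sub>5\<close>, which is excluded in the same way as \<open>2K\<^sub>2\<close>.

  Outside a clique \<open>Q\<close> of order \<open>\<chi>\<close> the graph is edgeless, since an edge there adds \<open>1\<close> to
  \<open>P(Q) = \<chi> - 1\<close>. Test matrices on \<open>Q\<close> and a few further vertices then leave only the listed graphs.
  Conversely, \<open>P \<le> tr Y\<close> whenever \<open>Y \<ge> 0\<close> and \<open>A + Y \<ge> 0\<close>, and each listed graph has such a \<open>Y\<close> of trace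
  less than \<open>\<chi>\<close>.
\<close>

section \<open>Half the energy as a semidefinite maximum\<close>

text \<open>Every graph satisfies P \<ge> \<chi> - 1, because a critical subgraph has minimum degree
  at least \<chi> - 1. So P < \<chi> leaves a gap of at most one, and any disjoint or orthogonal
  surplus of one closes it. The obstacle is that the bound P = \<chi> is attained, for instance by
  \<open>graph_A 7 4\<close>, so estimates with slack fail at the boundary. The condition in (iii)
  comes from the negative side of the spectrum. For 1 \<le> t \<le> n - 1 the graph
  \<open>graph_A n t\<close> has the eigenvalue -1 with multiplicity n - 2 on vectors of sum zero on
  the two parts of the clique, and exactly one further negative eigenvalue. Hence P < n says that
  this eigenvalue exceeds -2. Adding 2 on the diagonal of the quotient matrix of the partition into
  T, the rest of the clique, and the new vertex gives the determinant 2 (n + 1) - t (n - t + 1), so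
  (iii) is its positivity written out. Eigenvalues are mostly irrational. Both directions therefore
  work with exact eigenvectors at the threshold -2 or with rational approximations whose defect is
  small enough.\<close>

definition hconj :: "complex mat \<Rightarrow> complex mat" where
  "hconj A = mat (dim_col A) (dim_row A) (\<lambda>(i, j). cnj (A $$ (j, i)))"

lemma hconj_carrier [simp]: "A \<in> carrier_mat m n \<Longrightarrow> hconj A \<in> carrier_mat n m"
  by (simp add: hconj_def)

lemma hconj_hconj [simp]: "hconj (hconj A) = A"
  by (rule eq_matI) (auto simp: hconj_def)

lemma hconj_mult:
  assumes "A \<in> carrier_mat m n" "B \<in> carrier_mat n k"
  shows "hconj (A * B) = hconj B * hconj A"
  using assms
  by (intro eq_matI) (auto simp: hconj_def scalar_prod_def mult.commute intro!: sum.cong)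

text \<open>Gram-Schmidt on a basis starting with \<open>v\<close> keeps \<open>v\<close> as its
  first vector but does not normalise. Dividing column \<open>i\<close> by its norm
  \<open>N i\<close> makes the matrix unitary and leaves column 0 proportional to
  \<open>v\<close>.\<close>

lemma orthonormal_basis_extending:
  fixes v :: "complex vec"
  assumes v: "v \<in> carrier_vec n" "v \<noteq> 0\<^sub>v n" and n: "n \<noteq> 0"
  obtains W where "W \<in> carrier_mat n n" "hconj W * W = 1\<^sub>m n" "\<exists>c. col W 0 = c \<cdot>\<^sub>v v"
proof -
  interpret cof_vec_space n "TYPE(complex)" .
  define b where "b = basis_completion v"
  from basis_completion[OF v, folded b_def]
  have dist_b: "distinct b" and indep: "\<not> lin_dep (set b)"
    and b: "set b \<subseteq> carrier_vec n" and hdb: "hd b = v" and len_b: "length b = n"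
    by auto
  from hdb len_b n obtain vs where bv: "b = v # vs" by (cases b) auto
  define ws where "ws = gram_schmidt n b"
  from gram_schmidt_result[OF b dist_b indep refl, folded ws_def]
  have ws: "set ws \<subseteq> carrier_vec n" "corthogonal ws" "length ws = n"
    by (auto simp: len_b)
  from gram_schmidt_hd[OF v(1), of vs, folded bv] have hdws: "hd ws = v" unfolding ws_def .
  have wsi: "ws ! i \<in> carrier_vec n" if "i < n" for i using ws that by auto
  define N where "N i = complex_of_real (sqrt (\<Sum>k<n. (cmod (ws ! i $ k))\<^sup>2))" for i
  have cs: "ws ! i \<bullet>c ws ! j = (\<Sum>k<n. ws ! i $ k * cnj (ws ! j $ k))" if "i < n" "j < n" for i j
    using wsi[OF that(1)] wsi[OF that(2)] by (auto simp: scalar_prod_def lessThan_atLeast0)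
  have orth: "(\<Sum>k<n. ws ! i $ k * cnj (ws ! j $ k)) = 0 \<longleftrightarrow> i \<noteq> j" if "i < n" "j < n" for i j
    using corthogonalD[OF ws(2), of i j] that ws(3) cs[OF that] by simp
  have Nsq: "N i * N i = (\<Sum>k<n. ws ! i $ k * cnj (ws ! i $ k))" for i
  proof -
    have "N i * N i = of_real ((sqrt (\<Sum>k<n. (cmod (ws ! i $ k))\<^sup>2))\<^sup>2)"
      unfolding N_def of_real_power power2_eq_square[of "complex_of_real _"] ..
    also have "\<dots> = of_real (\<Sum>k<n. (cmod (ws ! i $ k))\<^sup>2)"
      by (simp add: sum_nonneg)
    also have "\<dots> = (\<Sum>k<n. ws ! i $ k * cnj (ws ! i $ k))"
      by (simp only: of_real_sum complex_norm_square)
    finally show ?thesis .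
  qed
  have N0: "N i \<noteq> 0" if "i < n" for i
    using orth[OF that that] Nsq[of i] by auto
  have cN: "cnj (N i) = N i" for i by (simp add: N_def)
  define W where "W = mat n n (\<lambda>(k, i). ws ! i $ k / N i)"
  have "hconj W * W = 1\<^sub>m n"
  proof (rule eq_matI)
    fix i j assume "i < dim_row (1\<^sub>m n :: complex mat)" "j < dim_col (1\<^sub>m n :: complex mat)"
    then have ij: "i < n" "j < n" by auto
    have "(hconj W * W) $$ (i, j) = (\<Sum>k<n. cnj (ws ! i $ k / N i) * (ws ! j $ k / N j))"
      using ij by (simp add: W_def hconj_def scalar_prod_def lessThan_atLeast0)
    also have "\<dots> = (\<Sum>k<n. ws ! j $ k * cnj (ws ! i $ k)) / (N i * N j)"
      by (simp add: sum_divide_distrib cN mult.commute)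
    also have "\<dots> = (if i = j then 1 else 0)"
      using orth[of j i] Nsq[of i] N0[of i] ij by auto
    finally show "(hconj W * W) $$ (i, j) = 1\<^sub>m n $$ (i, j)"
      using ij by simp
  qed (auto simp: W_def hconj_def)
  moreover have "col W 0 = (1 / N 0) \<cdot>\<^sub>v v"
  proof -
    have "ws ! 0 = v" using hdws ws(3) n by (cases ws) auto
    then show ?thesis using n v by (auto simp: W_def)
  qed
  ultimately show thesis using that[of W] by (auto simp: W_def)
qed

definition diagm :: "nat \<Rightarrow> (nat \<Rightarrow> real) \<Rightarrow> complex mat" where
  "diagm n d = mat n n (\<lambda>(i, j). if i = j then complex_of_real (d i) else 0)"

text \<open>Deflation by induction on the order: a unitary matrix whose first column is an
  eigenvector turns the first column of \<open>A\<close> into a multiple of a unit vector. Hermitian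
  symmetry then clears the first row as well and makes the corner entry real, so the induction
  hypothesis applies to the remaining block.\<close>

lemma hermitian_unitary_diagonalization:
  assumes "A \<in> carrier_mat n n" "hconj A = A"
  shows "\<exists>U d. U \<in> carrier_mat n n \<and> hconj U * U = 1\<^sub>m n \<and> A = U * diagm n d * hconj U"
  using assms
proof (induction n arbitrary: A)
  case 0
  then show ?case
    by (intro exI[of _ "1\<^sub>m 0"] exI[of _ "\<lambda>_. 0"]) (auto simp: hconj_def diagm_def)
next
  case (Suc n A)
  note A = Suc.prems(1) and hA = Suc.prems(2)
  obtain e where e: "eigenvalue A e"
    using spectrum_non_empty[OF A] by (auto simp: spectrum_def)
  then obtain v where v: "v \<in> carrier_vec (Suc n)" "v \<noteq> 0\<^sub>v (Suc n)" "A *\<^sub>v v = e \<cdot>\<^sub>v v"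
    using A by (auto simp: eigenvalue_def eigenvector_def)
  obtain W c where W: "W \<in> carrier_mat (Suc n) (Suc n)" and WW: "hconj W * W = 1\<^sub>m (Suc n)"
    and Wc: "col W 0 = c \<cdot>\<^sub>v v"
    using orthonormal_basis_extending[OF v(1,2)] by blast
  have hW: "hconj W \<in> carrier_mat (Suc n) (Suc n)" using W by simp
  have WW': "W * hconj W = 1\<^sub>m (Suc n)" by (rule mat_mult_left_right_inverse[OF hW W WW])
  define A' where "A' = hconj W * A * W"
  have A': "A' \<in> carrier_mat (Suc n) (Suc n)" using mult_carrier_mat[OF mult_carrier_mat[OF hW A] W] by (simp add: A'_def)
  have hA': "hconj A' = A'"
  proof -
    have "hconj A' = hconj W * (hconj A * hconj (hconj W))"
      unfolding A'_def hconj_mult[OF mult_carrier_mat[OF hW A] W] hconj_mult[OF hW A] ..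
    then show ?thesis using assoc_mult_mat[OF hW A W] by (simp add: hA A'_def)
  qed
  have AA': "A = W * A' * hconj W"
  proof -
    have "W * A' * hconj W = W * (hconj W * (A * W)) * hconj W"
      unfolding A'_def using assoc_mult_mat[OF hW A W] by simp
    also have "W * (hconj W * (A * W)) = (W * hconj W) * (A * W)"
      by (rule assoc_mult_mat[symmetric, OF W hW mult_carrier_mat[OF A W]])
    also have "\<dots> = A * W" unfolding WW' by (rule left_mult_one_mat[OF mult_carrier_mat[OF A W]])
    also have "A * W * hconj W = A * (W * hconj W)" by (rule assoc_mult_mat[OF A W hW])
    also have "\<dots> = A" unfolding WW' by (rule right_mult_one_mat[OF A])
    finally show ?thesis ..
  qed
  have colA': "col A' 0 = e \<cdot>\<^sub>v unit_vec (Suc n) 0"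
  proof -
    have "A' = hconj W * (A * W)" unfolding A'_def by (rule assoc_mult_mat[OF hW A W])
    then have "col A' 0 = hconj W *\<^sub>v (A *\<^sub>v col W 0)"
      by (simp add: col_mult2[OF hW mult_carrier_mat[OF A W]] col_mult2[OF A W])
    also have "A *\<^sub>v col W 0 = e \<cdot>\<^sub>v col W 0"
      unfolding Wc using A v by (simp add: mult_mat_vec smult_smult_assoc mult.commute)
    also have "hconj W *\<^sub>v (e \<cdot>\<^sub>v col W 0) = e \<cdot>\<^sub>v (hconj W *\<^sub>v col W 0)"
      using W by (intro mult_mat_vec[OF hW]) (metis col_dim carrier_matD(1))
    also have "hconj W *\<^sub>v col W 0 = col (hconj W * W) 0"
      by (simp add: col_mult2[OF hW W])
    finally show ?thesis by (simp add: WW)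
  qed
  have col0: "A' $$ (i, 0) = (if i = 0 then e else 0)" if "i < Suc n" for i
    using arg_cong[OF colA', of "\<lambda>w. w $ i"] that A' by auto
  have hij: "A' $$ (i, j) = cnj (A' $$ (j, i))" if "i < Suc n" "j < Suc n" for i j
  proof -
    have "hconj A' $$ (i, j) = cnj (A' $$ (j, i))" using A' that by (simp add: hconj_def)
    then show ?thesis by (simp add: hA')
  qed
  have row0: "A' $$ (0, j) = (if j = 0 then e else 0)" if "j < Suc n" for j
    using hij[of 0 j] col0[of j] hij[of 0 0] col0[of 0] that by auto
  define a where "a = Re e"
  have ea: "e = of_real a"
    using hij[of 0 0] col0[of 0] unfolding a_def by (metis complex_cnj_cancel_iff of_real_Re complex_is_Real_iff Reals_cnj_iff zero_less_Suc)
  define B where "B = mat n n (\<lambda>(i, j). A' $$ (Suc i, Suc j))"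
  have B: "B \<in> carrier_mat n n" by (simp add: B_def)
  have "hconj B = B" by (rule eq_matI) (auto simp: hconj_def B_def intro!: hij[symmetric])
  from Suc.IH[OF B this] obtain U d where U: "U \<in> carrier_mat n n"
    and UU: "hconj U * U = 1\<^sub>m n" and BU: "B = U * diagm n d * hconj U" by blast
  have hU: "hconj U \<in> carrier_mat n n" using U by simp
  define U' where "U' = four_block_mat (1\<^sub>m 1) (0\<^sub>m 1 n) (0\<^sub>m n 1) U"
  define d' where "d' i = (case i of 0 \<Rightarrow> a | Suc i \<Rightarrow> d i)" for i
  have hU': "hconj U' = four_block_mat (1\<^sub>m 1) (0\<^sub>m 1 n) (0\<^sub>m n 1) (hconj U)"
    using U by (intro eq_matI) (auto simp: hconj_def U'_def)
  have D': "diagm (Suc n) d' = four_block_mat (mat 1 1 (\<lambda>_. of_real a)) (0\<^sub>m 1 n) (0\<^sub>m n 1) (diagm n d)"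
    by (intro eq_matI) (auto simp: diagm_def d'_def split: nat.split)
  have A'B: "A' = four_block_mat (mat 1 1 (\<lambda>_. of_real a)) (0\<^sub>m 1 n) (0\<^sub>m n 1) B"
    using A' by (intro eq_matI) (auto simp: B_def col0 row0 ea)
  have dn: "diagm n d \<in> carrier_mat n n" by (simp add: diagm_def)
  have U'c: "U' \<in> carrier_mat (Suc n) (Suc n)" using U by (auto simp: U'_def)
  have hU'c: "hconj U' \<in> carrier_mat (Suc n) (Suc n)" using U'c by simp
  have d'c: "diagm (Suc n) d' \<in> carrier_mat (Suc n) (Suc n)" by (simp add: diagm_def)
  note mfb = mult_four_block_mat[of _ 1 1 _ n _ n _ _ 1 _ n]
  have UU': "hconj U' * U' = 1\<^sub>m (Suc n)"
  proof -
    have "hconj U' * U' = four_block_mat (1\<^sub>m 1) (0\<^sub>m 1 n) (0\<^sub>m n 1) (1\<^sub>m n)"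
      unfolding hU' unfolding U'_def using U hU
      by (subst mfb) (auto simp: UU right_mult_zero_mat[OF hU])
    then show ?thesis by (auto intro!: eq_matI)
  qed
  have "U' * diagm (Suc n) d' = four_block_mat (mat 1 1 (\<lambda>_. of_real a)) (0\<^sub>m 1 n) (0\<^sub>m n 1) (U * diagm n d)"
    unfolding U'_def D' using U dn by (subst mfb) auto
  then have "U' * diagm (Suc n) d' * hconj U' = four_block_mat (mat 1 1 (\<lambda>_. of_real a)) (0\<^sub>m 1 n) (0\<^sub>m n 1) (U * diagm n d * hconj U)"
    unfolding hU' using U dn hU
    by (simp, subst mfb)
      (auto simp: left_mult_zero_mat[OF hU] left_add_zero_mat[OF mult_carrier_mat[OF mult_carrier_mat[OF U dn] hU]])
  then have A'U: "A' = U' * diagm (Suc n) d' * hconj U'" by (simp add: A'B BU)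
  let ?V = "W * U'"
  have V: "?V \<in> carrier_mat (Suc n) (Suc n)" using W U'c by simp
  have hV: "hconj ?V = hconj U' * hconj W" by (rule hconj_mult[OF W U'c])
  have "hconj ?V * ?V = 1\<^sub>m (Suc n)"
  proof -
    have "hconj ?V * ?V = hconj U' * (hconj W * (W * U'))"
      unfolding hV by (rule assoc_mult_mat[OF hU'c hW V])
    also have "hconj W * (W * U') = hconj W * W * U'"
      by (rule assoc_mult_mat[symmetric, OF hW W U'c])
    also have "\<dots> = U'" unfolding WW by (rule left_mult_one_mat[OF U'c])
    finally show ?thesis using UU' by simp
  qed
  moreover have "A = ?V * diagm (Suc n) d' * hconj ?V"
  proof -
    have "A = W * (U' * diagm (Suc n) d' * hconj U') * hconj W" using AA' A'U by simp
    also have "\<dots> = ?V * diagm (Suc n) d' * hconj ?V"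
      unfolding hV
      by (simp only: assoc_mult_mat[OF W U'c d'c] assoc_mult_mat[OF U'c d'c hU'c]
          assoc_mult_mat[OF W _ hW] assoc_mult_mat[OF U'c _ hW] assoc_mult_mat[OF d'c hU'c hW]
          assoc_mult_mat[OF W _ mult_carrier_mat[OF hU'c hW]]
          assoc_mult_mat[OF U'c d'c mult_carrier_mat[OF hU'c hW]]
          assoc_mult_mat[OF U'c mult_carrier_mat[OF d'c hU'c] hW]
          mult_carrier_mat[OF U'c mult_carrier_mat[OF d'c hU'c]]
          mult_carrier_mat[OF U'c d'c] mult_carrier_mat[OF d'c hU'c])
    finally show ?thesis .
  qed
  ultimately show ?case using V by blast
qed

text \<open>Converts the definition of the energy, a sum over distinct eigenvalues weighted by root
  order, into a sum over the diagonal entries of a diagonalisation.\<close>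

lemma sum_order_mult_prod_list_linear:
  fixes as :: "complex list" and f :: "complex \<Rightarrow> real"
  assumes "finite S" "set as \<subseteq> S"
  shows "(\<Sum>\<mu>\<in>S. real (order \<mu> (\<Prod>a\<leftarrow>as. [:- a, 1:])) * f \<mu>) = sum_list (map f as)"
  using assms(2)
proof (induction as)
  case (Cons a as)
  have nz: "(\<Prod>a\<leftarrow>as. [:- a, 1:]) \<noteq> 0" by (auto simp: prod_list_zero_iff)
  have "order \<mu> (\<Prod>a\<leftarrow>a # as. [:- a, 1:]) = (if \<mu> = a then 1 else 0) + order \<mu> (\<Prod>a\<leftarrow>as. [:- a, 1:])" for \<mu>
  proof -
    have "order \<mu> ([:- a, 1:] * (\<Prod>a\<leftarrow>as. [:- a, 1:]))
        = order \<mu> [:- a, 1:] + order \<mu> (\<Prod>a\<leftarrow>as. [:- a, 1:])"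
      using nz by (intro order_mult) (simp only: mult_eq_0_iff, simp)
    moreover have "order \<mu> [:- a, 1:] = (if \<mu> = a then 1 else 0)"
      using order_power_n_n[of a 1] by (auto simp: order_0I)
    ultimately show ?thesis by simp
  qed
  then have "(\<Sum>\<mu>\<in>S. real (order \<mu> (\<Prod>a\<leftarrow>a # as. [:- a, 1:])) * f \<mu>)
    = (\<Sum>\<mu>\<in>S. (if \<mu> = a then f \<mu> else 0)) + (\<Sum>\<mu>\<in>S. real (order \<mu> (\<Prod>a\<leftarrow>as. [:- a, 1:])) * f \<mu>)"
    unfolding sum.distrib[symmetric] by (intro sum.cong refl) (simp add: algebra_simps)
  then show ?case using Cons assms(1) by simp
qed (simp add: order_1_eq_0)

lemma spectrum_order_char_poly_cong:
  assumes "A \<in> carrier_mat n n" "B \<in> carrier_mat m m" "char_poly A = char_poly (B :: complex mat)"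
  shows "spectrum A = spectrum B"
  using spectrum_root_char_poly[OF assms(1)] spectrum_root_char_poly[OF assms(2)] assms(3) by simp

lemma adj_mat_carrier: "adj_mat G vs \<in> carrier_mat (length vs) (length vs)"
  by (simp add: adj_mat_def)

text \<open>The characteristic polynomial depends neither on the enumeration of the vertices nor on
  the basis, so the energy can be read off any diagonalisation for any enumeration
  \<open>vs\<close>.\<close>

lemma energy_eq_sum_abs:
  assumes vs: "distinct vs" "set vs = pverts G" and n: "n = length vs"
    and U: "U \<in> carrier_mat n n" "hconj U * U = 1\<^sub>m n" "adj_mat G vs = U * diagm n d * hconj U"
  shows "energy G = (\<Sum>i<n. \<bar>d i\<bar>)"
proof -
  let ?A = "adjacency_matrix G" and ?D = "diagm n d"
  have D: "?D \<in> carrier_mat n n" by (simp add: diagm_def)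
  have "similar_mat (adj_mat G vs) ?D"
    by (rule similar_matI[OF _ mat_mult_left_right_inverse[OF _ _ U(2)] U(2,3)])
       (use U(1) D adj_mat_carrier[of G vs] n in auto)
  then have "char_poly (adj_mat G vs) = char_poly ?D" by (rule char_poly_similar)
  then have cp: "char_poly ?A = char_poly ?D"
    using char_poly_adjacency_matrix[OF vs] by simp
  have cpD: "char_poly ?D = (\<Prod>a\<leftarrow>diag_mat ?D. [:- a, 1:])"
    by (rule char_poly_upper_triangular[OF D]) (auto simp: diagm_def)
  have A: "?A \<in> carrier_mat (length (SOME vs. distinct vs \<and> set vs = pverts G)) (length (SOME vs. distinct vs \<and> set vs = pverts G))"
    unfolding adjacency_matrix_def by (rule adj_mat_carrier)
  have S: "spectrum ?A = spectrum ?D" by (rule spectrum_order_char_poly_cong[OF A D cp])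
  have fin: "finite (spectrum ?D)" using card_finite_spectrum[OF D] by simp
  have "set (diag_mat ?D) \<subseteq> spectrum ?D"
    unfolding spectrum_root_char_poly[OF D] cpD by (auto simp: poly_prod_list prod_list_zero_iff)
  from sum_order_mult_prod_list_linear[OF fin this, of cmod]
  have "energy G = sum_list (map cmod (diag_mat ?D))"
    unfolding energy_def Let_def S cp cpD .
  also have "\<dots> = (\<Sum>i<n. \<bar>d i\<bar>)"
    by (simp add: diag_mat_def diagm_def sum_list_distinct_conv_sum_set o_def lessThan_atLeast0
        interv_sum_list_conv_sum_set_nat cong: map_cong)
  finally show ?thesis .
qed

section \<open>Real quadratic forms indexed by vertices, and the spectral decomposition in terms of
  them\<close>

definition qf :: "'a set \<Rightarrow> ('a \<Rightarrow> 'a \<Rightarrow> real) \<Rightarrow> ('a \<Rightarrow> real) \<Rightarrow> real" where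
  "qf V X z = (\<Sum>u\<in>V. \<Sum>v\<in>V. X u v * z u * z v)"

definition adjf :: "'a rel \<Rightarrow> 'a \<Rightarrow> 'a \<Rightarrow> real" where
  "adjf E u v = (if (u, v) \<in> E then 1 else 0)"

text \<open>The real and imaginary parts \<open>a i\<close>, \<open>b i\<close> of a unitary eigenbasis are kept side by side, so
  that no real eigenbasis has to be chosen.\<close>

lemma spectral_decomposition:
  fixes G :: "'a pair_pre_digraph"
  assumes G: "pair_graph G"
  obtains n :: nat and d :: "nat \<Rightarrow> real" and a b :: "nat \<Rightarrow> 'a \<Rightarrow> real" where
    "energy G = (\<Sum>i<n. \<bar>d i\<bar>)" "(\<Sum>i<n. d i) = 0"
    "\<And>i. i < n \<Longrightarrow> (\<Sum>v\<in>pverts G. (a i v)\<^sup>2 + (b i v)\<^sup>2) = 1"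
    "\<And>u v. u \<in> pverts G \<Longrightarrow> v \<in> pverts G \<Longrightarrow>
       (\<Sum>i<n. a i u * a i v + b i u * b i v) = (if u = v then 1 else 0)"
    "\<And>u v. u \<in> pverts G \<Longrightarrow> v \<in> pverts G \<Longrightarrow>
       adjf (parcs G) u v = (\<Sum>i<n. d i * (a i u * a i v + b i u * b i v))"
    "\<And>i. i < n \<Longrightarrow> qf (pverts G) (adjf (parcs G)) (a i) + qf (pverts G) (adjf (parcs G)) (b i) = d i"
proof -
  interpret pair_graph G by fact
  let ?V = "pverts G"
  obtain vs where vs: "distinct vs" "set vs = ?V"
    using finite_distinct_list[OF finite_verts] by auto
  define n where "n = length vs"
  let ?A = "adj_mat G vs"
  have A: "?A \<in> carrier_mat n n" using adj_mat_carrier by (simp add: n_def)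
  have "hconj ?A = ?A"
    using arcs_symmetric by (intro eq_matI) (auto simp: hconj_def adj_mat_def)
  then obtain U d where U: "U \<in> carrier_mat n n" "hconj U * U = 1\<^sub>m n"
    and AU: "?A = U * diagm n d * hconj U"
    using hermitian_unitary_diagonalization[OF A] by blast
  have UU: "U * hconj U = 1\<^sub>m n"
    by (rule mat_mult_left_right_inverse[OF _ U(1) U(2)]) (use U in simp)
  have bij: "bij_betw ((!) vs) {..<n} ?V" using bij_betw_nth[OF vs(1)] vs(2) n_def by auto
  define ix where "ix = inv_into {..<n} ((!) vs)"
  have ixn: "ix v < n" and vix: "vs ! ix v = v" if "v \<in> ?V" for v
    using that bij bij_betw_inv_into_right[OF bij that] bij_betw_inv_into[OF bij]
    unfolding ix_def by (auto simp: bij_betw_def)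
  have ixv: "ix (vs ! k) = k" if "k < n" for k
    using that bij_betw_inv_into_left[OF bij, of k] by (simp add: ix_def)
  have ixeq: "ix u = ix v \<longleftrightarrow> u = v" if "u \<in> ?V" "v \<in> ?V" for u v
    using vix that by metis
  define f where "f i v = U $$ (ix v, i)" for i v
  have orth1: "(\<Sum>v\<in>?V. cnj (f i v) * f j v) = (if i = j then 1 else 0)" if "i < n" "j < n" for i j
  proof -
    have "(\<Sum>v\<in>?V. cnj (f i v) * f j v) = (\<Sum>k<n. cnj (U $$ (k, i)) * U $$ (k, j))"
      using ixv by (subst sum.reindex_bij_betw[OF bij, symmetric]) (simp add: f_def)
    also have "\<dots> = (hconj U * U) $$ (i, j)"
      using U(1) that by (simp add: hconj_def scalar_prod_def lessThan_atLeast0)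
    finally show ?thesis using that by (simp add: U(2))
  qed
  have orth2: "(\<Sum>i<n. f i u * cnj (f i v)) = (if u = v then 1 else 0)" if "u \<in> ?V" "v \<in> ?V" for u v
  proof -
    have "(\<Sum>i<n. f i u * cnj (f i v)) = (U * hconj U) $$ (ix u, ix v)"
      using U(1) that ixn by (simp add: hconj_def scalar_prod_def lessThan_atLeast0 f_def)
    then show ?thesis using that ixn ixeq by (simp add: UU)
  qed
  have dec: "complex_of_real (adjf (parcs G) u v) = (\<Sum>i<n. of_real (d i) * (f i u * cnj (f i v)))"
    if "u \<in> ?V" "v \<in> ?V" for u v
  proof -
    have "complex_of_real (adjf (parcs G) u v) = ?A $$ (ix u, ix v)"
      using that ixn vix by (simp add: adj_mat_def adjf_def n_def)
    also have "?A $$ (ix u, ix v) = (\<Sum>i<n. (U * diagm n d) $$ (ix u, i) * cnj (U $$ (ix v, i)))"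
      unfolding AU using U(1) that ixn
      by (simp add: scalar_prod_def lessThan_atLeast0 hconj_def diagm_def)
    also have "\<dots> = (\<Sum>i<n. of_real (d i) * (f i u * cnj (f i v)))"
      using U(1) that ixn
      by (intro sum.cong) (auto simp: scalar_prod_def diagm_def f_def sum.delta if_distrib cong: if_cong)
    finally show ?thesis .
  qed
  define a where "a i v = Re (f i v)" for i v
  define b where "b i v = Im (f i v)" for i v
  have Re1: "a i u * a i v + b i u * b i v = Re (f i u * cnj (f i v))" for i u v
    by (simp add: a_def b_def)
  have norm: "(\<Sum>v\<in>?V. (a i v)\<^sup>2 + (b i v)\<^sup>2) = 1" if "i < n" for i
    using arg_cong[OF orth1[OF that that], of Re] by (simp add: a_def b_def power2_eq_square)
  moreover note norm
  moreover have "(\<Sum>i<n. a i u * a i v + b i u * b i v) = (if u = v then 1 else 0)"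
    if "u \<in> ?V" "v \<in> ?V" for u v
    unfolding Re1 using arg_cong[OF orth2[OF that], of Re] by simp
  moreover have dec': "adjf (parcs G) u v = (\<Sum>i<n. d i * (a i u * a i v + b i u * b i v))"
    if "u \<in> ?V" "v \<in> ?V" for u v
    unfolding Re1 using arg_cong[OF dec[OF that], of Re] by simp
  moreover have "qf ?V (adjf (parcs G)) (a i) + qf ?V (adjf (parcs G)) (b i) = d i" if i: "i < n" for i
  proof -
    have "(\<Sum>v\<in>?V. complex_of_real (adjf (parcs G) u v) * f i v) = of_real (d i) * f i u" if u: "u \<in> ?V" for u
    proof -
      have "(\<Sum>v\<in>?V. complex_of_real (adjf (parcs G) u v) * f i v)
          = (\<Sum>v\<in>?V. \<Sum>j<n. of_real (d j) * f j u * (cnj (f j v) * f i v))"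
        using u by (intro sum.cong) (auto simp: dec sum_distrib_right sum_distrib_left mult_ac)
      also have "\<dots> = (\<Sum>j<n. of_real (d j) * f j u * (\<Sum>v\<in>?V. cnj (f j v) * f i v))"
        by (subst sum.swap) (simp add: sum_distrib_left)
      also have "\<dots> = (\<Sum>j<n. if j = i then of_real (d j) * f j u else 0)"
        using i by (intro sum.cong) (auto simp: orth1)
      finally show ?thesis using i by simp
    qed
    then have "(\<Sum>u\<in>?V. cnj (f i u) * (\<Sum>v\<in>?V. complex_of_real (adjf (parcs G) u v) * f i v))
        = of_real (d i) * (\<Sum>u\<in>?V. cnj (f i u) * f i u)"
      by (simp add: sum_distrib_left mult_ac)
    also have "\<dots> = of_real (d i)" using orth1[OF i i] by simp
    finally have "d i = Re (\<Sum>u\<in>?V. cnj (f i u) * (\<Sum>v\<in>?V. complex_of_real (adjf (parcs G) u v) * f i v))"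
      by simp
    also have "\<dots> = qf ?V (adjf (parcs G)) (a i) + qf ?V (adjf (parcs G)) (b i)"
      unfolding qf_def sum.distrib[symmetric] sum_distrib_left Re_sum
      by (intro sum.cong refl) (simp add: a_def b_def algebra_simps)
    finally show ?thesis ..
  qed
  moreover have "(\<Sum>i<n. d i) = 0"
  proof -
    have "(\<Sum>i<n. d i) = (\<Sum>i<n. \<Sum>v\<in>?V. d i * (a i v * a i v + b i v * b i v))"
      using norm by (simp add: sum_distrib_left[symmetric] power2_eq_square)
    also have "\<dots> = (\<Sum>v\<in>?V. \<Sum>i<n. d i * (a i v * a i v + b i v * b i v))"
      by (rule sum.swap)
    also have "\<dots> = (\<Sum>v\<in>?V. adjf (parcs G) v v)" by (simp add: dec')
    also have "\<dots> = 0"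
      using pair_no_loops by (intro sum.neutral) (force simp: adjf_def)
    finally show ?thesis .
  qed
  ultimately show thesis
    using that[of d n a b] energy_eq_sum_abs[OF vs n_def U(1,2) AU] by blast
qed

section \<open>The semidefinite lower and upper bounds for half the energy\<close>

definition feasible :: "'a set \<Rightarrow> ('a \<Rightarrow> 'a \<Rightarrow> real) \<Rightarrow> bool" where
  "feasible V X \<longleftrightarrow> (\<forall>z. 0 \<le> qf V X z \<and> qf V X z \<le> (\<Sum>v\<in>V. (z v)\<^sup>2))"

text \<open>The trace pairing of two forms, computed in the eigenbasis of the first. It is applied
  to the adjacency form and also, with all weights \<open>d i\<close> equal to 1, to the identity,
  where the pairing becomes a trace.\<close>

lemma sum_adjf_eq_sum_eigen:
  assumes "\<And>u v. u \<in> V \<Longrightarrow> v \<in> V \<Longrightarrow> A u v = (\<Sum>i<n. d i * (a i u * a i v + b i u * b i v))"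
  shows "(\<Sum>u\<in>V. \<Sum>v\<in>V. A u v * X u v) = (\<Sum>i<n. d i * (qf V X (a i) + qf V X (b i)))"
proof -
  have "(\<Sum>u\<in>V. \<Sum>v\<in>V. A u v * X u v)
      = (\<Sum>u\<in>V. \<Sum>v\<in>V. \<Sum>i<n. d i * (X u v * a i u * a i v + X u v * b i u * b i v))"
    using assms by (intro sum.cong) (auto simp: sum_distrib_right sum_distrib_left algebra_simps)
  also have "\<dots> = (\<Sum>u\<in>V. \<Sum>i<n. \<Sum>v\<in>V. d i * (X u v * a i u * a i v + X u v * b i u * b i v))"
    by (intro sum.cong refl sum.swap)
  also have "\<dots> = (\<Sum>i<n. \<Sum>u\<in>V. \<Sum>v\<in>V. d i * (X u v * a i u * a i v + X u v * b i u * b i v))"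
    by (rule sum.swap)
  also have "\<dots> = (\<Sum>i<n. d i * (qf V X (a i) + qf V X (b i)))"
    by (simp add: qf_def sum_distrib_left sum.distrib algebra_simps)
  finally show ?thesis .
qed

text \<open>In the eigenbasis each eigenvalue \<open>d i\<close> receives a weight
  \<open>c i\<close> in [0, 1], because the real and imaginary parts of a unit eigenvector have
  squared norms adding to 1. The pairing is thus at most the sum of the positive eigenvalues, which
  is half the energy as the trace vanishes.\<close>

lemma feasible_le_energy:
  assumes G: "pair_graph G" and X: "feasible (pverts G) X"
  shows "(\<Sum>u\<in>pverts G. \<Sum>v\<in>pverts G. adjf (parcs G) u v * X u v) \<le> energy G / 2"
proof -
  interpret pair_graph G by fact
  let ?V = "pverts G" and ?A = "adjf (parcs G)"
  obtain n :: nat and d a b where sd: "energy G = (\<Sum>i<n. \<bar>d i\<bar>)" and tr: "(\<Sum>i<n. d i) = 0"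
    and norm: "\<And>i. i < n \<Longrightarrow> (\<Sum>v\<in>?V. (a i v)\<^sup>2 + (b i v)\<^sup>2) = 1"
    and unit: "\<And>u v. u \<in> ?V \<Longrightarrow> v \<in> ?V \<Longrightarrow> (\<Sum>i<n. a i u * a i v + b i u * b i v) = (if u = v then 1 else 0)"
    and dec: "\<And>u v. u \<in> ?V \<Longrightarrow> v \<in> ?V \<Longrightarrow> ?A u v = (\<Sum>i<n. d i * (a i u * a i v + b i u * b i v))"
    and eig: "\<And>i. i < n \<Longrightarrow> qf ?V ?A (a i) + qf ?V ?A (b i) = d i"
    by (rule spectral_decomposition[OF G]) blast
  define c where "c i = qf ?V X (a i) + qf ?V X (b i)" for i
  have c: "0 \<le> c i" "c i \<le> 1" if "i < n" for i
    using X norm[OF that] unfolding feasible_def c_def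
    by (auto simp: sum.distrib intro!: add_nonneg_nonneg) (metis add_mono)
  have "(\<Sum>u\<in>?V. \<Sum>v\<in>?V. ?A u v * X u v) = (\<Sum>i<n. d i * c i)"
    unfolding c_def by (rule sum_adjf_eq_sum_eigen) (rule dec)
  also have "\<dots> \<le> (\<Sum>i<n. (\<bar>d i\<bar> + d i) / 2)"
  proof (rule sum_mono)
    fix i assume "i \<in> {..<n}"
    then show "d i * c i \<le> (\<bar>d i\<bar> + d i) / 2"
      using c[of i] mult_left_le[of "c i" "d i"] mult_nonpos_nonneg[of "d i" "c i"]
      by (cases "d i \<ge> 0") auto
  qed
  also have "\<dots> = energy G / 2"
    using tr sd by (simp add: sum_divide_distrib[symmetric] sum.distrib)
  finally show ?thesis .
qed

text \<open>Weak duality: on a unit eigenvector for \<open>d i\<close> the form of \<open>Y\<close>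
  is at least 0 and at least \<open>- d i\<close>. Summing over the eigenbasis bounds the negative
  part of the spectrum, again half the energy, by the trace of \<open>Y\<close>.\<close>

lemma energy_le_trace:
  assumes G: "pair_graph G" and Y: "\<And>z. 0 \<le> qf (pverts G) Y z"
    and AY: "\<And>z. 0 \<le> qf (pverts G) (adjf (parcs G)) z + qf (pverts G) Y z"
  shows "energy G / 2 \<le> (\<Sum>v\<in>pverts G. Y v v)"
proof -
  interpret pair_graph G by fact
  let ?V = "pverts G" and ?A = "adjf (parcs G)"
  obtain n :: nat and d a b where sd: "energy G = (\<Sum>i<n. \<bar>d i\<bar>)" and tr: "(\<Sum>i<n. d i) = 0"
    and norm: "\<And>i. i < n \<Longrightarrow> (\<Sum>v\<in>?V. (a i v)\<^sup>2 + (b i v)\<^sup>2) = 1"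
    and unit: "\<And>u v. u \<in> ?V \<Longrightarrow> v \<in> ?V \<Longrightarrow> (\<Sum>i<n. a i u * a i v + b i u * b i v) = (if u = v then 1 else 0)"
    and dec: "\<And>u v. u \<in> ?V \<Longrightarrow> v \<in> ?V \<Longrightarrow> ?A u v = (\<Sum>i<n. d i * (a i u * a i v + b i u * b i v))"
    and eig: "\<And>i. i < n \<Longrightarrow> qf ?V ?A (a i) + qf ?V ?A (b i) = d i"
    by (rule spectral_decomposition[OF G]) blast
  have "energy G / 2 = (\<Sum>i<n. (\<bar>d i\<bar> - d i) / 2)"
    using tr sd by (simp add: sum_divide_distrib[symmetric] sum_subtractf)
  also have "\<dots> \<le> (\<Sum>i<n. 1 * (qf ?V Y (a i) + qf ?V Y (b i)))"
  proof (rule sum_mono)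
    fix i assume "i \<in> {..<n}"
    then show "(\<bar>d i\<bar> - d i) / 2 \<le> 1 * (qf ?V Y (a i) + qf ?V Y (b i))"
      using eig[of i] Y[of "a i"] Y[of "b i"] AY[of "a i"] AY[of "b i"] by auto
  qed
  also have "\<dots> = (\<Sum>u\<in>?V. \<Sum>v\<in>?V. (if u = v then 1 else 0) * Y u v)"
    by (rule sum_adjf_eq_sum_eigen[symmetric]) (use unit in simp)
  also have "\<dots> = (\<Sum>v\<in>?V. Y v v)"
    using finite_verts by (simp add: if_distrib if_distribR sum.delta cong: if_cong)
  finally show ?thesis .
qed

section \<open>Lower bounds by test vectors\<close>

text \<open>The vertex set is deliberately not fixed. Every notion takes a set \<open>W\<close> and
  refers to the subgraph induced on it, so that passing to induced subgraphs is merely a change of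
  argument.\<close>

locale simple_graph =
  fixes E :: "'a rel"
  assumes adj_sym: "(u, v) \<in> E \<Longrightarrow> (v, u) \<in> E"
    and adj_irrefl [simp]: "(v, v) \<notin> E"
begin

lemma adj_commute: "(u, v) \<in> E \<longleftrightarrow> (v, u) \<in> E"
  using adj_sym by blast

definition adj_val :: "'a set \<Rightarrow> ('a \<Rightarrow> 'a \<Rightarrow> real) \<Rightarrow> real" where
  "adj_val W X = (\<Sum>u\<in>W. \<Sum>v\<in>W. adjf E u v * X u v)"

text \<open>\<open>pos_ge W r\<close>: the positive eigenvalues of the subgraph induced on \<open>W\<close> sum to at least \<open>r\<close>.\<close>

definition pos_ge :: "'a set \<Rightarrow> real \<Rightarrow> bool" where
  "pos_ge W r \<longleftrightarrow> (\<exists>X. feasible W X \<and> r \<le> adj_val W X)"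

definition ip :: "'a set \<Rightarrow> ('a \<Rightarrow> real) \<Rightarrow> ('a \<Rightarrow> real) \<Rightarrow> real" where
  "ip W x y = (\<Sum>v\<in>W. x v * y v)"

abbreviation qA :: "'a set \<Rightarrow> ('a \<Rightarrow> real) \<Rightarrow> real" where
  "qA W \<equiv> qf W (adjf E)"

lemma ip_commute: "ip W x y = ip W y x"
  by (simp add: ip_def mult.commute)

lemma ip_self_nonneg: "0 \<le> ip W x x"
  by (simp add: ip_def sum_nonneg)

lemma pos_geI: "feasible W X \<Longrightarrow> r \<le> adj_val W X \<Longrightarrow> pos_ge W r"
  by (auto simp: pos_ge_def)

lemma pos_ge_le: "pos_ge W r \<Longrightarrow> s \<le> r \<Longrightarrow> pos_ge W s"
  by (auto simp: pos_ge_def)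

lemma qf_restrict:
  assumes "finite W" "S \<subseteq> W" "\<And>u v. u \<in> W \<Longrightarrow> v \<in> W \<Longrightarrow> u \<notin> S \<or> v \<notin> S \<Longrightarrow> X u v * z u * z v = 0"
  shows "qf W X z = qf S X z"
proof -
  have "qf W X z = (\<Sum>u\<in>S. \<Sum>v\<in>W. X u v * z u * z v)"
    unfolding qf_def using assms by (intro sum.mono_neutral_right) (auto intro!: sum.neutral)
  also have "\<dots> = qf S X z"
    unfolding qf_def using assms by (intro sum.cong refl sum.mono_neutral_right) auto
  finally show ?thesis .
qed

text \<open>The block diagonal combination of the two witnesses is feasible. Edges between
  \<open>A\<close> and \<open>B\<close> meet zero entries and do not affect its value.\<close>

lemma pos_ge_union:
  assumes fin: "finite A" "finite B" and dis: "A \<inter> B = {}" and A: "pos_ge A r" and B: "pos_ge B s"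
  shows "pos_ge (A \<union> B) (r + s)"
proof -
  obtain X Y where X: "feasible A X" "r \<le> adj_val A X" and Y: "feasible B Y" "s \<le> adj_val B Y"
    using A B by (auto simp: pos_ge_def)
  define Z where "Z u v = (if u \<in> A \<and> v \<in> A then X u v else if u \<in> B \<and> v \<in> B then Y u v else 0)" for u v
  have split: "(\<Sum>u\<in>A \<union> B. \<Sum>v\<in>A \<union> B. c u v * Z u v)
      = (\<Sum>u\<in>A. \<Sum>v\<in>A. c u v * X u v) + (\<Sum>u\<in>B. \<Sum>v\<in>B. c u v * Y u v)" for c :: "'a \<Rightarrow> 'a \<Rightarrow> real"
  proof -
    have 1: "(\<Sum>v\<in>A \<union> B. c u v * Z u v) = (\<Sum>v\<in>A. c u v * X u v)" if "u \<in> A" for u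
      using that dis fin by (subst sum.union_disjoint) (auto simp: Z_def intro!: sum.neutral)
    have 2: "(\<Sum>v\<in>A \<union> B. c u v * Z u v) = (\<Sum>v\<in>B. c u v * Y u v)" if "u \<in> B" for u
    proof -
      have "u \<notin> A" using that dis by auto
      moreover have "(\<Sum>v\<in>B. c u v * Z u v) = (\<Sum>v\<in>B. c u v * Y u v)"
        using that dis by (intro sum.cong) (auto simp: Z_def)
      ultimately show ?thesis
        using that dis fin by (subst sum.union_disjoint) (auto simp: Z_def intro!: sum.neutral)
    qed
    show ?thesis
      using dis fin by (subst sum.union_disjoint) (auto simp: 1 2)
  qed
  have q: "qf (A \<union> B) Z z = qf A X z + qf B Y z" for z
    using split[of "\<lambda>u v. z u * z v"] by (simp add: qf_def mult_ac)
  have "feasible (A \<union> B) Z"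
    using X(1) Y(1) fin dis unfolding feasible_def q
    by (auto simp: sum.union_disjoint intro: add_nonneg_nonneg add_mono)
  moreover have "adj_val (A \<union> B) Z = adj_val A X + adj_val B Y"
    using split[of "adjf E"] by (simp add: adj_val_def)
  ultimately show ?thesis using X(2) Y(2) by (intro pos_geI[of _ Z]) auto
qed

lemma pos_ge_0: "pos_ge W 0"
  by (rule pos_geI[of _ "\<lambda>_ _. 0"]) (auto simp: feasible_def qf_def adj_val_def sum_nonneg)

lemma pos_ge_mono:
  assumes "finite W" "S \<subseteq> W" "pos_ge S r"
  shows "pos_ge W r"
proof -
  have "pos_ge (S \<union> (W - S)) (r + 0)"
    using assms by (intro pos_ge_union pos_ge_0) (auto intro: finite_subset)
  then show ?thesis using assms(2) by (simp add: Un_absorb1)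
qed

lemma pos_ge_add:
  assumes "finite W" "A \<subseteq> W" "B \<subseteq> W" "A \<inter> B = {}" "pos_ge A r" "pos_ge B s" "c \<le> r + s"
  shows "pos_ge W c"
proof -
  have "finite A" "finite B" using assms finite_subset by blast+
  then have "pos_ge (A \<union> B) (r + s)" using assms pos_ge_union by blast
  then show ?thesis using pos_ge_mono[of W "A \<union> B" "r + s"] assms pos_ge_le by blast
qed

lemma not_pos_ge_diff:
  assumes "finite W" "A \<subseteq> W" "pos_ge A r" "\<not> pos_ge W c"
  shows "\<not> pos_ge (W - A) (c - r)"
  using pos_ge_add[of W A "W - A" r "c - r" c] assms by auto

text \<open>The adjacency matrix has zero diagonal, so the complement \<open>I - X\<close> of a
  feasible \<open>X\<close> is feasible with the opposite value. Lower bounds can therefore also be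
  collected from negative eigenvalues.\<close>

lemma pos_ge_neg:
  assumes fin: "finite W" and X: "feasible W X" and r: "r \<le> - adj_val W X"
  shows "pos_ge W r"
proof -
  define Y where "Y u v = (if u = v then 1 else 0) - X u v" for u v
  have "qf W Y z = (\<Sum>v\<in>W. (z v)\<^sup>2) - qf W X z" for z
  proof -
    have "(\<Sum>v\<in>W. (if u = v then 1 else 0) * z u * z v) = (if u \<in> W then (z u)\<^sup>2 else 0)" for u
      using fin by (simp add: if_distrib if_distribR sum.delta power2_eq_square cong: if_cong)
    then show ?thesis
      by (simp add: qf_def Y_def left_diff_distrib sum_subtractf)
  qed
  then have "feasible W Y" using X by (auto simp: feasible_def)
  moreover have "adj_val W Y = - adj_val W X"
    unfolding adj_val_def sum_negf[symmetric]
    by (intro sum.cong refl) (auto simp: Y_def adjf_def)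
  ultimately show ?thesis using r by (intro pos_geI[of _ Y]) auto
qed

section \<open>Orthogonal families and sums of Rayleigh quotients\<close>

definition orth :: "'a set \<Rightarrow> ('a \<Rightarrow> real) list \<Rightarrow> bool" where
  "orth W vs \<longleftrightarrow> sorted_wrt (\<lambda>x y. ip W x y = 0) vs \<and> (\<forall>x\<in>set vs. 0 < ip W x x)"

lemma orth_Nil [simp]: "orth W []"
  by (simp add: orth_def)

lemma orth_Cons [simp]: "orth W (x # vs) \<longleftrightarrow> 0 < ip W x x \<and> (\<forall>y\<in>set vs. ip W x y = 0) \<and> orth W vs"
  by (auto simp: orth_def)

lemma orth_append:
  "orth W (xs @ ys) \<longleftrightarrow> orth W xs \<and> orth W ys \<and> (\<forall>x\<in>set xs. \<forall>y\<in>set ys. ip W x y = 0)"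
  by (auto simp: orth_def sorted_wrt_append)

text \<open>Bessel's inequality for vectors that need not be normalised; it supplies the upper half
  of feasibility in \<open>orth_feasible_val\<close>.\<close>

lemma bessel:
  assumes "orth W vs"
  shows "(\<Sum>x\<leftarrow>vs. (ip W x z)\<^sup>2 / ip W x x) \<le> ip W z z"
  using assms
proof (induction vs arbitrary: z)
  case Nil
  then show ?case by (simp add: ip_self_nonneg)
next
  case (Cons x vs)
  define c where "c = ip W x z / ip W x x"
  define z' where "z' v = z v - c * x v" for v
  have lin: "ip W y z' = ip W y z - c * ip W y x" for y
    by (simp add: ip_def z'_def algebra_simps sum_subtractf sum_distrib_left)
  have y: "ip W y z' = ip W y z" if "y \<in> set vs" for y
    using Cons.prems that by (simp add: lin ip_commute[of W y x])
  have "(\<Sum>y\<leftarrow>vs. (ip W y z)\<^sup>2 / ip W y y) = (\<Sum>y\<leftarrow>vs. (ip W y z')\<^sup>2 / ip W y y)"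
    using y by (intro arg_cong[of _ _ sum_list] map_cong) auto
  also have "\<dots> \<le> ip W z' z'" using Cons by simp
  also have "ip W z' z' = ip W z z - 2 * c * ip W x z + c\<^sup>2 * ip W x x"
    by (simp add: ip_def z'_def algebra_simps sum_subtractf sum.distrib sum_distrib_left power2_eq_square)
  also have "\<dots> = ip W z z - (ip W x z)\<^sup>2 / ip W x x"
    using Cons.prems by (simp add: c_def power2_eq_square field_simps)
  finally show ?case by simp
qed

text \<open>\<open>X\<close> is the orthogonal projection onto the span of \<open>vs\<close>;
  pairing it with the adjacency matrix gives the sum of the Rayleigh quotients.\<close>

lemma orth_feasible_val:
  assumes fin: "finite W" and orth: "orth W vs"
  obtains X where "feasible W X" "adj_val W X = (\<Sum>x\<leftarrow>vs. qA W x / ip W x x)"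
proof -
  define X where "X u v = (\<Sum>x\<leftarrow>vs. x u * x v / ip W x x)" for u v
  have sw: "(\<Sum>u\<in>W. \<Sum>v\<in>W. c u v * X u v) = (\<Sum>x\<leftarrow>vs. (\<Sum>u\<in>W. \<Sum>v\<in>W. c u v * x u * x v) / ip W x x)"
    for c :: "'a \<Rightarrow> 'a \<Rightarrow> real"
    unfolding X_def by (induction vs) (simp_all add: sum.distrib distrib_left sum_divide_distrib mult_ac)
  have "qf W X z = (\<Sum>x\<leftarrow>vs. (ip W x z)\<^sup>2 / ip W x x)" for z
  proof -
    have "qf W X z = (\<Sum>u\<in>W. \<Sum>v\<in>W. (z u * z v) * X u v)" by (simp add: qf_def mult_ac)
    also have "\<dots> = (\<Sum>x\<leftarrow>vs. (\<Sum>u\<in>W. \<Sum>v\<in>W. z u * z v * x u * x v) / ip W x x)" by (rule sw)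
    also have "(\<lambda>x. (\<Sum>u\<in>W. \<Sum>v\<in>W. z u * z v * x u * x v)) = (\<lambda>x. (ip W x z)\<^sup>2)"
      by (simp add: ip_def power2_eq_square sum_product mult_ac)
    finally show ?thesis .
  qed
  moreover have "0 \<le> (\<Sum>x\<leftarrow>vs. (ip W x z)\<^sup>2 / ip W x x)" for z
    by (intro sum_list_nonneg) (auto simp: ip_self_nonneg)
  moreover have "ip W z z = (\<Sum>v\<in>W. (z v)\<^sup>2)" for z by (simp add: ip_def power2_eq_square)
  ultimately have "feasible W X" using bessel[OF orth] by (simp add: feasible_def)
  moreover have "adj_val W X = (\<Sum>x\<leftarrow>vs. qA W x / ip W x x)"
    unfolding adj_val_def sw by (simp add: qf_def)
  ultimately show thesis by (rule that)
qed

lemma pos_ge_orth: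
  assumes "finite W" "orth W vs" "r \<le> (\<Sum>x\<leftarrow>vs. qA W x / ip W x x)"
  shows "pos_ge W r"
  using orth_feasible_val[OF assms(1,2)] assms(3) pos_geI by metis

lemma pos_ge_orth_neg:
  assumes "finite W" "orth W vs" "r \<le> - (\<Sum>x\<leftarrow>vs. qA W x / ip W x x)"
  shows "pos_ge W r"
  using orth_feasible_val[OF assms(1,2)] assms(1,3) pos_ge_neg by metis

section \<open>Cliques, average degree, and vectors of sum zero\<close>

definition clique :: "'a set \<Rightarrow> bool" where
  "clique Q \<longleftrightarrow> (\<forall>u\<in>Q. \<forall>v\<in>Q. u \<noteq> v \<longrightarrow> (u, v) \<in> E)"

definition indep :: "'a set \<Rightarrow> bool" where
  "indep R \<longleftrightarrow> (\<forall>u\<in>R. \<forall>v\<in>R. (u, v) \<notin> E)"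

definition nbrs :: "'a set \<Rightarrow> 'a \<Rightarrow> 'a set" where
  "nbrs W v = {u \<in> W. (v, u) \<in> E}"

lemma clique_subset: "clique Q \<Longrightarrow> S \<subseteq> Q \<Longrightarrow> clique S"
  by (auto simp: clique_def)

lemma clique_insert: "clique (insert v Q) \<longleftrightarrow> clique Q \<and> (\<forall>u\<in>Q. u \<noteq> v \<longrightarrow> (v, u) \<in> E)"
  using adj_commute by (auto simp: clique_def)

lemma qA_indicator:
  assumes "finite W" "S \<subseteq> W"
  shows "qA W (\<lambda>v. if v \<in> S then 1 else 0) = (\<Sum>v\<in>S. real (card (nbrs S v)))"
proof -
  have fS: "finite S" using assms finite_subset by blast
  have "qA W (\<lambda>v. if v \<in> S then 1 else 0) = qA S (\<lambda>v. if v \<in> S then 1 else 0)"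
    by (rule qf_restrict[OF assms]) auto
  also have "\<dots> = (\<Sum>u\<in>S. \<Sum>v\<in>S. if (u, v) \<in> E then 1 else 0)"
    unfolding qf_def by (intro sum.cong refl) (auto simp: adjf_def)
  also have "\<dots> = (\<Sum>u\<in>S. real (card (nbrs S u)))"
    using fS by (intro sum.cong refl) (simp add: nbrs_def sum.If_cases Int_def)
  finally show ?thesis .
qed

lemma ip_indicator:
  assumes "finite W" "S \<subseteq> W"
  shows "ip W (\<lambda>v. if v \<in> S then 1 else 0) y = sum y S"
proof -
  have "ip W (\<lambda>v. if v \<in> S then 1 else 0) y = (\<Sum>v\<in>S. (if v \<in> S then 1 else 0) * y v)"
    unfolding ip_def using assms by (intro sum.mono_neutral_right) auto
  then show ?thesis by simp
qed

lemma clique_card_nbrs: "finite Q \<Longrightarrow> clique Q \<Longrightarrow> v \<in> Q \<Longrightarrow> card (nbrs Q v) = card Q - 1"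
  by (subst card_Diff_singleton[symmetric]) (auto simp: nbrs_def clique_def intro!: arg_cong[of _ _ card])

text \<open>The Rayleigh quotient of the all-ones vector is the average degree, which is at least
  the minimum degree.\<close>

lemma pos_ge_min_degree:
  assumes "finite W" "W \<noteq> {}" "\<And>v. v \<in> W \<Longrightarrow> c \<le> real (card (nbrs W v))"
  shows "pos_ge W c"
proof -
  let ?x = "\<lambda>v. if v \<in> W then 1 else 0 :: real"
  have n: "0 < card W" using assms by (simp add: card_gt_0_iff)
  have ip: "ip W ?x ?x = card W" using assms by (simp add: ip_indicator)
  have "qA W ?x = (\<Sum>v\<in>W. real (card (nbrs W v)))" using assms by (simp add: qA_indicator)
  also have "\<dots> \<ge> (\<Sum>v\<in>W. c)" by (intro sum_mono assms)
  finally have "c * card W \<le> qA W ?x" by (simp add: mult.commute)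
  then show ?thesis using assms n by (intro pos_ge_orth[of _ "[?x]"]) (auto simp: ip field_simps)
qed

lemma pos_ge_clique:
  assumes "finite Q" "clique Q" "Q \<noteq> {}"
  shows "pos_ge Q (real (card Q) - 1)"
proof (rule pos_ge_min_degree[OF assms(1,3)])
  fix v assume "v \<in> Q"
  moreover have "card Q \<noteq> 0" using assms by simp
  ultimately show "real (card Q) - 1 \<le> real (card (nbrs Q v))"
    using clique_card_nbrs[OF assms(1,2)] by (simp add: of_nat_diff)
qed

lemma pos_ge_clique':
  assumes "finite Q" "clique Q"
  shows "pos_ge Q (real (card Q) - 1)"
  using pos_ge_clique[OF assms] pos_ge_le[OF pos_ge_0, of "-1"] by (cases "Q = {}") auto

lemma pos_ge_edge: "(u, v) \<in> E \<Longrightarrow> pos_ge {u, v} 1"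
  using pos_ge_clique[of "{u, v}"] adj_commute by (cases "u = v") (auto simp: clique_def)

text \<open>Helmert contrasts: each new point \<open>a\<close> contributes the contrast
  \<open>g\<close> of \<open>a\<close> against all earlier points. It has sum zero and is orthogonal
  to the earlier contrasts because it is constant on their support.\<close>

lemma helmert_family:
  assumes "finite T" "T \<noteq> {}"
  shows "\<exists>hs. length hs = card T - 1 \<and> orth T hs \<and> (\<forall>h\<in>set hs. sum h T = 0 \<and> (\<forall>v. v \<notin> T \<longrightarrow> h v = 0))"
  using assms
proof (induction T rule: finite_ne_induct)
  case (singleton x)
  then show ?case by (intro exI[of _ "[]"]) auto
next
  case (insert a T)
  then obtain hs where hs: "length hs = card T - 1" "orth T hs"
    "\<forall>h\<in>set hs. sum h T = 0 \<and> (\<forall>v. v \<notin> T \<longrightarrow> h v = 0)" by blast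
  define g where "g v = (if v \<in> T then 1 else if v = a then - real (card T) else 0)" for v
  have T0: "0 < card T" using insert by (simp add: card_gt_0_iff)
  have ipT: "ip (insert a T) x y = ip T x y" if "y a = 0" for x y
    using insert that by (simp add: ip_def)
  have sumg: "sum g T = card T" by (simp add: g_def)
  have gg: "0 < ip (insert a T) g g"
    using insert T0 by (simp add: ip_def g_def add_pos_nonneg)
  have gh: "ip (insert a T) g h = 0" if "h \<in> set hs" for h
  proof -
    have "ip T g h = sum h T" by (simp add: ip_def g_def)
    then show ?thesis using that hs(3) insert(3) ipT[of h g] by simp
  qed
  have "orth (insert a T) hs"
    using hs(2,3) insert(3) unfolding orth_def
    by (auto simp: ipT elim!: sorted_wrt_mono_rel[rotated])
  then have "orth (insert a T) (g # hs)" using gg gh by simp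
  moreover have "sum g (insert a T) = 0" using insert sumg by (simp add: g_def)
  moreover have "sum h (insert a T) = 0" if "h \<in> set hs" for h using insert hs(3) that by simp
  ultimately show ?case
    using hs insert T0 by (intro exI[of _ "g # hs"]) (auto simp: g_def)
qed

lemma helmert_family_within:
  assumes "finite W" "T \<subseteq> W" "T \<noteq> {}"
  obtains hs where "length hs = card T - 1" "orth W hs"
    "\<And>h. h \<in> set hs \<Longrightarrow> sum h T = 0" "\<And>h v. h \<in> set hs \<Longrightarrow> v \<notin> T \<Longrightarrow> h v = 0"
proof -
  have fT: "finite T" using assms finite_subset by blast
  obtain hs where hs: "length hs = card T - 1" "orth T hs"
    "\<forall>h\<in>set hs. sum h T = 0 \<and> (\<forall>v. v \<notin> T \<longrightarrow> h v = 0)"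
    using helmert_family[OF fT assms(3)] by blast
  have "ip W x y = ip T x y" if "y \<in> set hs" for x y
    unfolding ip_def using assms hs(3) that by (intro sum.mono_neutral_right) auto
  then have "orth W hs" using hs(2) unfolding orth_def
    by (auto elim!: sorted_wrt_mono_rel[rotated])
  then show thesis using that hs by blast
qed

text \<open>On a clique the adjacency matrix is the all-ones matrix minus the identity, and the
  all-ones matrix annihilates vectors of sum zero.\<close>

lemma qA_sum_zero_on_clique:
  assumes "finite W" "T \<subseteq> W" "clique T" "sum h T = 0" "\<And>v. v \<notin> T \<Longrightarrow> h v = 0"
  shows "qA W h = - ip W h h"
proof -
  have fT: "finite T" using assms finite_subset by blast
  have "qA W h = qA T h" by (rule qf_restrict) (use assms in auto)
  also have "\<dots> = (\<Sum>u\<in>T. \<Sum>v\<in>T. h u * h v - (if v = u then h u * h v else 0))"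
    unfolding qf_def using assms(3) by (intro sum.cong refl) (auto simp: adjf_def clique_def)
  also have "\<dots> = sum h T * sum h T - ip T h h"
    using fT by (simp add: sum_subtractf sum_product ip_def)
  also have "ip T h h = ip W h h"
    unfolding ip_def using assms by (intro sum.mono_neutral_left) auto
  finally show ?thesis using assms by simp
qed

lemma ip_constant_sum_zero:
  assumes "finite W" "T \<subseteq> W" "sum h T = 0" "\<And>v. v \<notin> T \<Longrightarrow> h v = 0" "\<And>v. v \<in> T \<Longrightarrow> y v = c"
  shows "ip W h y = 0"
proof -
  have "ip W h y = (\<Sum>v\<in>T. h v * y v)"
    unfolding ip_def using assms by (intro sum.mono_neutral_right) auto
  also have "\<dots> = sum h T * c" using assms(5) by (simp add: sum_distrib_right)
  finally show ?thesis using assms(3) by simp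
qed

text \<open>Negative directions: vectors of sum zero on a clique are eigenvectors for \<open>-1\<close> of the
  clique, and they are orthogonal to everything that is constant on the clique.\<close>

lemma pos_ge_two_cliques:
  assumes W: "finite W" and T: "T \<subseteq> W" "clique T" "T \<noteq> {}" and U: "U \<subseteq> W" "clique U" "U \<noteq> {}"
    and dis: "T \<inter> U = {}" and ys: "orth W ys"
    and const: "\<And>y. y \<in> set ys \<Longrightarrow> \<exists>c. \<forall>v\<in>T. y v = c" "\<And>y. y \<in> set ys \<Longrightarrow> \<exists>c. \<forall>v\<in>U. y v = c"
    and r: "r \<le> real (card T) - 1 + (real (card U) - 1) - (\<Sum>y\<leftarrow>ys. qA W y / ip W y y)"
  shows "pos_ge W r"
proof -
  obtain hs where hs: "length hs = card T - 1" "orth W hs"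
    "\<And>h. h \<in> set hs \<Longrightarrow> sum h T = 0" "\<And>h v. h \<in> set hs \<Longrightarrow> v \<notin> T \<Longrightarrow> h v = 0"
    using helmert_family_within[OF W T(1,3)] by blast
  obtain gs where gs: "length gs = card U - 1" "orth W gs"
    "\<And>h. h \<in> set gs \<Longrightarrow> sum h U = 0" "\<And>h v. h \<in> set gs \<Longrightarrow> v \<notin> U \<Longrightarrow> h v = 0"
    using helmert_family_within[OF W U(1,3)] by blast
  have fin: "finite T" "finite U" using W T U finite_subset by blast+
  have "ip W h g = 0" if "h \<in> set hs" "g \<in> set gs" for h g
    by (rule ip_constant_sum_zero[OF W T(1) hs(3)[OF that(1)] hs(4)[OF that(1)], of _ 0])
      (use gs(4)[OF that(2)] dis in auto)
  moreover have "ip W h y = 0" if h: "h \<in> set hs" and y: "y \<in> set ys" for h y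
  proof -
    obtain c where "\<forall>v\<in>T. y v = c" using const(1)[OF y] by blast
    then show ?thesis using ip_constant_sum_zero[OF W T(1) hs(3)[OF h] hs(4)[OF h], of _ c] by blast
  qed
  moreover have "ip W h y = 0" if h: "h \<in> set gs" and y: "y \<in> set ys" for h y
  proof -
    obtain c where "\<forall>v\<in>U. y v = c" using const(2)[OF y] by blast
    then show ?thesis using ip_constant_sum_zero[OF W U(1) gs(3)[OF h] gs(4)[OF h], of _ c] by blast
  qed
  ultimately have orth: "orth W (hs @ gs @ ys)"
    using hs(2) gs(2) ys by (auto simp: orth_append)
  have val: "(\<Sum>h\<leftarrow>xs. qA W h / ip W h h) = - real (length xs)"
    if "\<And>h. h \<in> set xs \<Longrightarrow> 0 < ip W h h \<and> qA W h = - ip W h h" for xs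
    using that
  proof (induction xs)
    case (Cons a xs)
    have "ip W a a \<noteq> 0" "qA W a = - ip W a a" using Cons.prems[of a] by auto
    then show ?case using Cons by simp
  qed simp
  have hp: "0 < ip W h h \<and> qA W h = - ip W h h" if "h \<in> set hs" for h
    using hs(2) that qA_sum_zero_on_clique[OF W T(1,2) hs(3)[OF that] hs(4)[OF that]]
    by (auto simp: orth_def)
  have gp: "0 < ip W h h \<and> qA W h = - ip W h h" if "h \<in> set gs" for h
    using gs(2) that qA_sum_zero_on_clique[OF W U(1,2) gs(3)[OF that] gs(4)[OF that]]
    by (auto simp: orth_def)
  have c: "real (card T - 1) = real (card T) - 1" "real (card U - 1) = real (card U) - 1"
    using T U fin by (simp_all add: of_nat_diff card_gt_0_iff Suc_leI)
  show ?thesis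
    by (rule pos_ge_orth_neg[OF W orth])
      (use r c hs(1) gs(1) in \<open>simp add: val[OF hp] val[OF gp]\<close>)
qed

section \<open>Colour-critical vertex sets\<close>

definition colorable :: "'a set \<Rightarrow> nat \<Rightarrow> bool" where
  "colorable W k \<longleftrightarrow> (\<exists>c::'a \<Rightarrow> nat. (\<forall>v\<in>W. c v < k) \<and> (\<forall>u\<in>W. \<forall>v\<in>W. (u, v) \<in> E \<longrightarrow> c u \<noteq> c v))"

definition chi :: "'a set \<Rightarrow> nat" where
  "chi W = (LEAST k. colorable W k)"

text \<open>Lets colours be arbitrary objects. The recolouring arguments below use vertices as
  colours, typically the vertices of a clique.\<close>

lemma colorable_image:
  assumes "finite W" "\<And>u v. u \<in> W \<Longrightarrow> v \<in> W \<Longrightarrow> (u, v) \<in> E \<Longrightarrow> f u \<noteq> f v"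
  shows "colorable W (card (f ` W))"
proof -
  obtain h where h: "bij_betw h (f ` W) {0..<card (f ` W)}"
    using ex_bij_betw_finite_nat[of "f ` W"] assms(1) by auto
  have "h (f v) < card (f ` W)" if "v \<in> W" for v
    using h that by (auto simp: bij_betw_def)
  moreover have "h (f u) \<noteq> h (f v)" if "u \<in> W" "v \<in> W" "(u, v) \<in> E" for u v
    using h that assms(2)[OF that] by (auto simp: bij_betw_def inj_on_def)
  ultimately show ?thesis
    unfolding colorable_def by (intro exI[of _ "h \<circ> f"]) auto
qed

lemma chi_le: "colorable W k \<Longrightarrow> chi W \<le> k"
  unfolding chi_def by (rule Least_le)

lemma colorable_chi:
  assumes "finite W"
  shows "colorable W (chi W)"
proof -
  have "colorable W (card (id ` W))" using assms by (intro colorable_image) auto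
  then show ?thesis unfolding chi_def by (rule LeastI)
qed

lemma chi_le_image:
  assumes "finite W" "\<And>u v. u \<in> W \<Longrightarrow> v \<in> W \<Longrightarrow> (u, v) \<in> E \<Longrightarrow> f u \<noteq> f v"
    and "f ` W \<subseteq> C" "finite C"
  shows "chi W \<le> card C"
proof -
  have "chi W \<le> card (f ` W)" by (intro chi_le colorable_image assms)
  then show ?thesis using card_mono[OF assms(4,3)] by simp
qed

lemma chi_mono:
  assumes "finite W" "S \<subseteq> W"
  shows "chi S \<le> chi W"
proof (rule chi_le)
  obtain c where "\<forall>v\<in>W. c v < chi W" "\<forall>u\<in>W. \<forall>v\<in>W. (u, v) \<in> E \<longrightarrow> c u \<noteq> (c v :: nat)"
    using colorable_chi[OF assms(1)] by (auto simp: colorable_def)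
  then show "colorable S (chi W)"
    unfolding colorable_def using assms(2) by (intro exI[of _ c]) blast
qed

lemma chi_union:
  assumes "finite A" "finite B"
  shows "chi (A \<union> B) \<le> chi A + chi B"
proof -
  obtain a where a: "\<And>v. v \<in> A \<Longrightarrow> a v < chi A" "\<And>u v. u \<in> A \<Longrightarrow> v \<in> A \<Longrightarrow> (u, v) \<in> E \<Longrightarrow> a u \<noteq> a v"
    using colorable_chi[OF assms(1)] by (auto simp: colorable_def)
  obtain b where b: "\<And>v. v \<in> B \<Longrightarrow> b v < chi B" "\<And>u v. u \<in> B \<Longrightarrow> v \<in> B \<Longrightarrow> (u, v) \<in> E \<Longrightarrow> b u \<noteq> b v"
    using colorable_chi[OF assms(2)] by (auto simp: colorable_def)
  have "colorable (A \<union> B) (chi A + chi B)"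
    unfolding colorable_def
    using a b by (intro exI[of _ "\<lambda>v. if v \<in> A then a v else chi A + b v"])
      (auto simp: trans_less_add1, fastforce+)
  then show ?thesis by (rule chi_le)
qed

lemma clique_le_chi:
  assumes "finite W" "Q \<subseteq> W" "clique Q"
  shows "card Q \<le> chi W"
proof -
  obtain c where c: "\<And>v. v \<in> W \<Longrightarrow> c v < chi W"
    "\<And>u v. u \<in> W \<Longrightarrow> v \<in> W \<Longrightarrow> (u, v) \<in> E \<Longrightarrow> c u \<noteq> (c v :: nat)"
    using colorable_chi[OF assms(1)] by (auto simp: colorable_def)
  have "inj_on c Q"
    using c(2) assms(2,3) unfolding inj_on_def clique_def by blast
  moreover have "c ` Q \<subseteq> {..<chi W}" using c(1) assms(2) by auto
  ultimately have "card Q \<le> card {..<chi W}" by (intro card_inj_on_le[of c]) auto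
  then show ?thesis by simp
qed

lemma chi_le_card: "finite W \<Longrightarrow> chi W \<le> card W"
  using chi_le_image[of W "\<lambda>v. v" W] by fastforce

lemma chi_clique: "finite Q \<Longrightarrow> clique Q \<Longrightarrow> chi Q = card Q"
  using clique_le_chi[of Q Q] chi_le_card[of Q] by simp

section \<open>Vertex-critical sets: degrees, private neighbours, and excluded
  configurations\<close>

definition critical :: "'a set \<Rightarrow> bool" where
  "critical W \<longleftrightarrow> (\<forall>v\<in>W. chi (W - {v}) < chi W)"

text \<open>A vertex with fewer than \<open>chi W - 1\<close> neighbours would find a free colour
  among the \<open>chi W - 1\<close> colours that suffice for the rest.\<close>

lemma critical_degree:
  assumes fin: "finite W" and crit: "critical W" and v: "v \<in> W"
  shows "chi W \<le> card (nbrs W v) + 1"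
proof (rule ccontr)
  assume "\<not> ?thesis"
  then have lt: "card (nbrs W v) < chi W - 1" by simp
  have "colorable (W - {v}) (chi (W - {v}))" using fin by (intro colorable_chi) auto
  then obtain c where c: "\<And>u. u \<in> W - {v} \<Longrightarrow> c u < chi (W - {v})"
    "\<And>u w. u \<in> W - {v} \<Longrightarrow> w \<in> W - {v} \<Longrightarrow> (u, w) \<in> E \<Longrightarrow> c u \<noteq> (c w :: nat)"
    by (auto simp: colorable_def)
  have c': "c u < chi W - 1" if "u \<in> W - {v}" for u
    using c(1)[OF that] crit v by (fastforce simp: critical_def)
  have fN: "finite (nbrs W v)" using fin by (simp add: nbrs_def)
  have "\<not> {..<chi W - 1} \<subseteq> c ` nbrs W v"
  proof
    assume "{..<chi W - 1} \<subseteq> c ` nbrs W v"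
    then have "card {..<chi W - 1} \<le> card (c ` nbrs W v)" using fN by (intro card_mono) auto
    then have "chi W - 1 \<le> card (c ` nbrs W v)" by simp
    then show False using lt card_image_le[OF fN, of c] by simp
  qed
  then obtain x where x: "x < chi W - 1" "x \<notin> c ` nbrs W v" by auto
  have "colorable W (chi W - 1)"
    unfolding colorable_def
  proof (intro exI[of _ "c(v := x)"] conjI ballI impI)
    show "(c(v := x)) u < chi W - 1" if "u \<in> W" for u using x(1) c' that by auto
    show "(c(v := x)) u \<noteq> (c(v := x)) w" if "u \<in> W" "w \<in> W" "(u, w) \<in> E" for u w
      using x(2) c(2)[of u w] that adj_sym[OF that(3)] by (auto simp: nbrs_def)
  qed
  then have "chi W \<le> chi W - 1" by (rule chi_le)
  then show False using lt by simp
qed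

text \<open>If every neighbour of \<open>u\<close> were also a neighbour of \<open>v\<close>, a
  colouring of \<open>W - {u}\<close> would extend by giving \<open>u\<close> the colour of
  \<open>v\<close>.\<close>

lemma critical_private_nbr:
  assumes fin: "finite W" and crit: "critical W" and uv: "u \<in> W" "v \<in> W" "u \<noteq> v" "(u, v) \<notin> E"
  obtains a where "a \<in> W" "(u, a) \<in> E" "(v, a) \<notin> E"
proof (rule ccontr)
  assume nt: "\<not> thesis"
  have sub: "\<forall>a\<in>W. (u, a) \<in> E \<longrightarrow> (v, a) \<in> E" using nt that by blast
  have "colorable (W - {u}) (chi (W - {u}))" using fin by (intro colorable_chi) auto
  then obtain c where c: "\<And>w. w \<in> W - {u} \<Longrightarrow> c w < chi (W - {u})"
    "\<And>w w'. w \<in> W - {u} \<Longrightarrow> w' \<in> W - {u} \<Longrightarrow> (w, w') \<in> E \<Longrightarrow> c w \<noteq> (c w' :: nat)"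
    by (auto simp: colorable_def)
  have "colorable W (chi (W - {u}))"
    unfolding colorable_def
  proof (intro exI[of _ "c(u := c v)"] conjI ballI impI)
    show "(c(u := c v)) w < chi (W - {u})" if "w \<in> W" for w using c(1) that uv by auto
    show "(c(u := c v)) w \<noteq> (c(u := c v)) w'" if w: "w \<in> W" "w' \<in> W" "(w, w') \<in> E" for w w'
    proof -
      have "c v \<noteq> c w'' \<and> c w'' \<noteq> c v" if "w'' \<in> W" "(u, w'') \<in> E" "w'' \<noteq> u" for w''
        using c(2)[of v w''] sub that uv by auto
      then show ?thesis using c(2)[of w w'] w adj_sym[OF w(3)] by (cases "w = u"; cases "w' = u") auto
    qed
  qed
  then have "chi W \<le> chi (W - {u})" by (rule chi_le)
  then show False using crit uv(1) by (fastforce simp: critical_def)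
qed

lemma critical_subset_exists:
  assumes "finite W"
  shows "\<exists>S\<subseteq>W. chi S = chi W \<and> critical S"
  using assms
proof (induction "card W" arbitrary: W rule: less_induct)
  case less
  show ?case
  proof (cases "critical W")
    case False
    then obtain v where v: "v \<in> W" "\<not> chi (W - {v}) < chi W" by (auto simp: critical_def)
    then have "chi (W - {v}) = chi W" using chi_mono[OF less.prems, of "W - {v}"] by auto
    moreover obtain S where "S \<subseteq> W - {v}" "chi S = chi (W - {v})" "critical S"
      using less.hyps[of "W - {v}"] v(1) less.prems by (meson card_Diff1_less finite_Diff)
    ultimately show ?thesis by auto
  qed auto
qed

text \<open>The universal bound, from the minimum degree of a critical subset. All later arguments
  only have to gain one more unit.\<close>

lemma pos_ge_chi:
  assumes "finite W"
  shows "pos_ge W (real (chi W) - 1)"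
proof -
  obtain S where S: "S \<subseteq> W" "chi S = chi W" "critical S"
    using critical_subset_exists[OF assms] by blast
  have fS: "finite S" using S assms finite_subset by blast
  show ?thesis
  proof (cases "S = {}")
    case True
    then have "chi W = 0" using S chi_le_card[of "{}"] by simp
    then show ?thesis using pos_ge_le[OF pos_ge_0] by simp
  next
    case False
    have "pos_ge S (real (chi W) - 1)"
    proof (rule pos_ge_min_degree[OF fS False])
      show "real (chi W) - 1 \<le> real (card (nbrs S v))" if "v \<in> S" for v
        using critical_degree[OF fS S(3) that] S(2) by linarith
    qed
    then show ?thesis using pos_ge_mono[OF assms S(1)] by blast
  qed
qed

text \<open>In a critical graph the all-ones vector already yields \<open>chi W - 1\<close>, and every vector of sum
  zero is orthogonal to it.\<close>

lemma pos_ge_critical: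
  assumes fin: "finite W" and ne: "W \<noteq> {}" and crit: "critical W" and S: "S \<subseteq> W"
    and ys: "orth S ys" "\<And>y. y \<in> set ys \<Longrightarrow> sum y S = 0" "\<And>y v. y \<in> set ys \<Longrightarrow> v \<notin> S \<Longrightarrow> y v = 0"
    and r: "r \<le> real (chi W) - 1 + (\<Sum>y\<leftarrow>ys. qA S y / ip S y y)"
  shows "pos_ge W r"
proof -
  let ?x = "\<lambda>v. if v \<in> W then 1 else 0 :: real"
  have n: "0 < card W" using fin ne by (simp add: card_gt_0_iff)
  have ipx: "ip W ?x y = sum y W" for y by (rule ip_indicator[OF fin subset_refl])
  have ipy: "ip W y z = ip S y z" if "z \<in> set ys" for y z
    unfolding ip_def using fin S ys(3)[OF that] by (intro sum.mono_neutral_right) auto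
  have sy: "sum y W = 0" if "y \<in> set ys" for y
  proof -
    have "sum y W = sum y S" using fin S ys(3)[OF that] by (intro sum.mono_neutral_right) auto
    then show ?thesis using ys(2)[OF that] by simp
  qed
  have qy: "qA W y = qA S y" if "y \<in> set ys" for y
    by (rule qf_restrict[OF fin S]) (use ys(3)[OF that] in auto)
  have "orth W ys" using ys(1) ipy unfolding orth_def
    by (auto elim!: sorted_wrt_mono_rel[rotated])
  then have orth: "orth W (?x # ys)" using n sy by (simp add: ipx)
  have "(\<Sum>v\<in>W. real (chi W) - 1) \<le> (\<Sum>v\<in>W. real (card (nbrs W v)))"
  proof (rule sum_mono)
    show "real (chi W) - 1 \<le> real (card (nbrs W v))" if "v \<in> W" for v
      using critical_degree[OF fin crit that] by linarith
  qed
  then have "(real (chi W) - 1) * real (card W) \<le> qA W ?x"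
    by (simp add: qA_indicator[OF fin] mult.commute)
  then have "real (chi W) - 1 \<le> qA W ?x / ip W ?x ?x"
    using n by (simp add: ipx field_simps)
  moreover have "(\<Sum>y\<leftarrow>ys. qA W y / ip W y y) = (\<Sum>y\<leftarrow>ys. qA S y / ip S y y)"
    by (intro arg_cong[of _ _ sum_list] map_cong) (auto simp: qy ipy)
  ultimately show ?thesis using r by (intro pos_ge_orth[OF fin orth]) simp
qed

text \<open>The vector with value 1 on one edge and -1 on the other has sum zero and Rayleigh
  quotient 1, exactly the missing unit.\<close>

lemma critical_2K2:
  assumes fin: "finite W" and crit: "critical W" and W: "{a, b, c, d} \<subseteq> W"
    and dist: "a \<noteq> c" "a \<noteq> d" "b \<noteq> c" "b \<noteq> d"
    and e: "(a, b) \<in> E" "(c, d) \<in> E"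
    and ne: "(a, c) \<notin> E" "(a, d) \<notin> E" "(b, c) \<notin> E" "(b, d) \<notin> E"
  shows "pos_ge W (real (chi W))"
proof -
  have d: "a \<noteq> b" "c \<noteq> d" using e by auto
  note e' = e adj_sym[OF e(1)] adj_sym[OF e(2)]
  have ne': "(c, a) \<notin> E" "(d, a) \<notin> E" "(c, b) \<notin> E" "(d, b) \<notin> E" using ne adj_commute by blast+
  define y where "y = (\<lambda>_. 0 :: real)(a := 1, b := 1, c := -1, d := -1)"
  show ?thesis
    by (rule pos_ge_critical[OF fin _ crit W, of "[y]"])
      (use W dist d dist[symmetric] d[symmetric] e' ne ne' in \<open>auto simp: y_def ip_def qf_def adjf_def\<close>)
qed

text \<open>The 5-cycle has the eigenvalue (sqrt 5 - 1) / 2 twice, on vectors of sum zero.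
  \<open>y\<close> and \<open>z\<close> are orthogonal integer approximations of such eigenvectors;
  their quotients 3/5 and 11/18 add to more than 1.\<close>

lemma critical_C5:
  assumes fin: "finite W" and crit: "critical W" and W: "{a, b, c, d, e} \<subseteq> W"
    and dist: "distinct [a, b, c, d, e]"
    and ed: "(a, b) \<in> E" "(b, c) \<in> E" "(c, d) \<in> E" "(d, e) \<in> E" "(e, a) \<in> E"
    and ne: "(a, c) \<notin> E" "(a, d) \<notin> E" "(b, d) \<notin> E" "(b, e) \<notin> E" "(c, e) \<notin> E"
  shows "pos_ge W (real (chi W))"
proof -
  note ed' = ed ed[THEN adj_sym]
  have ne': "(c, a) \<notin> E" "(d, a) \<notin> E" "(d, b) \<notin> E" "(e, b) \<notin> E" "(e, c) \<notin> E" using ne adj_commute by blast+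
  define y where "y = (\<lambda>_. 0 :: real)(b := 2, c := 1, d := -1, e := -2)"
  define z where "z = (\<lambda>_. 0 :: real)(a := 4, b := 1, c := -3, d := -3, e := 1)"
  have "qA {a, b, c, d, e} y = 6" "qA {a, b, c, d, e} z = 22"
    "ip {a, b, c, d, e} y y = 10" "ip {a, b, c, d, e} z z = 36" "ip {a, b, c, d, e} y z = 0"
    "sum y {a, b, c, d, e} = 0" "sum z {a, b, c, d, e} = 0"
    using dist ed' ne ne' by (auto simp: y_def z_def ip_def qf_def adjf_def)
  moreover have "v \<notin> {a, b, c, d, e} \<Longrightarrow> y v = 0" "v \<notin> {a, b, c, d, e} \<Longrightarrow> z v = 0" for v
    by (auto simp: y_def z_def)
  ultimately show ?thesis
    by (intro pos_ge_critical[OF fin _ crit W, of "[y, z]"]) (use W in auto)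
qed

end

text \<open>Certificates for small graphs: \<open>M\<close> is the adjacency matrix with respect to the enumeration
  \<open>ws\<close>, and the rows of \<open>xs\<close> are pairwise orthogonal vectors.\<close>

definition iplist :: "real list \<Rightarrow> real list \<Rightarrow> real" where
  "iplist x y = (\<Sum>(a, b)\<leftarrow>zip x y. a * b)"

definition qlist :: "bool list list \<Rightarrow> real list \<Rightarrow> real" where
  "qlist M x = (\<Sum>(row, a)\<leftarrow>zip M x. \<Sum>(e, b)\<leftarrow>zip row x. (if e then a * b else 0))"

definition vec_on :: "'a list \<Rightarrow> real list \<Rightarrow> 'a \<Rightarrow> real" where
  "vec_on ws x v = (case map_of (zip ws x) v of None \<Rightarrow> 0 | Some r \<Rightarrow> r)"

lemma map_vec_on:
  assumes "distinct ws" "length x = length ws"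
  shows "map (vec_on ws x) ws = x"
  using assms by (intro nth_equalityI) (auto simp: vec_on_def map_of_zip_nth)

lemma (in simple_graph) ip_vec_on:
  assumes ws: "distinct ws" "length x = length ws" "length y = length ws"
  shows "ip (set ws) (vec_on ws x) (vec_on ws y) = iplist x y"
proof -
  have "ip (set ws) (vec_on ws x) (vec_on ws y) = (\<Sum>v\<leftarrow>ws. vec_on ws x v * vec_on ws y v)"
    unfolding ip_def using ws(1) by (simp add: sum.distinct_set_conv_list)
  also have "\<dots> = iplist (map (vec_on ws x) ws) (map (vec_on ws y) ws)"
    by (simp add: iplist_def zip_map_map zip_same_conv_map o_def)
  finally show ?thesis by (simp add: map_vec_on ws)
qed

lemma (in simple_graph) qA_vec_on:
  assumes ws: "distinct ws" "length x = length ws"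
  shows "qA (set ws) (vec_on ws x) = qlist (map (\<lambda>u. map (\<lambda>v. (u, v) \<in> E) ws) ws) x"
proof -
  have "qA (set ws) (vec_on ws x)
      = (\<Sum>u\<leftarrow>ws. \<Sum>v\<leftarrow>ws. (if (u, v) \<in> E then vec_on ws x u * vec_on ws x v else 0))"
    unfolding qf_def using ws(1)
    by (simp add: sum.distinct_set_conv_list adjf_def if_distrib if_distribR cong: if_cong)
  also have "\<dots> = qlist (map (\<lambda>u. map (\<lambda>v. (u, v) \<in> E) ws) ws) (map (vec_on ws x) ws)"
    by (simp add: qlist_def zip_map_map zip_same_conv_map o_def)
  finally show ?thesis by (simp add: map_vec_on ws)
qed

lemma (in simple_graph) orth_vec_on:
  assumes ws: "distinct ws" and M: "map (\<lambda>u. map (\<lambda>v. (u, v) \<in> E) ws) ws = M"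
    and len: "\<forall>x\<in>set xs. length x = length ws"
    and orth: "sorted_wrt (\<lambda>x y. iplist x y = 0) xs" "\<forall>x\<in>set xs. 0 < iplist x x"
  shows "orth (set ws) (map (vec_on ws) xs)"
    and "(\<Sum>x\<leftarrow>map (vec_on ws) xs. qA (set ws) x / ip (set ws) x x) = (\<Sum>x\<leftarrow>xs. qlist M x / iplist x x)"
proof -
  have "sorted_wrt (\<lambda>x y. ip (set ws) (vec_on ws x) (vec_on ws y) = 0) xs"
    using orth(1) len by (auto simp: ip_vec_on[OF ws] elim!: sorted_wrt_mono_rel[rotated])
  then show "orth (set ws) (map (vec_on ws) xs)"
    using orth(2) len by (auto simp: orth_def sorted_wrt_map ip_vec_on[OF ws])
  show "(\<Sum>x\<leftarrow>map (vec_on ws) xs. qA (set ws) x / ip (set ws) x x) = (\<Sum>x\<leftarrow>xs. qlist M x / iplist x x)"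
    unfolding map_map o_def using len
    by (intro arg_cong[of _ _ sum_list] map_cong refl) (simp add: ip_vec_on[OF ws] qA_vec_on[OF ws] M)
qed

text \<open>Reduces a bound for a concrete small graph to rational arithmetic that can be evaluated
  by rewriting. The negative variant takes test vectors near eigenvectors for negative
  eigenvalues.\<close>

lemma (in simple_graph)
  assumes ws: "distinct ws" "map (\<lambda>u. map (\<lambda>v. (u, v) \<in> E) ws) ws = M" "\<forall>x\<in>set xs. length x = length ws"
    "sorted_wrt (\<lambda>x y. iplist x y = 0) xs" "\<forall>x\<in>set xs. 0 < iplist x x"
  shows pos_ge_certificate: "r \<le> (\<Sum>x\<leftarrow>xs. qlist M x / iplist x x) \<Longrightarrow> pos_ge (set ws) r"
    and pos_ge_certificate_neg: "r \<le> - (\<Sum>x\<leftarrow>xs. qlist M x / iplist x x) \<Longrightarrow> pos_ge (set ws) r"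
  using pos_ge_orth[OF _ orth_vec_on(1)[OF ws]] pos_ge_orth_neg[OF _ orth_vec_on(1)[OF ws]]
  unfolding orth_vec_on(2)[OF ws] by simp_all

lemma (in simple_graph) pos_ge_matching2:
  assumes "distinct [a, b, c, d]" "(a, b) \<in> E" "(c, d) \<in> E"
  shows "pos_ge {a, b, c, d} 2"
proof (rule pos_ge_add)
  show "pos_ge {a, b} 1" "pos_ge {c, d} 1" using assms by (simp_all add: pos_ge_edge)
qed (use assms in auto)

lemma (in simple_graph) pos_ge_matching3:
  assumes B: "finite B" "{a, b, c, d, e, f} \<subseteq> B" and dist: "distinct [a, b, c, d, e, f]"
    and edge: "(a, b) \<in> E" "(c, d) \<in> E" "(e, f) \<in> E"
  shows "pos_ge B 3"
proof (rule pos_ge_add[OF B(1)])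
  show "pos_ge {a, b, c, d} 2" using pos_ge_matching2[OF _ edge(1,2)] dist by simp
  show "pos_ge {e, f} 1" using edge by (simp add: pos_ge_edge)
  show "{a, b, c, d} \<subseteq> B" "{e, f} \<subseteq> B" using B by simp_all
  show "{a, b, c, d} \<inter> {e, f} = {}" using dist by simp
qed simp

text \<open>The triangle is worth 2 and the disjoint edge 1.\<close>

lemma (in simple_graph) pos_ge_triangle_edge:
  assumes B: "finite B" "{a, b, c, d, e} \<subseteq> B" and dist: "distinct [a, b, c, d, e]"
    and edge: "(a, b) \<in> E" "(b, c) \<in> E" "(a, c) \<in> E" "(d, e) \<in> E"
  shows "pos_ge B 3"
proof (rule pos_ge_add[OF B(1)])
  have "clique {a, b, c}" using edge[THEN adj_sym] edge by (simp add: clique_def)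
  then show "pos_ge {a, b, c} 2" using pos_ge_clique[of "{a, b, c}"] dist by simp
  show "pos_ge {d, e} 1" using edge by (simp add: pos_ge_edge)
  show "{a, b, c} \<subseteq> B" "{d, e} \<subseteq> B" using B by simp_all
  show "{a, b, c} \<inter> {d, e} = {}" using dist by simp
qed simp

section \<open>A clique of order \<open>chi\<close>\<close>

text \<open>The situation in the induction for \<open>clique_of_low_pos\<close> once the induced
  \<open>2K_2\<close> has been excluded. \<open>IH\<close> is the induction hypothesis, that is,
  minimality of the counterexample.\<close>

locale critical_p4 = simple_graph +
  fixes W :: "'a set" and p1 p2 p3 p4 :: 'a
  assumes fin: "finite W" and crit: "critical W" and low: "\<not> pos_ge W (real (chi W))"
    and IH: "\<And>S. S \<subset> W \<Longrightarrow> \<not> pos_ge S (real (chi S)) \<Longrightarrow> \<exists>Q\<subseteq>S. clique Q \<and> card Q = chi S"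
    and pW: "p1 \<in> W" "p2 \<in> W" "p3 \<in> W" "p4 \<in> W"
    and dist: "distinct [p1, p2, p3, p4]"
    and path: "(p1, p2) \<in> E" "(p2, p3) \<in> E" "(p3, p4) \<in> E"
    and nonadj: "(p1, p3) \<notin> E" "(p1, p4) \<notin> E" "(p2, p4) \<notin> E"
begin

lemma path': "(p2, p1) \<in> E" "(p3, p2) \<in> E" "(p4, p3) \<in> E"
  using path adj_sym by blast+

lemma nonadj': "(p3, p1) \<notin> E" "(p4, p1) \<notin> E" "(p4, p2) \<notin> E"
  using nonadj adj_sym by blast+

lemma dist': "p1 \<noteq> p2" "p1 \<noteq> p3" "p1 \<noteq> p4" "p2 \<noteq> p3" "p2 \<noteq> p4" "p3 \<noteq> p4"
  "p2 \<noteq> p1" "p3 \<noteq> p1" "p4 \<noteq> p1" "p3 \<noteq> p2" "p4 \<noteq> p2" "p4 \<noteq> p3"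
  using dist by auto

text \<open>Reversing the path exchanges the types \<open>t13\<close> and \<open>t24\<close> defined
  below and fixes \<open>t23\<close>, so one certificate serves two cases.\<close>

lemma reverse: "critical_p4 E W p4 p3 p2 p1"
  by unfold_locales (use fin crit low IH pW dist path path' nonadj nonadj' in \<open>auto\<close>)

definition J where "J = {p1, p2, p3, p4}"

abbreviation S where "S \<equiv> W - J"

lemma finS: "finite S" and finJ: "finite J" and JW: "J \<subseteq> W"
  using fin pW by (auto simp: J_def)

lemma pos_ge_J: "pos_ge J 2"
  unfolding J_def by (rule pos_ge_matching2[OF dist path(1,3)])

text \<open>A path is 2-colourable, so deleting it lowers \<open>chi\<close> by at most 2. A drop of
  at most 1 would let the path, worth 2, and the universal bound \<open>chi S - 1\<close> add up to
  \<open>chi W\<close>.\<close>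

lemma chi_S: "chi W = chi S + 2"
proof -
  have "chi J \<le> card {p1, p2}"
    by (rule chi_le_image[of _ "\<lambda>v. if v = p1 \<or> v = p3 then p1 else p2"])
      (use dist' nonadj nonadj' in \<open>auto simp: J_def\<close>)
  then have "chi J \<le> 2" using dist' by simp
  moreover have "chi W \<le> chi S + chi J"
    using chi_union[OF finS finJ] JW by (simp add: Un_absorb2)
  ultimately have le: "chi W \<le> chi S + 2" by simp
  have "\<not> real (chi W) \<le> 2 + (real (chi S) - 1)"
    using pos_ge_add[OF fin JW, of S 2 "real (chi S) - 1" "real (chi W)"] pos_ge_J pos_ge_chi[OF finS] low
    by auto
  then show ?thesis using le by linarith
qed

lemma low_S: "\<not> pos_ge S (real (chi S))"
  using not_pos_ge_diff[OF fin JW pos_ge_J low] chi_S by simp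

lemma max_clique_exists: "\<exists>Q\<subseteq>S. clique Q \<and> card Q = chi S"
  by (rule IH[OF _ low_S]) (use pW in \<open>auto simp: J_def\<close>)

text \<open>\<open>Q\<close> is worth \<open>chi S - 1 = chi W - 3\<close>, so nothing disjoint from
  \<open>Q\<close> can be worth 3. This is the threshold for all certificates of this
  section.\<close>

lemma low_outside:
  assumes "Q \<subseteq> S" "clique Q" "card Q = chi S" "B \<subseteq> W - Q"
  shows "\<not> pos_ge B 3"
proof -
  have fQ: "finite Q" using assms(1) finS finite_subset by blast
  have "\<not> pos_ge (W - Q) (real (chi W) - (real (card Q) - 1))"
    by (rule not_pos_ge_diff[OF fin _ pos_ge_clique'[OF fQ assms(2)] low]) (use assms(1) in auto)
  then have "\<not> pos_ge (W - Q) 3" using chi_S assms(3) by simp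
  then show ?thesis using pos_ge_mono[OF _ assms(4)] fin by auto
qed

text \<open>An edge outside the path and \<open>Q\<close> would form a matching of three edges
  together with the two outer edges of the path.\<close>

lemma indep_rest:
  assumes "Q \<subseteq> S" "clique Q" "card Q = chi S"
  shows "indep (S - Q)"
  unfolding indep_def
proof (intro ballI notI)
  fix u v assume uv: "u \<in> S - Q" "v \<in> S - Q" "(u, v) \<in> E"
  then have "u \<noteq> v" by auto
  have "pos_ge {p1, p2, p3, p4, u, v} 3"
    by (rule pos_ge_matching3[of _ p1 p2 p3 p4 u v]) (use uv \<open>u \<noteq> v\<close> dist path in \<open>auto simp: J_def\<close>)
  moreover have "{p1, p2, p3, p4, u, v} \<subseteq> W - Q" using uv pW assms(1) by (auto simp: J_def)
  ultimately show False using low_outside[OF assms] by blast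
qed

text \<open>The possible neighbourhoods on the path of a vertex outside the path and
  \<open>Q\<close>, as shown by \<open>rest_type\<close>.\<close>

abbreviation "t13 r \<equiv> (r, p1) \<in> E \<and> (r, p3) \<in> E \<and> (r, p2) \<notin> E \<and> (r, p4) \<notin> E"
abbreviation "t24 r \<equiv> (r, p2) \<in> E \<and> (r, p4) \<in> E \<and> (r, p1) \<notin> E \<and> (r, p3) \<notin> E"
abbreviation "t23 r \<equiv> (r, p2) \<in> E \<and> (r, p3) \<in> E \<and> (r, p1) \<notin> E \<and> (r, p4) \<notin> E"

text \<open>By criticality \<open>r\<close> has at least \<open>card Q + 1\<close> neighbours, all
  of them on the path or in \<open>Q\<close>, and it cannot see all of \<open>Q\<close>; so it sees
  at least two path vertices. Seeing \<open>p1\<close> and \<open>p2\<close>, or \<open>p3\<close>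
  and \<open>p4\<close>, creates a triangle disjoint from an edge, and seeing just \<open>p1\<close>
  and \<open>p4\<close> an induced 5-cycle. Exactly two path neighbours remain, and then the degree
  forces \<open>r\<close> to miss exactly one vertex of \<open>Q\<close>.\<close>

lemma rest_type:
  assumes Q: "Q \<subseteq> S" "clique Q" "card Q = chi S" and r: "r \<in> S - Q"
  shows "t13 r \<or> t24 r \<or> t23 r" and "\<exists>q\<in>Q. \<forall>v\<in>Q. (r, v) \<in> E \<longleftrightarrow> v \<noteq> q"
proof -
  have fQ: "finite Q" using Q(1) finS finite_subset by blast
  have rW: "r \<in> W" "r \<noteq> p1" "r \<noteq> p2" "r \<noteq> p3" "r \<noteq> p4" using r by (auto simp: J_def)
  have pQ: "p1 \<notin> Q" "p2 \<notin> Q" "p3 \<notin> Q" "p4 \<notin> Q" using Q(1) by (auto simp: J_def)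
  have no3: "\<not> pos_ge {p1, p2, p3, p4, r} 3"
    by (rule low_outside[OF Q]) (use rW r pW pQ in auto)
  have 12: "\<not> ((r, p1) \<in> E \<and> (r, p2) \<in> E)"
    using pos_ge_triangle_edge[of "{p1, p2, p3, p4, r}" r p1 p2 p3 p4] no3 rW dist' path by auto
  have 34: "\<not> ((r, p3) \<in> E \<and> (r, p4) \<in> E)"
    using pos_ge_triangle_edge[of "{p1, p2, p3, p4, r}" r p3 p4 p1 p2] no3 rW dist' path by auto
  have 14: "\<not> ((r, p1) \<in> E \<and> (r, p4) \<in> E \<and> (r, p2) \<notin> E \<and> (r, p3) \<notin> E)"
  proof
    assume a: "(r, p1) \<in> E \<and> (r, p4) \<in> E \<and> (r, p2) \<notin> E \<and> (r, p3) \<notin> E"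
    have "pos_ge W (real (chi W))"
      by (rule critical_C5[OF fin crit, of p1 p2 p3 p4 r])
        (use a rW pW dist' path nonadj adj_commute in auto)
    then show False using low by simp
  qed
  define A where "A = nbrs J r"
  define B where "B = nbrs Q r"
  have "nbrs W r \<subseteq> A \<union> B"
    using indep_rest[OF Q] r by (auto simp: nbrs_def indep_def A_def B_def)
  moreover have "finite A" "finite B" using finJ fQ by (auto simp: A_def B_def nbrs_def)
  ultimately have "card (nbrs W r) \<le> card A + card B"
    by (meson card_Un_le card_mono finite_UnI le_trans)
  then have deg: "card Q + 1 \<le> card A + card B"
    using critical_degree[OF fin crit rW(1)] chi_S Q(3) by simp
  have BQ: "B \<subseteq> Q" by (auto simp: B_def nbrs_def)
  have "B \<noteq> Q"
  proof
    assume "B = Q"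
    then have "clique (insert r Q)" using Q(2) by (auto simp: clique_insert B_def nbrs_def)
    moreover have "insert r Q \<subseteq> S" using r Q(1) by auto
    ultimately have "card (insert r Q) \<le> chi S" using clique_le_chi[OF finS] by blast
    then show False using r Q(3) fQ by simp
  qed
  then have cB: "card B < card Q" using BQ fQ by (simp add: psubset_card_mono psubsetI)
  have A: "A = (if (r, p1) \<in> E then {p1} else {}) \<union> (if (r, p2) \<in> E then {p2} else {})
      \<union> (if (r, p3) \<in> E then {p3} else {}) \<union> (if (r, p4) \<in> E then {p4} else {})"
    by (auto simp: A_def nbrs_def J_def)
  have cA: "2 \<le> card A" using deg cB by simp
  show t: "t13 r \<or> t24 r \<or> t23 r"
    using cA 12 34 14 unfolding A by (auto split: if_splits)
  then have "card A = 2" using dist' unfolding A by auto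
  then have "card (Q - B) = 1"
    using deg cB card_Diff_subset[of B Q] BQ fQ finite_subset[OF BQ fQ] by simp
  then obtain q where "Q - B = {q}" by (auto simp: card_1_singleton_iff)
  then show "\<exists>q\<in>Q. \<forall>v\<in>Q. (r, v) \<in> E \<longleftrightarrow> v \<noteq> q"
    by (intro bexI[of _ q]) (auto simp: B_def nbrs_def)
qed

lemma rest_not_13_13:
  assumes Q: "Q \<subseteq> S" "clique Q" "card Q = chi S" and r: "r \<in> S - Q" "t \<in> S - Q" "r \<noteq> t"
    and "t13 r" "t13 t"
  shows False
proof -
  have ne: "r \<noteq> p1" "r \<noteq> p2" "r \<noteq> p3" "r \<noteq> p4" "t \<noteq> p1" "t \<noteq> p2" "t \<noteq> p3" "t \<noteq> p4"
    using r by (auto simp: J_def)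
  have rt: "(r, t) \<notin> E" "(t, r) \<notin> E" using indep_rest[OF Q] r by (auto simp: indep_def)
  have adj: "(p1, r) \<in> E" "(p3, r) \<in> E" "(p2, r) \<notin> E" "(p4, r) \<notin> E"
    "(p1, t) \<in> E" "(p3, t) \<in> E" "(p2, t) \<notin> E" "(p4, t) \<notin> E"
    using assms(7,8) adj_commute by blast+
  let ?B = "{p1, p2, p3, p4, r, t}"
  let ?M = "[[False, True, False, False, True, True],
      [True, False, True, False, False, False],
      [False, True, False, True, True, True],
      [False, False, True, False, False, False],
      [True, False, True, False, False, False],
      [True, False, True, False, False, False]]"
  have "pos_ge (set [p1, p2, p3, p4, r, t]) 3"
  proof (rule pos_ge_certificate)
    show "map (\<lambda>u. map (\<lambda>v. (u, v) \<in> E) [p1, p2, p3, p4, r, t]) [p1, p2, p3, p4, r, t] = ?M"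
      using rt adj assms(7,8) path path' nonadj nonadj' by simp
    \<comment> \<open>Orthogonal integer approximations of the eigenvectors for the two positive
      eigenvalues, about 2.56 and 0.68.\<close>
    show "3 \<le> (\<Sum>x\<leftarrow>[[6, 5, 7, 3, 5, 5], [-4, -1, 3, 6, -1, -1]]. qlist ?M x / iplist x x)"
      by (simp add: qlist_def iplist_def)
  qed (use dist' ne ne[symmetric] r(3) in \<open>simp_all add: iplist_def\<close>)
  then show False using low_outside[OF Q, of ?B] r pW Q(1) by (auto simp: J_def)
qed

lemma rest_not_23_23:
  assumes Q: "Q \<subseteq> S" "clique Q" "card Q = chi S" and r: "r \<in> S - Q" "t \<in> S - Q" "r \<noteq> t"
    and "t23 r" "t23 t"
  shows False
proof -
  have ne: "r \<noteq> p1" "r \<noteq> p2" "r \<noteq> p3" "r \<noteq> p4" "t \<noteq> p1" "t \<noteq> p2" "t \<noteq> p3" "t \<noteq> p4"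
    using r by (auto simp: J_def)
  have rt: "(r, t) \<notin> E" "(t, r) \<notin> E" using indep_rest[OF Q] r by (auto simp: indep_def)
  have adj: "(p2, r) \<in> E" "(p3, r) \<in> E" "(p1, r) \<notin> E" "(p4, r) \<notin> E"
    "(p2, t) \<in> E" "(p3, t) \<in> E" "(p1, t) \<notin> E" "(p4, t) \<notin> E"
    using assms(7,8) adj_commute by blast+
  let ?B = "{p1, p2, p3, p4, r, t}"
  let ?M = "[[False, True, False, False, False, False],
      [True, False, True, False, True, True],
      [False, True, False, True, True, True],
      [False, False, True, False, False, False],
      [False, True, True, False, False, False],
      [False, True, True, False, False, False]]"
  have "pos_ge (set [p1, p2, p3, p4, r, t]) 3"
  proof (rule pos_ge_certificate)
    show "map (\<lambda>u. map (\<lambda>v. (u, v) \<in> E) [p1, p2, p3, p4, r, t]) [p1, p2, p3, p4, r, t] = ?M"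
      using rt adj assms(7,8) path path' nonadj nonadj' by simp
    \<comment> \<open>One vector is symmetric and the other antisymmetric under reversal of the
      path, which makes them orthogonal; their quotients are 39/14 and 3/5.\<close>
    show "3 \<le> (\<Sum>x\<leftarrow>[[1, 3, 3, 1, 2, 2], [2, 1, -1, -2, 0, 0]]. qlist ?M x / iplist x x)"
      by (simp add: qlist_def iplist_def)
  qed (use dist' ne ne[symmetric] r(3) in \<open>simp_all add: iplist_def\<close>)
  then show False using low_outside[OF Q, of ?B] r pW Q(1) by (auto simp: J_def)
qed

lemma J_reverse: "critical_p4.J p4 p3 p2 p1 = J"
  unfolding critical_p4.J_def[OF reverse] J_def by auto

lemma rest_not_24_24:
  assumes Q: "Q \<subseteq> S" "clique Q" "card Q = chi S" and r: "r \<in> S - Q" "t \<in> S - Q" "r \<noteq> t"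
    and "t24 r" "t24 t"
  shows False
  using critical_p4.rest_not_13_13[OF reverse, unfolded J_reverse, OF Q r] assms(7,8) by blast

text \<open>Equal types are excluded by certificates. Two vertices of different types can be matched
  to two adjacent end vertices of the path, which leaves the opposite edge and so gives a perfect
  matching on six vertices, worth 3.\<close>

lemma rest_unique:
  assumes Q: "Q \<subseteq> S" "clique Q" "card Q = chi S" and r: "r \<in> S - Q" "t \<in> S - Q"
  shows "r = t"
proof (rule ccontr)
  assume rt: "r \<noteq> t"
  have ne: "r \<noteq> p1" "r \<noteq> p2" "r \<noteq> p3" "r \<noteq> p4" "t \<noteq> p1" "t \<noteq> p2" "t \<noteq> p3" "t \<noteq> p4"
    using r by (auto simp: J_def)
  have no3: "\<not> pos_ge {p1, p2, p3, p4, r, t} 3"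
    by (rule low_outside[OF Q]) (use r pW Q(1) in \<open>auto simp: J_def\<close>)
  have match: False if "(a, b) \<in> E" "(c, d) \<in> E" "(e, f) \<in> E" "distinct [a, b, c, d, e, f]"
    "{a, b, c, d, e, f} = {p1, p2, p3, p4, r, t}" for a b c d e f
    using pos_ge_matching3[of "{p1, p2, p3, p4, r, t}" a b c d e f] that no3 by auto
  have mixed: False if "a \<in> {r, t}" "b \<in> {r, t}" "a \<noteq> b" "t13 a \<and> (t24 b \<or> t23 b) \<or> t24 a \<and> t23 b" for a b
  proof -
    have eq: "{p1, p2, p3, p4, r, t} = {p1, p2, p3, p4, a, b}" using that(1-3) by auto
    have d: "a \<noteq> p1" "a \<noteq> p2" "a \<noteq> p3" "a \<noteq> p4" "b \<noteq> p1" "b \<noteq> p2" "b \<noteq> p3" "b \<noteq> p4"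
      using that(1,2) ne by auto
    from that(4) consider "(a, p1) \<in> E" "(b, p2) \<in> E" | "(a, p4) \<in> E" "(b, p3) \<in> E" by blast
    then show False
    proof cases
      case 1
      then show ?thesis using match[of a p1 b p2 p3 p4] d dist' that(3) path unfolding eq by fastforce
    next
      case 2
      then show ?thesis using match[of a p4 b p3 p1 p2] d dist' that(3) path unfolding eq by fastforce
    qed
  qed
  show False
    using rest_type(1)[OF Q r(1)] rest_type(1)[OF Q r(2)] mixed[of r t] mixed[of t r] rt
      rest_not_13_13[OF Q r rt] rest_not_24_24[OF Q r rt] rest_not_23_23[OF Q r rt]
    by auto
qed

text \<open>The only vertex \<open>r\<close> outside the path and \<open>Q\<close> misses a single
  \<open>q\<close> in \<open>Q\<close>, so \<open>r\<close> and \<open>q\<close> can be exchanged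
  and \<open>q\<close> has one of the three types too. Degrees at the ends of the path force the
  types \<open>t13\<close> and \<open>t24\<close>. Then one more colour class at each parity of the
  path absorbs \<open>r\<close> and \<open>q\<close>, and \<open>card Q + 1\<close> colours suffice,
  one too few.\<close>

lemma rest_empty:
  assumes Q: "Q \<subseteq> S" "clique Q" "card Q = chi S"
  shows "S - Q = {}"
proof (rule ccontr)
  assume "S - Q \<noteq> {}"
  then obtain r where r: "r \<in> S - Q" by blast
  have SQ: "S = insert r Q" using rest_unique[OF Q r] r Q(1) by blast
  have fQ: "finite Q" using Q(1) finS finite_subset by blast
  obtain q where q: "q \<in> Q" "\<forall>v\<in>Q. (r, v) \<in> E \<longleftrightarrow> v \<noteq> q" using rest_type(2)[OF Q r] by blast
  have "0 < card Q" using q(1) fQ by (auto simp: card_gt_0_iff)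
  then have cQ: "0 < card Q" "0 < chi S" using Q(3) by simp_all
  define Q' where "Q' = insert r (Q - {q})"
  have rq: "r \<noteq> q" "(r, q) \<notin> E" "(q, r) \<notin> E" using q r adj_commute by auto
  have Q': "Q' \<subseteq> S" "clique Q'" "card Q' = chi S"
    unfolding Q'_def using r Q q fQ cQ clique_subset[OF Q(2), of "Q - {q}"]
    by (auto simp: clique_insert)
  have q': "q \<in> S - Q'" using q(1) Q(1) rq by (auto simp: Q'_def)
  note tr = rest_type(1)[OF Q r] and tq = rest_type(1)[OF Q' q']
  have ne: "r \<noteq> p1" "r \<noteq> p2" "r \<noteq> p3" "r \<noteq> p4" "q \<noteq> p1" "q \<noteq> p2" "q \<noteq> p3" "q \<noteq> p4"
    using r q' by (auto simp: J_def)
  have WQ: "W = {p1, p2, p3, p4} \<union> insert r Q" using SQ pW by (auto simp: J_def)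
  have pQ: "p1 \<notin> Q" "p2 \<notin> Q" "p3 \<notin> Q" "p4 \<notin> Q" using Q(1) by (auto simp: J_def)
  have cW: "card W = card Q + 5"
    unfolding WQ using dist' ne pQ r fQ by simp
  \<comment> \<open>A vertex with four such non-neighbours keeps at most
    \<open>card W - 5 = card Q\<close> neighbours, one below the critical degree.\<close>
  have four: False if "p \<in> W" "distinct [p, a, b, r, q]" "{a, b} \<subseteq> W" "(p, a) \<notin> E" "(p, b) \<notin> E" "(p, r) \<notin> E" "(p, q) \<notin> E" for p a b
  proof -
    have rqW: "r \<in> W" "q \<in> W" using r q' by auto
    have "nbrs W p \<subseteq> W - {p, a, b, r, q}" using that by (auto simp: nbrs_def)
    then have "card (nbrs W p) \<le> card (W - {p, a, b, r, q})" using fin by (intro card_mono) auto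
    also have "\<dots> = card W - card {p, a, b, r, q}"
      using that(1,3) rqW by (intro card_Diff_subset) simp_all
    also have "card {p, a, b, r, q} = 5" using that(2) by simp
    also have "card W - 5 = card Q" using cW by simp
    finally show False using critical_degree[OF fin crit that(1)] chi_S Q(3) by simp
  qed
  have "\<not> ((r, p4) \<notin> E \<and> (q, p4) \<notin> E)"
    using four[of p4 p1 p2] pW ne dist' rq nonadj' adj_commute by auto
  moreover have "\<not> ((r, p1) \<notin> E \<and> (q, p1) \<notin> E)"
    using four[of p1 p3 p4] pW ne dist' rq nonadj adj_commute by auto
  ultimately have "t13 r \<and> t24 q \<or> t13 q \<and> t24 r" using tr tq by blast
  then have "t13 r \<and> t24 q \<and> {r, q} = {r, q} \<or> t13 q \<and> t24 r \<and> {q, r} = {r, q}" by auto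
  then obtain a b where ab: "{a, b} = {r, q}" "t13 a" "t24 b" by blast
  define f where "f v = (if v \<in> {p1, p3, b} then p1 else if v \<in> {p2, p4, a} then p2 else v)" for v
  have "chi W \<le> card ({p1, p2} \<union> (Q - {q}))"
  proof (rule chi_le_image[OF fin])
    show "f ` W \<subseteq> {p1, p2} \<union> (Q - {q})"
      unfolding WQ f_def using ab(1) by auto
    show "f u \<noteq> f v" if "u \<in> W" "v \<in> W" "(u, v) \<in> E" for u v
    proof
      assume eq: "f u = f v"
      have abne: "a \<noteq> p1" "a \<noteq> p2" "a \<noteq> p3" "a \<noteq> p4" "b \<noteq> p1" "b \<noteq> p2" "b \<noteq> p3" "b \<noteq> p4"
        using ab(1) ne by (metis insertCI insertE singletonD)+
      have "u \<noteq> v" using that by auto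
      then have "u \<in> {p1, p3, b} \<and> v \<in> {p1, p3, b} \<or> u \<in> {p2, p4, a} \<and> v \<in> {p2, p4, a}"
        using eq dist' abne unfolding f_def by (auto split: if_splits)
      then show False using that(3) ab(2,3) nonadj nonadj' adj_commute by auto
    qed
  qed (use fQ in auto)
  also have "\<dots> \<le> 2 + (card Q - 1)"
    using card_Un_le[of "{p1, p2}" "Q - {q}"] dist' q(1) fQ by simp
  finally show False using chi_S Q(3) cQ by simp
qed

text \<open>Two adjacent path vertices that see all of \<open>Q\<close> extend \<open>Q\<close> to
  the desired clique. In every other case either a colouring with \<open>card Q + 1\<close> colours
  exists or an induced 5-cycle appears.\<close>

lemma max_clique_of_cover:
  assumes Q: "Q \<subseteq> S" "clique Q" "card Q = chi S"
  shows "\<exists>K\<subseteq>W. clique K \<and> card K = chi W"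
proof -
  have fQ: "finite Q" using Q(1) finS finite_subset by blast
  have WQ: "W = {p1, p2, p3, p4} \<union> Q" using rest_empty[OF Q] Q(1) pW by (auto simp: J_def)
  have pQ: "p1 \<notin> Q" "p2 \<notin> Q" "p3 \<notin> Q" "p4 \<notin> Q" using Q(1) by (auto simp: J_def)
  define full where "full p \<longleftrightarrow> (\<forall>m\<in>Q. (p, m) \<in> E)" for p
  have K: ?thesis if "full a" "full b" "(a, b) \<in> E" "a \<in> W" "b \<in> W" "a \<notin> Q" "b \<notin> Q" for a b
  proof (intro exI[of _ "insert a (insert b Q)"] conjI)
    have "a \<noteq> b" using that(3) by auto
    then show "card (insert a (insert b Q)) = chi W" using chi_S Q(3) that fQ by simp
    show "clique (insert a (insert b Q))" using Q(2) that by (auto simp: clique_insert full_def)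
    show "insert a (insert b Q) \<subseteq> W" using that Q(1) by auto
  qed
  \<comment> \<open>Each of \<open>a\<close> and \<open>b\<close> takes the colour of a clique
    vertex it misses, and the nonadjacent vertices \<open>c\<close> and \<open>d\<close> share the
    single new colour.\<close>
  have colour: False if m: "m \<in> Q" "m' \<in> Q" "(a, m) \<notin> E" "(b, m') \<notin> E" and ab: "m = m' \<Longrightarrow> (a, b) \<notin> E"
    and cd: "(c, d) \<notin> E" and perm: "{a, b, c, d} = {p1, p2, p3, p4}" "distinct [a, b, c, d]" for a b c d m m'
  proof -
    have aQ: "a \<notin> Q" "b \<notin> Q" "c \<notin> Q" "d \<notin> Q" using perm(1) pQ by (metis insertCI insertE singletonD)+
    define f where "f v = (if v \<in> {c, d} then c else if v = a then m else if v = b then m' else v)" for v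
    have "chi W \<le> card (insert c Q)"
    proof (rule chi_le_image[OF fin])
      show "f ` W \<subseteq> insert c Q"
        unfolding WQ f_def using perm(1)[symmetric] m by auto
      show "f u \<noteq> f v" if "u \<in> W" "v \<in> W" "(u, v) \<in> E" for u v
      proof
        assume eq: "f u = f v"
        have "u \<noteq> v" using that by auto
        have uv: "u \<in> {a, b, c, d} \<union> Q" "v \<in> {a, b, c, d} \<union> Q" using that WQ perm(1) by auto
        have s: "(d, c) \<notin> E" "(m, a) \<notin> E" "(m', b) \<notin> E" "m = m' \<Longrightarrow> (b, a) \<notin> E"
          using cd m ab adj_commute by blast+
        show False
          using eq \<open>u \<noteq> v\<close> uv that(3) aQ perm(2) m ab cd s unfolding f_def
          by (auto split: if_splits)
      qed
    qed (use fQ in auto)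
    then show False using chi_S Q(3) fQ card_insert_le_m1 by (metis Suc_n_not_le_n add_2_eq_Suc' card_insert_if le_SucI le_trans)
  qed
  have n2: "\<exists>m\<in>Q. (p, m) \<notin> E" if "\<not> full p" for p using that by (auto simp: full_def)
  \<comment> \<open>If no two consecutive path vertices are full, yet each of the pairs
    \<open>p2\<close>, \<open>p4\<close> and \<open>p1\<close>, \<open>p3\<close> contains a full
    vertex, then precisely the two ends are full.\<close>
  consider "\<not> full p2" "\<not> full p4" | "\<not> full p1" "\<not> full p3" | "full p1" "full p2" | "full p2" "full p3"
    | "full p3" "full p4" | "full p1" "full p4" "\<not> full p2" "\<not> full p3" by blast
  then show ?thesis
  proof cases
    case 1
    then obtain m m' where "m \<in> Q" "m' \<in> Q" "(p2, m) \<notin> E" "(p4, m') \<notin> E" using n2 by meson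
    then have False using colour[of m m' p2 p4 p1 p3] nonadj dist' by auto
    then show ?thesis ..
  next
    case 2
    then obtain m m' where "m \<in> Q" "m' \<in> Q" "(p1, m) \<notin> E" "(p3, m') \<notin> E" using n2 by meson
    then have False using colour[of m m' p1 p3 p2 p4] nonadj dist' by auto
    then show ?thesis ..
  next
    case 3
    then show ?thesis using K path pW pQ by blast
  next
    case 4
    then show ?thesis using K path pW pQ by blast
  next
    case 5
    then show ?thesis using K path pW pQ by blast
  next
    case 6
    obtain m m' where m: "m \<in> Q" "m' \<in> Q" "(p2, m) \<notin> E" "(p3, m') \<notin> E" using n2 6 by meson
    show ?thesis
    proof (cases "m = m'")
      case True
      \<comment> \<open>A common missed vertex \<open>m\<close> closes the path to an induced
        5-cycle, since the full ends \<open>p1\<close> and \<open>p4\<close> both see it.\<close>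
      have "pos_ge W (real (chi W))"
        by (rule critical_C5[OF fin crit, of p1 p2 p3 p4 m])
          (use m True 6 pW pQ Q(1) dist' path nonadj adj_commute in \<open>auto simp: full_def\<close>)
      then show ?thesis using low by simp
    next
      case False
      then have False using colour[of m m' p2 p3 p1 p4] m nonadj dist' by auto
      then show ?thesis ..
    qed
  qed
qed

lemma max_clique: "\<exists>K\<subseteq>W. clique K \<and> card K = chi W"
  using max_clique_exists max_clique_of_cover by blast

end

context simple_graph
begin

theorem clique_of_low_pos:
  assumes "finite W" "\<not> pos_ge W (real (chi W))"
  shows "\<exists>Q\<subseteq>W. clique Q \<and> card Q = chi W"
  using assms
proof (induction "card W" arbitrary: W rule: less_induct)
  case (less W)
  note fin = less.prems(1) and low = less.prems(2)
  have IH: "\<exists>Q\<subseteq>S. clique Q \<and> card Q = chi S" if "S \<subset> W" "\<not> pos_ge S (real (chi S))" for S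
    using less.hyps[of S] that fin psubset_card_mono[OF fin that(1)] finite_subset by blast
  consider "\<not> critical W" | "clique W" | "critical W" "\<not> clique W" by blast
  then show ?case
  proof cases
    case 1
    then obtain v where v: "v \<in> W" "\<not> chi (W - {v}) < chi W" by (auto simp: critical_def)
    then have eq: "chi (W - {v}) = chi W" using chi_mono[OF fin, of "W - {v}"] by auto
    have "\<not> pos_ge (W - {v}) (real (chi (W - {v})))"
      using low pos_ge_mono[OF fin, of "W - {v}"] eq by auto
    then obtain Q where "Q \<subseteq> W - {v}" "clique Q" "card Q = chi (W - {v})" using IH[of "W - {v}"] v(1) by blast
    then show ?thesis using eq by auto
  next
    case 2
    then show ?thesis using chi_clique[OF fin] by (intro exI[of _ W]) auto
  next
    case 3
    then obtain u v where uv: "u \<in> W" "v \<in> W" "u \<noteq> v" "(u, v) \<notin> E" by (auto simp: clique_def)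
    obtain a where a: "a \<in> W" "(u, a) \<in> E" "(v, a) \<notin> E"
      using critical_private_nbr[OF fin 3(1) uv] by blast
    obtain b where b: "b \<in> W" "(v, b) \<in> E" "(u, b) \<notin> E"
      using critical_private_nbr[OF fin 3(1), of v u] uv adj_commute by metis
    have ne: "a \<noteq> u" "a \<noteq> v" "b \<noteq> u" "b \<noteq> v" "a \<noteq> b" using a b uv adj_commute by auto
    have ab: "(a, b) \<in> E"
    proof (rule ccontr)
      assume "(a, b) \<notin> E"
      then have "pos_ge W (real (chi W))"
        by (intro critical_2K2[OF fin 3(1), of u a v b]) (use a b uv ne adj_commute in auto)
      then show False using low by simp
    qed
    have "critical_p4 E W u a b v"
      by unfold_locales (use fin 3 low IH uv a b ab ne adj_commute in auto)
    then show ?thesis by (rule critical_p4.max_clique)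
  qed
qed

section \<open>Vertices attached to a maximum clique\<close>

lemma finite_nbrs [simp]: "finite W \<Longrightarrow> finite (nbrs W v)"
  by (simp add: nbrs_def)

lemma nbrs_subset: "nbrs W v \<subseteq> W"
  by (auto simp: nbrs_def)

text \<open>Stated for a general symmetric \<open>F\<close>, so that it evaluates both quadratic
  forms, with \<open>F u v = y u * y v\<close>, and the value of an explicit witness matrix.\<close>

lemma sum_sum_clique_indep:
  fixes F :: "'a \<Rightarrow> 'a \<Rightarrow> real"
  assumes Q: "finite Q" "clique Q" and R: "finite R" "indep R" and dis: "Q \<inter> R = {}"
    and sym: "\<And>u v. F u v = F v u"
  shows "(\<Sum>u\<in>Q \<union> R. \<Sum>v\<in>Q \<union> R. adjf E u v * F u v)
    = (\<Sum>u\<in>Q. \<Sum>v\<in>Q. F u v) - (\<Sum>u\<in>Q. F u u) + 2 * (\<Sum>r\<in>R. \<Sum>u\<in>nbrs Q r. F r u)"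
proof -
  have QQ: "(\<Sum>v\<in>Q. adjf E u v * F u v) = (\<Sum>v\<in>Q. F u v) - F u u" if "u \<in> Q" for u
  proof -
    have "(\<Sum>v\<in>Q. adjf E u v * F u v) = (\<Sum>v\<in>Q. F u v - (if v = u then F u u else 0))"
      using Q(2) that by (intro sum.cong refl) (auto simp: adjf_def clique_def)
    then show ?thesis using Q(1) that by (simp add: sum_subtractf)
  qed
  have RQ: "(\<Sum>u\<in>Q. adjf E r u * F r u) = (\<Sum>u\<in>nbrs Q r. F r u)" for r
    unfolding nbrs_def adjf_def using Q(1)
    by (simp add: sum.inter_filter if_distrib if_distribR cong: if_cong)
  have RR: "(\<Sum>v\<in>R. adjf E r v * F r v) = 0" if "r \<in> R" for r
    using R(2) that by (intro sum.neutral) (auto simp: adjf_def indep_def)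
  have "adjf E u r * F u r = adjf E r u * F r u" for u r
    using adj_commute[of u r] sym by (simp add: adjf_def)
  then have QR: "(\<Sum>u\<in>Q. \<Sum>r\<in>R. adjf E u r * F u r) = (\<Sum>r\<in>R. \<Sum>u\<in>nbrs Q r. F r u)"
    by (subst sum.swap) (simp add: RQ)
  have "(\<Sum>u\<in>Q \<union> R. \<Sum>v\<in>Q \<union> R. adjf E u v * F u v)
      = (\<Sum>u\<in>Q. \<Sum>v\<in>Q. adjf E u v * F u v) + (\<Sum>u\<in>Q. \<Sum>v\<in>R. adjf E u v * F u v)
      + ((\<Sum>u\<in>R. \<Sum>v\<in>Q. adjf E u v * F u v) + (\<Sum>u\<in>R. \<Sum>v\<in>R. adjf E u v * F u v))"
    using Q(1) R(1) dis by (simp add: sum.union_disjoint sum.distrib)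
  moreover have "(\<Sum>u\<in>Q. \<Sum>v\<in>Q. adjf E u v * F u v) = (\<Sum>u\<in>Q. \<Sum>v\<in>Q. F u v) - (\<Sum>u\<in>Q. F u u)"
    by (simp add: QQ sum_subtractf)
  moreover have "(\<Sum>u\<in>R. \<Sum>v\<in>R. adjf E u v * F u v) = 0"
    by (simp add: RR)
  ultimately show ?thesis by (simp add: QR RQ)
qed

lemma qA_clique_indep:
  assumes "finite Q" "clique Q" "finite R" "indep R" "Q \<inter> R = {}"
  shows "qA (Q \<union> R) y = (sum y Q)\<^sup>2 - (\<Sum>v\<in>Q. (y v)\<^sup>2) + 2 * (\<Sum>r\<in>R. y r * sum y (nbrs Q r))"
  using sum_sum_clique_indep[OF assms, of "\<lambda>u v. y u * y v"]
  by (simp add: qf_def mult_ac power2_eq_square sum_product sum_distrib_left)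

lemma indep_doubleton: "r \<noteq> s \<Longrightarrow> (r, s) \<notin> E \<Longrightarrow> indep {r, s}"
  using adj_commute by (auto simp: indep_def)

lemma qA_clique_plus_two:
  assumes Q: "finite Q" "clique Q" and r: "r \<notin> Q" "s \<notin> Q" "r \<noteq> s" "(r, s) \<notin> E"
  shows "qA (Q \<union> {r, s}) y = (sum y Q)\<^sup>2 - (\<Sum>v\<in>Q. (y v)\<^sup>2)
    + 2 * (y r * sum y (nbrs Q r) + y s * sum y (nbrs Q s))"
  using qA_clique_indep[OF Q _ indep_doubleton[OF r(3,4)]] r by simp

text \<open>The eigenvalue \<open>-2\<close> of the equitable partition \<open>T\<close>, \<open>Q - T\<close>, \<open>{r}\<close> suggests the vector \<open>y\<close>.\<close>

lemma pos_ge_clique_plus_one: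
  assumes Q: "finite Q" "clique Q" and r: "r \<notin> Q"
    and t: "card (nbrs Q r) = t" "0 < t" "t < card Q"
    and big: "2 * (card Q + 1) \<le> t * (card Q - t + 1)"
  shows "pos_ge (Q \<union> {r}) (real (card Q))"
proof -
  let ?T = "nbrs Q r"
  let ?U = "Q - nbrs Q r"
  define u where "u = card Q - t"
  define a b :: real where "a = real t" and "b = real u"
  have cU: "card ?U = u" using Q t(1) nbrs_subset by (simp add: card_Diff_subset u_def)
  have ab: "0 < a" "0 < b" and cQ: "real (card Q) = a + b" using t by (simp_all add: a_def b_def u_def)
  have big': "2 * (a + b + 1) \<le> a * (b + 1)"
  proof -
    have "real (2 * (card Q + 1)) \<le> real (t * (u + 1))" using big u_def by (simp only: of_nat_le_iff)
    then show ?thesis using cQ by (simp add: a_def b_def algebra_simps)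
  qed
  \<comment> \<open>When \<open>big\<close> holds with equality this is an eigenvector for -2. In
    general its Rayleigh quotient is at most -2 exactly under \<open>big\<close>, and the two
    cliques \<open>T\<close> and \<open>Q - T\<close> supply the remaining
    \<open>card Q - 2\<close>.\<close>
  define y where "y v = (if v = r then - a * (b + 1) / 2 else if v \<in> ?T then b + 1 else - a)" for v
  have rT: "r \<notin> ?T" using r nbrs_subset by blast
  have spl: "sum f Q = sum f ?T + sum f ?U" for f :: "'a \<Rightarrow> real"
    using Q(1) nbrs_subset[of Q r] by (metis add.commute sum.subset_diff)
  have yT: "sum (\<lambda>v. f (y v)) ?T = a * f (b + 1)" for f :: "real \<Rightarrow> real"
    using rT t(1) by (subst sum.cong[OF refl, of _ _ "\<lambda>_. f (b + 1)"]) (auto simp: y_def a_def)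
  have yU: "sum (\<lambda>v. f (y v)) ?U = b * f (- a)" for f :: "real \<Rightarrow> real"
    using r cU by (subst sum.cong[OF refl, of _ _ "\<lambda>_. f (- a)"]) (auto simp: y_def b_def)
  have yr: "y r = - a * (b + 1) / 2" by (simp add: y_def)
  have "qA (Q \<union> {r}) y = (sum y Q)\<^sup>2 - (\<Sum>v\<in>Q. (y v)\<^sup>2) + 2 * (y r * sum y ?T)"
    using qA_clique_indep[OF Q, of "{r}" y] r by (simp add: indep_def)
  also have "\<dots> = (a * (b + 1) - b * a)\<^sup>2 - (a * (b + 1)\<^sup>2 + b * a\<^sup>2) - a * (b + 1) * (a * (b + 1))"
    unfolding spl using yT[of "\<lambda>x. x"] yT[of power2] yU[of "\<lambda>x. x"] yU[of power2] by (simp add: yr)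
  finally have q: "qA (Q \<union> {r}) y = a\<^sup>2 - a * (b + 1)\<^sup>2 - b * a\<^sup>2 - a\<^sup>2 * (b + 1)\<^sup>2"
    by (simp add: algebra_simps power2_eq_square)
  have "ip (Q \<union> {r}) y y = (\<Sum>v\<in>Q. (y v)\<^sup>2) + (y r)\<^sup>2"
    using Q r by (simp add: ip_def power2_eq_square)
  also have "\<dots> = a * (b + 1)\<^sup>2 + b * a\<^sup>2 + a\<^sup>2 * (b + 1)\<^sup>2 / 4"
    unfolding spl using yT[of power2] yU[of power2] by (simp add: yr power_divide power_mult_distrib)
  finally have i: "ip (Q \<union> {r}) y y = a * (b + 1)\<^sup>2 + b * a\<^sup>2 + a\<^sup>2 * (b + 1)\<^sup>2 / 4" .
  have ipos: "0 < ip (Q \<union> {r}) y y" unfolding i using ab by (intro add_pos_nonneg) auto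
  have "qA (Q \<union> {r}) y + 2 * ip (Q \<union> {r}) y y = a * (b + 1) * (a + b + 1 - a * (b + 1) / 2)"
    unfolding q i by (simp add: field_simps power2_eq_square)
  also have "\<dots> \<le> 0" using big' ab by (intro mult_nonneg_nonpos) auto
  finally have "2 \<le> - (qA (Q \<union> {r}) y / ip (Q \<union> {r}) y y)" using ipos by (simp add: field_simps)
  moreover have "?T \<noteq> {}" using t by auto
  moreover have "?U \<noteq> {}"
  proof
    assume "?U = {}"
    then have "u = 0" using cU by (metis card.empty)
    then show False using ab by (simp add: b_def)
  qed
  ultimately show ?thesis
    using Q ipos rT r cU t(1) cQ nbrs_subset[of Q r]
    by (intro pos_ge_two_cliques[of _ ?T ?U "[y]"])
      (auto intro: clique_subset simp: y_def a_def b_def)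
qed

lemma cauchy_schwarz: "(ip W x z)\<^sup>2 \<le> ip W x x * ip W z z"
proof (cases "ip W x x = 0")
  case True
  show ?thesis
  proof (cases "finite W")
    case fin: True
    have "\<forall>v\<in>W. x v * x v = 0"
      using True sum_nonneg_eq_0_iff[OF fin, of "\<lambda>v. x v * x v"] by (simp add: ip_def)
    then have "ip W x z = 0" by (simp add: ip_def)
    then show ?thesis by (simp add: ip_self_nonneg)
  qed (simp add: ip_def)
next
  case False
  then have "0 < ip W x x" using ip_self_nonneg[of W x] by simp
  then show ?thesis using bessel[of W "[x]" z] by (simp add: field_simps)
qed

text \<open>Here \<open>w r\<close> is the projection of the neighbourhood of \<open>r\<close> onto the vectors of sum zero on \<open>Q\<close>. On
  that space extended by the coordinates in \<open>R\<close> the adjacency form has the block shape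
  \<open>[[-1, W], [W\<^sup>T, 0]]\<close>, and the witness \<open>X\<close> is optimal when \<open>W W\<^sup>T\<close> has the single eigenvalue \<open>2\<close>.\<close>

lemma pos_ge_clique_plus_many:
  assumes Q: "finite Q" "clique Q" "Q \<noteq> {}" and R: "finite R" "indep R" and dis: "Q \<inter> R = {}"
    and big: "2 * card Q \<le> (\<Sum>r\<in>R. card (nbrs Q r) * (card Q - card (nbrs Q r)))"
  shows "pos_ge (Q \<union> R) (real (card Q))"
proof -
  define k where "k = real (card Q)"
  define t where "t r = real (card (nbrs Q r))" for r
  have k: "0 < k" using Q by (simp add: k_def card_gt_0_iff)
  define w where "w r v = (if v \<in> nbrs Q r then 1 else 0) - t r / k" for r v
  define om where "om r = t r * (k - t r) / k" for r
  have tk: "card (nbrs Q r) \<le> card Q" for r using Q(1) nbrs_subset by (rule card_mono)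
  have sind: "(\<Sum>v\<in>Q. if v \<in> nbrs Q r then f v else 0) = sum f (nbrs Q r)" for r and f :: "'a \<Rightarrow> real"
    using Q(1) nbrs_subset[of Q r] by (simp add: sum.inter_restrict[symmetric] Int_absorb1 Int_commute)
  have w0: "(\<Sum>v\<in>Q. w r v) = 0" for r
    using k sind[of r "\<lambda>_. 1"] by (simp add: w_def sum_subtractf t_def[symmetric] k_def[symmetric])
  have wT: "(\<Sum>v\<in>nbrs Q r. w r v) = om r" for r
  proof -
    have "(\<Sum>v\<in>nbrs Q r. w r v) = t r * (1 - t r / k)"
      unfolding w_def by (subst sum.cong[OF refl, of _ _ "\<lambda>_. 1 - t r / k"]) (auto simp: t_def)
    then show ?thesis using k by (simp add: om_def field_simps)
  qed
  have ww: "(\<Sum>v\<in>Q. (w r v)\<^sup>2) = om r" for r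
  proof -
    have "(\<Sum>v\<in>Q. (w r v)\<^sup>2) = (\<Sum>v\<in>Q. (if v \<in> nbrs Q r then w r v else 0) - t r / k * w r v)"
      by (intro sum.cong refl) (auto simp: w_def power2_eq_square algebra_simps)
    then show ?thesis by (simp only: sum_subtractf sind sum_distrib_left[symmetric] wT w0)
  qed
  define tau where "tau = (\<Sum>r\<in>R. om r)"
  have "k * tau = (\<Sum>r\<in>R. t r * (k - t r))" using k by (simp add: tau_def om_def sum_distrib_left)
  also have "\<dots> = real (\<Sum>r\<in>R. card (nbrs Q r) * (card Q - card (nbrs Q r)))"
    using tk by (simp add: t_def k_def of_nat_diff)
  also have "\<dots> \<ge> 2 * k" using big unfolding k_def by (metis of_nat_le_iff of_nat_mult of_nat_numeral)
  finally have tau: "2 \<le> tau" using k by simp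
  \<comment> \<open>Scaling by \<open>c\<close> gives the projected neighbourhoods total squared
    norm exactly 2; \<open>big\<close> is what makes \<open>c\<close> at most 1.\<close>
  define c where "c = sqrt (2 / tau)"
  have c: "0 < c" "c \<le> 1" "c\<^sup>2 * tau = 2" "c * tau = 2 / c"
    using tau by (simp_all add: c_def field_simps real_sqrt_mult_self real_sqrt_divide)
  \<comment> \<open>For a single singular value sqrt 2 the model matrix [[-1, sqrt 2], [sqrt 2, 0]]
    has eigenvalues 1 and -2, and its projection onto -2 is [[2/3, -sqrt 2 / 3],
    [-sqrt 2 / 3, 1/3]]. The constants \<open>c / 3\<close>, \<open>c\<^sup>2 / 6\<close> and
    \<open>1 / 3\<close> transcribe this projection.\<close>
  define X where "X u v = (if u \<in> Q then
      if v \<in> Q then (if u = v then 1 else 0) - 1 / k - c\<^sup>2 / 6 * (\<Sum>r\<in>R. w r u * w r v)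
      else - c / 3 * w v u
    else if v \<in> Q then - c / 3 * w u v else if u = v then 1 / 3 else 0)" for u v
  have Xsym: "X u v = X v u" for u v by (simp add: X_def mult.commute)
  have notQ: "r \<notin> Q" if "r \<in> R" for r using that dis by auto
  define s where "s z r = (\<Sum>v\<in>Q. w r v * z v)" for z r
  define D where "D z = (\<Sum>v\<in>Q. (z v)\<^sup>2) - (sum z Q)\<^sup>2 / k" for z
  have qX: "qf (Q \<union> R) X z = D z - c\<^sup>2 / 6 * (\<Sum>r\<in>R. (s z r)\<^sup>2) - 2 * c / 3 * (\<Sum>r\<in>R. z r * s z r)
      + (\<Sum>r\<in>R. (z r)\<^sup>2) / 3" for z
  proof -
    have sq: "(\<Sum>u\<in>Q. \<Sum>v\<in>Q. w r u * w r v * z u * z v) = (s z r)\<^sup>2" for r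
      by (simp add: s_def power2_eq_square sum_product mult_ac)
    have "(\<Sum>u\<in>Q. \<Sum>v\<in>Q. X u v * z u * z v)
        = (\<Sum>u\<in>Q. \<Sum>v\<in>Q. (if u = v then z u * z v else 0) - (z u * z v) / k
            - c\<^sup>2 / 6 * (\<Sum>r\<in>R. w r u * w r v * z u * z v))"
      by (intro sum.cong refl) (auto simp: X_def algebra_simps sum_distrib_left sum_distrib_right)
    also have "\<dots> = D z - c\<^sup>2 / 6 * (\<Sum>u\<in>Q. \<Sum>v\<in>Q. \<Sum>r\<in>R. w r u * w r v * z u * z v)"
      using Q(1) by (simp add: sum_subtractf D_def power2_eq_square sum_product
          sum_divide_distrib[symmetric] sum_distrib_left[symmetric])
    also have "(\<Sum>u\<in>Q. \<Sum>v\<in>Q. \<Sum>r\<in>R. w r u * w r v * z u * z v) = (\<Sum>r\<in>R. (s z r)\<^sup>2)"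
    proof -
      have "(\<Sum>u\<in>Q. \<Sum>v\<in>Q. \<Sum>r\<in>R. w r u * w r v * z u * z v)
          = (\<Sum>u\<in>Q. \<Sum>r\<in>R. \<Sum>v\<in>Q. w r u * w r v * z u * z v)"
        by (intro sum.cong refl sum.swap)
      also have "\<dots> = (\<Sum>r\<in>R. \<Sum>u\<in>Q. \<Sum>v\<in>Q. w r u * w r v * z u * z v)" by (rule sum.swap)
      finally show ?thesis by (simp add: sq)
    qed
    finally have QQ: "(\<Sum>u\<in>Q. \<Sum>v\<in>Q. X u v * z u * z v) = D z - c\<^sup>2 / 6 * (\<Sum>r\<in>R. (s z r)\<^sup>2)" .
    have RQ: "(\<Sum>r\<in>R. \<Sum>v\<in>Q. X r v * z r * z v) = - c / 3 * (\<Sum>r\<in>R. z r * s z r)"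
      unfolding s_def sum_distrib_left
      by (intro sum.cong refl) (auto simp: X_def notQ)
    have QR: "(\<Sum>u\<in>Q. \<Sum>r\<in>R. X u r * z u * z r) = - c / 3 * (\<Sum>r\<in>R. z r * s z r)"
      unfolding RQ[symmetric] by (subst sum.swap) (simp add: Xsym mult_ac)
    have RR: "(\<Sum>r\<in>R. \<Sum>r'\<in>R. X r r' * z r * z r') = (\<Sum>r\<in>R. (z r)\<^sup>2) / 3"
    proof -
      have "(\<Sum>r\<in>R. \<Sum>r'\<in>R. X r r' * z r * z r') = (\<Sum>r\<in>R. \<Sum>r'\<in>R. if r = r' then (z r)\<^sup>2 / 3 else 0)"
        by (intro sum.cong refl) (auto simp: X_def notQ power2_eq_square)
      then show ?thesis using R(1) by (simp add: sum_divide_distrib)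
    qed
    have "qf (Q \<union> R) X z = (\<Sum>u\<in>Q. \<Sum>v\<in>Q. X u v * z u * z v) + (\<Sum>u\<in>Q. \<Sum>r\<in>R. X u r * z u * z r)
      + ((\<Sum>r\<in>R. \<Sum>v\<in>Q. X r v * z r * z v) + (\<Sum>r\<in>R. \<Sum>r'\<in>R. X r r' * z r * z r'))"
      unfolding qf_def using Q(1) R(1) dis by (simp add: sum.union_disjoint sum.distrib)
    then show ?thesis by (simp add: QQ QR RQ RR)
  qed
  have sD: "(s z r)\<^sup>2 \<le> om r * D z" for z r
  proof -
    define m where "m = sum z Q / k"
    have "s z r = (\<Sum>v\<in>Q. w r v * (z v - m))"
      using w0[of r] by (simp add: s_def right_diff_distrib sum_subtractf sum_distrib_right[symmetric])
    moreover have "(\<Sum>v\<in>Q. (z v - m)\<^sup>2) = D z"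
    proof -
      have "(\<Sum>v\<in>Q. (z v - m)\<^sup>2) = (\<Sum>v\<in>Q. (z v)\<^sup>2) - 2 * m * sum z Q + k * m\<^sup>2"
        by (simp add: power2_diff sum.distrib sum_subtractf sum_distrib_left sum_distrib_right k_def mult_ac)
      then show ?thesis using k by (simp add: D_def m_def power2_eq_square field_simps)
    qed
    ultimately show ?thesis
      using cauchy_schwarz[of Q "w r" "\<lambda>v. z v - m"] ww[of r] by (simp add: ip_def power2_eq_square)
  qed
  have S: "c\<^sup>2 * (\<Sum>r\<in>R. (s z r)\<^sup>2) \<le> 2 * D z" for z
  proof -
    have "(\<Sum>r\<in>R. (s z r)\<^sup>2) \<le> tau * D z"
      unfolding tau_def sum_distrib_right by (intro sum_mono sD)
    then have "c\<^sup>2 * (\<Sum>r\<in>R. (s z r)\<^sup>2) \<le> c\<^sup>2 * (tau * D z)" by (intro mult_left_mono) auto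
    then show ?thesis using c(3) by (simp add: mult.assoc[symmetric])
  qed
  have feas: "feasible (Q \<union> R) X"
    unfolding feasible_def
  proof (intro allI conjI)
    fix z
    \<comment> \<open>The form of \<open>X\<close> is this square plus \<open>D z\<close> minus half
      of the sum that \<open>S\<close> bounds by \<open>2 * D z\<close>.\<close>
    have "0 \<le> (\<Sum>r\<in>R. (z r - c * s z r)\<^sup>2) / 3" by (simp add: sum_nonneg)
    also have "\<dots> = (\<Sum>r\<in>R. (z r)\<^sup>2) / 3 - 2 * c / 3 * (\<Sum>r\<in>R. z r * s z r) + c\<^sup>2 / 3 * (\<Sum>r\<in>R. (s z r)\<^sup>2)"
      by (simp add: power2_diff power_mult_distrib sum.distrib sum_subtractf sum_distrib_left sum_divide_distrib mult_ac)
    finally show "0 \<le> qf (Q \<union> R) X z" unfolding qX using S[of z] by simp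
    have "0 \<le> (\<Sum>r\<in>R. (c * s z r + 2 * z r)\<^sup>2) / 6" by (simp add: sum_nonneg)
    also have "\<dots> = c\<^sup>2 / 6 * (\<Sum>r\<in>R. (s z r)\<^sup>2) + 2 * c / 3 * (\<Sum>r\<in>R. z r * s z r) + 2 / 3 * (\<Sum>r\<in>R. (z r)\<^sup>2)"
      by (simp add: power2_sum power_mult_distrib sum.distrib sum_distrib_left sum_divide_distrib mult_ac)
    finally have "qf (Q \<union> R) X z \<le> D z + (\<Sum>r\<in>R. (z r)\<^sup>2)" unfolding qX by simp
    also have "\<dots> \<le> (\<Sum>v\<in>Q \<union> R. (z v)\<^sup>2)"
      using Q(1) R(1) dis k by (simp add: D_def sum.union_disjoint)
    finally show "qf (Q \<union> R) X z \<le> (\<Sum>v\<in>Q \<union> R. (z v)\<^sup>2)" .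
  qed
  have "adj_val (Q \<union> R) X = (\<Sum>u\<in>Q. \<Sum>v\<in>Q. X u v) - (\<Sum>u\<in>Q. X u u) + 2 * (\<Sum>r\<in>R. \<Sum>u\<in>nbrs Q r. X r u)"
    unfolding adj_val_def by (rule sum_sum_clique_indep[OF Q(1,2) R dis Xsym])
  also have "(\<Sum>u\<in>Q. \<Sum>v\<in>Q. X u v) = 0"
  proof -
    have "(\<Sum>v\<in>Q. X u v) = 0" if "u \<in> Q" for u
    proof -
      have "(\<Sum>v\<in>Q. X u v) = (\<Sum>v\<in>Q. (if u = v then 1 else 0) - 1 / k - c\<^sup>2 / 6 * (\<Sum>r\<in>R. w r u * w r v))"
        using that by (intro sum.cong) (auto simp: X_def)
      also have "\<dots> = 1 - k * (1 / k) - c\<^sup>2 / 6 * (\<Sum>r\<in>R. w r u * (\<Sum>v\<in>Q. w r v))"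
      proof -
        have "(\<Sum>v\<in>Q. \<Sum>r\<in>R. w r u * w r v) = (\<Sum>r\<in>R. w r u * (\<Sum>v\<in>Q. w r v))"
          by (subst sum.swap) (simp add: sum_distrib_left)
        then show ?thesis
          using that Q(1) unfolding sum_subtractf sum_distrib_left[symmetric] by (simp add: k_def)
      qed
      finally show ?thesis using k by (simp add: w0)
    qed
    then show ?thesis by simp
  qed
  also have "(\<Sum>u\<in>Q. X u u) = k - 1 - c\<^sup>2 / 6 * tau"
  proof -
    have "(\<Sum>u\<in>Q. X u u) = (\<Sum>u\<in>Q. 1 - 1 / k - c\<^sup>2 / 6 * (\<Sum>r\<in>R. (w r u)\<^sup>2))"
      by (intro sum.cong) (auto simp: X_def power2_eq_square)
    also have "\<dots> = k * (1 - 1 / k) - c\<^sup>2 / 6 * (\<Sum>r\<in>R. \<Sum>u\<in>Q. (w r u)\<^sup>2)"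
      unfolding sum_subtractf sum_distrib_left[symmetric]
      by (subst (2) sum.swap) (simp add: k_def right_diff_distrib)
    finally show ?thesis using k by (simp add: ww tau_def right_diff_distrib)
  qed
  also have "(\<Sum>r\<in>R. \<Sum>u\<in>nbrs Q r. X r u) = - c / 3 * tau"
  proof -
    have "(\<Sum>u\<in>nbrs Q r. X r u) = - c / 3 * om r" if "r \<in> R" for r
      unfolding wT[symmetric] sum_distrib_left using notQ[OF that] nbrs_subset[of Q r]
      by (intro sum.cong) (auto simp: X_def)
    then show ?thesis by (simp add: tau_def sum_distrib_left)
  qed
  finally have "- adj_val (Q \<union> R) X = k - 1 - c\<^sup>2 * tau / 6 + 2 / 3 * (c * tau)" by simp
  also have "\<dots> = k - 4 / 3 + 4 / (3 * c)" unfolding c(3,4) by simp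
  also have "\<dots> \<ge> k" using c(1,2) by (simp add: field_simps)
  finally show ?thesis using pos_ge_neg[OF _ feas] Q(1) R(1) by (simp add: k_def)
qed

text \<open>Here \<open>q\<close>, \<open>r\<close>, \<open>s\<close> are three independent
  vertices, all joined to the clique \<open>Q - {q}\<close>. The largest eigenvalue alone reaches
  \<open>card Q\<close>, with equality for order 3, and \<open>x\<close> is the eigenvector of that
  boundary case.\<close>

lemma pos_ge_two_twins:
  assumes Q: "finite Q" "clique Q" "3 \<le> card Q" and r: "r \<notin> Q" "s \<notin> Q" "r \<noteq> s" "(r, s) \<notin> E"
    and q: "q \<in> Q" "nbrs Q r = Q - {q}" "nbrs Q s = Q - {q}"
  shows "pos_ge (Q \<union> {r, s}) (real (card Q))"
proof -
  define k where "k = real (card Q)"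
  have k: "3 \<le> k" using Q(3) by (simp add: k_def)
  define x where "x v = (if v \<in> Q - {q} then k else k - 1)" for v
  have c: "real (card (Q - {q})) = k - 1" using Q q(1) by (simp add: k_def of_nat_diff)
  have f: "(\<Sum>v\<in>Q - {q}. f (x v)) = (k - 1) * f k" for f :: "real \<Rightarrow> real"
  proof -
    have "(\<Sum>v\<in>Q - {q}. f (x v)) = (\<Sum>v\<in>Q - {q}. f k)" by (simp add: x_def)
    also have "\<dots> = (k - 1) * f k" unfolding sum_constant c ..
    finally show ?thesis .
  qed
  have spl: "(\<Sum>v\<in>Q. f (x v)) = f (k - 1) + (k - 1) * f k" for f :: "real \<Rightarrow> real"
    unfolding sum.remove[OF Q(1) q(1)] f by (simp add: x_def)
  have xr: "x r = k - 1" "x s = k - 1" using r by (simp_all add: x_def)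
  let ?W = "Q \<union> {r, s}"
  have "qA ?W x = (sum x Q)\<^sup>2 - (\<Sum>v\<in>Q. (x v)\<^sup>2) + 2 * (x r * sum x (nbrs Q r) + x s * sum x (nbrs Q s))"
    by (rule qA_clique_plus_two[OF Q(1,2) r])
  also have "\<dots> = (k - 1 + (k - 1) * k)\<^sup>2 - ((k - 1)\<^sup>2 + (k - 1) * k\<^sup>2) + 4 * (k - 1) * ((k - 1) * k)"
    using spl[of "\<lambda>x. x"] spl[of power2] f[of "\<lambda>x. x"] by (simp add: q xr)
  finally have qx: "qA ?W x = (k - 1 + (k - 1) * k)\<^sup>2 - ((k - 1)\<^sup>2 + (k - 1) * k\<^sup>2) + 4 * (k - 1) * ((k - 1) * k)" .
  have ix: "ip ?W x x = 3 * (k - 1)\<^sup>2 + (k - 1) * k\<^sup>2"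
    using Q(1) r spl[of power2] by (simp add: ip_def xr power2_eq_square)
  have "qA ?W x - k * ip ?W x x = (k - 1) * (k * (k - 3))"
    unfolding qx ix by (simp add: algebra_simps power2_eq_square power3_eq_cube)
  also have "\<dots> \<ge> 0" using k by simp
  finally have "k * ip ?W x x \<le> qA ?W x" by simp
  moreover have "0 < ip ?W x x" unfolding ix using k by (intro add_pos_pos) auto
  ultimately show ?thesis
    using Q(1) by (intro pos_ge_orth[of _ "[x]"]) (auto simp: k_def field_simps)
qed

text \<open>\<open>Q\<close> with \<open>s\<close> is a complete graph minus an edge, so
  \<open>x\<close> loses only 2 / (k + 1) against \<open>k\<close>. The orthogonal vector
  \<open>y\<close>, concentrated on the edge from \<open>a\<close> to \<open>r\<close>, makes up for
  this loss from order 4 on.\<close>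

lemma pos_ge_pendant_and_near_twin:
  assumes Q: "finite Q" "clique Q" "4 \<le> card Q" and r: "r \<notin> Q" "s \<notin> Q" "r \<noteq> s" "(r, s) \<notin> E"
    and ab: "a \<in> Q" "b \<in> Q" "a \<noteq> b" "nbrs Q r = {a}" "nbrs Q s = Q - {b}"
  shows "pos_ge (Q \<union> {r, s}) (real (card Q))"
proof -
  define k where "k = real (card Q)"
  have k: "4 \<le> k" using Q(3) by (simp add: k_def)
  define W where "W = Q \<union> {r, s}"
  have fW: "finite W" using Q(1) by (simp add: W_def)
  define x where "x v = (if v = r then 0 else 1 :: real)" for v
  \<comment> \<open>With value \<tau> k at \<open>r\<close> the quotient tends to (2 \<tau> - 1) /
    (1 + \<tau>^2), which is largest at the golden ratio; 3/2 is a rational substitute.\<close>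
  define y where "y v = (if v = r then 3 * k / 2 else if v = a then k else -1)" for v
  have ca: "real (card (Q - {a})) = k - 1" "real (card (Q - {b})) = k - 1"
    using Q ab by (simp_all add: k_def of_nat_diff)
  have fx: "(\<Sum>v\<in>A. f (x v)) = real (card A) * f 1" if "A \<subseteq> Q" for A and f :: "real \<Rightarrow> real"
    using that r by (subst sum.cong[OF refl, of _ _ "\<lambda>_. f 1"]) (auto simp: x_def)
  have fy: "(\<Sum>v\<in>Q. f (y v)) = f k + (k - 1) * f (-1)" for f :: "real \<Rightarrow> real"
  proof -
    have "(\<Sum>v\<in>Q. f (y v)) = f (y a) + (\<Sum>v\<in>Q - {a}. f (y v))" by (rule sum.remove[OF Q(1) ab(1)])
    also have "(\<Sum>v\<in>Q - {a}. f (y v)) = (\<Sum>v\<in>Q - {a}. f (-1))"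
      using r by (intro sum.cong) (auto simp: y_def)
    also have "\<dots> = (k - 1) * f (-1)" unfolding sum_constant ca ..
    also have "y a = k" using ab(1) r by (auto simp: y_def)
    finally show ?thesis .
  qed
  have yb: "(\<Sum>v\<in>Q - {b}. y v) = 2"
  proof -
    have "y b = -1" using ab r by (auto simp: y_def)
    then show ?thesis using sum.remove[OF Q(1) ab(2), of y] fy[of "\<lambda>x. x"] by simp
  qed
  have v: "x r = 0" "x s = 1" "x a = 1" "y r = 3 * k / 2" "y s = -1" "y a = k"
    using r ab by (auto simp: x_def y_def)
  have qx: "qA W x = k\<^sup>2 - k + 2 * (k - 1)"
    unfolding W_def qA_clique_plus_two[OF Q(1,2) r]
    using fx[of Q "\<lambda>x. x"] fx[of Q power2] fx[of "Q - {b}" "\<lambda>x. x"] ca by (simp add: ab v k_def)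
  have ix: "ip W x x = k + 1"
    using Q(1) r fx[of Q power2] by (simp add: W_def ip_def v power2_eq_square k_def)
  have qy: "qA W y = 2 * k\<^sup>2 - k - 2"
    unfolding W_def qA_clique_plus_two[OF Q(1,2) r]
    using fy[of "\<lambda>x. x"] fy[of power2] yb by (simp add: ab v power2_eq_square algebra_simps)
  have iy: "ip W y y = 13 * k\<^sup>2 / 4 + k"
    using Q(1) r fy[of power2] by (simp add: W_def ip_def v power2_eq_square)
  have xy: "ip W x y = 0"
  proof -
    have "(\<Sum>v\<in>Q. x v * y v) = (\<Sum>v\<in>Q. y v)" using r by (intro sum.cong) (auto simp: x_def)
    then show ?thesis using Q(1) r fy[of "\<lambda>x. x"] by (simp add: W_def ip_def v)
  qed
  have pos: "0 < k + 1" "0 < 13 * k\<^sup>2 / 4 + k" using k by (auto intro: add_pos_pos)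
  have "k \<le> (k\<^sup>2 - k + 2 * (k - 1)) / (k + 1) + (2 * k\<^sup>2 - k - 2) / (13 * k\<^sup>2 / 4 + k)"
  proof -
    have "(k\<^sup>2 - k + 2 * (k - 1)) / (k + 1) = k - 2 / (k + 1)"
      using pos by (simp add: field_simps power2_eq_square)
    moreover have "2 / (k + 1) \<le> (2 * k\<^sup>2 - k - 2) / (13 * k\<^sup>2 / 4 + k)"
    proof -
      have "0 \<le> (k - 4) * (2 * k\<^sup>2 + 5 / 2 * k + 5)" using k by (intro mult_nonneg_nonneg) auto
      moreover have "(2 * k\<^sup>2 - k - 2) * (k + 1) - 2 * (13 * k\<^sup>2 / 4 + k) = (k - 4) * (2 * k\<^sup>2 + 5 / 2 * k + 5) + 18"
        by (simp add: field_simps power2_eq_square)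
      ultimately have "2 * (13 * k\<^sup>2 / 4 + k) \<le> (2 * k\<^sup>2 - k - 2) * (k + 1)" by linarith
      moreover have "2 / p \<le> B / C" if "0 < p" "0 < C" "2 * C \<le> B * p" for p B C :: real
        using that by (simp add: field_simps)
      ultimately show ?thesis using pos by blast
    qed
    ultimately show ?thesis by simp
  qed
  then have "pos_ge W k"
    using pos by (intro pos_ge_orth[OF fW, of "[x, y]"]) (auto simp: qx ix qy iy xy)
  then show ?thesis by (simp add: k_def W_def)
qed

text \<open>Counts negative eigenvalues: vectors of sum zero on \<open>Q - {a, b}\<close> give p -
  1, so \<open>y\<close> and \<open>z\<close> must add 3. The antisymmetric \<open>y\<close> uses
  8/5 for the golden ratio and yields 144/89, which leaves 123/89 for \<open>z\<close>.\<close>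

lemma pos_ge_two_pendants:
  assumes Q: "finite Q" "clique Q" "4 \<le> card Q" and r: "r \<notin> Q" "s \<notin> Q" "r \<noteq> s" "(r, s) \<notin> E"
    and ab: "a \<in> Q" "b \<in> Q" "a \<noteq> b" "nbrs Q r = {a}" "nbrs Q s = {b}"
  shows "pos_ge (Q \<union> {r, s}) (real (card Q))"
proof -
  define W where "W = Q \<union> {r, s}"
  have fW: "finite W" using Q(1) by (simp add: W_def)
  let ?U = "Q - {a, b}"
  define p where "p = real (card Q) - 2"
  define N where "N = 5 * p + 2"
  have p: "2 \<le> p" using Q(3) by (simp add: p_def)
  have cU: "real (card ?U) = p" using Q ab by (simp add: p_def of_nat_diff card_Diff_subset)
  define y where "y v = (if v = a then 8 else if v = b then -8 else if v = r then -5 else if v = s then 5 else 0 :: real)" for v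
  \<comment> \<open>\<open>N\<close> nearly balances the sum over \<open>Q\<close>, leaving 4. The
    factor 18/25 is close to the reciprocal of the eigenvalue's modulus, about 1.39, as the
    eigenvalue equation at a pendant vertex requires.\<close>
  define z where "z v = (if v \<in> {a, b} then N else if v \<in> {r, s} then - 18 / 25 * N else -10)" for v
  have ne: "a \<noteq> r" "a \<noteq> s" "b \<noteq> r" "b \<noteq> s" using ab r by auto
  have spl: "sum f Q = f a + f b + sum f ?U" for f :: "'a \<Rightarrow> real"
  proof -
    have "sum f Q = sum f {a, b} + sum f ?U"
      using Q(1) ab by (metis add.commute empty_subsetI insert_subset sum.subset_diff)
    then show ?thesis using ab(3) by simp
  qed
  have yU: "y v = 0" if "v \<in> ?U" for v using that r by (auto simp: y_def)
  have zU: "z v = -10" if "v \<in> ?U" for v using that r by (auto simp: z_def)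
  have yv: "y a = 8" "y b = -8" "y r = -5" "y s = 5" using ab ne r by (auto simp: y_def)
  have zv: "z a = N" "z b = N" "z r = - 18 / 25 * N" "z s = - 18 / 25 * N" using ne by (auto simp: z_def)
  have qy: "qA W y = -288"
    unfolding W_def qA_clique_plus_two[OF Q(1,2) r] spl by (simp add: ab yv yU)
  have iy: "ip W y y = 178" using Q(1) r by (simp add: W_def ip_def spl yv yU)
  have yz: "ip W y z = 0" using Q(1) r by (simp add: W_def ip_def spl yv yU zv)
  have qz: "qA W z = 16 - 2 * N\<^sup>2 - 100 * p - 72 / 25 * N\<^sup>2"
  proof -
    have "sum z Q = 4" unfolding spl by (simp add: zv zU cU N_def)
    moreover have "(\<Sum>v\<in>Q. (z v)\<^sup>2) = 2 * N\<^sup>2 + 100 * p" unfolding spl by (simp add: zv zU cU)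
    ultimately show ?thesis
      unfolding W_def qA_clique_plus_two[OF Q(1,2) r] by (simp add: ab zv power2_eq_square)
  qed
  have iz: "ip W z z = 2 * N\<^sup>2 + 100 * p + 648 / 625 * N\<^sup>2"
    using Q(1) r by (simp add: W_def ip_def spl zv zU cU power2_eq_square)
  have N0: "0 < N" using p by (simp add: N_def)
  have zpos: "0 < ip W z z" unfolding iz using p N0 by (intro add_pos_pos) auto
  have "123 / 89 * ip W z z \<le> - qA W z"
  proof -
    have "0 \<le> (p - 2) * (p + 1 / 2)" using p by (intro mult_nonneg_nonneg) auto
    moreover have "(p - 2) * (p + 1 / 2) = p\<^sup>2 - 3 / 2 * p - 1" by (simp add: field_simps power2_eq_square)
    ultimately have "3 / 2 * p + 1 \<le> p\<^sup>2" by simp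
    then have "0 \<le> 683 * (25 * p\<^sup>2 + 20 * p + 4) - 38210 * p - 16000" using p by simp
    also have "25 * p\<^sup>2 + 20 * p + 4 = N\<^sup>2" by (simp add: N_def power2_eq_square field_simps)
    finally have "0 \<le> 683 / 1000 * N\<^sup>2 - 3821 / 100 * p - 16" by simp
    moreover have "683 / 1000 * N\<^sup>2 \<le> 37996 / 55625 * N\<^sup>2" by (intro mult_right_mono) auto
    moreover have "3400 / 89 * p \<le> 3821 / 100 * p" using p by (intro mult_right_mono) auto
    moreover have "- qA W z - 123 / 89 * ip W z z = 37996 / 55625 * N\<^sup>2 - 3400 / 89 * p - 16"
      unfolding qz iz by (simp add: field_simps)
    ultimately show ?thesis by linarith
  qed
  then have z: "123 / 89 \<le> - (qA W z / ip W z z)" using zpos by (simp add: field_simps)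
  have U: "?U \<noteq> {}"
  proof
    assume "?U = {}"
    then have "p = 0" using cU by (metis card.empty of_nat_0)
    then show False using p by simp
  qed
  have "pos_ge W (p + 2)"
  proof (rule pos_ge_two_cliques[of _ "{a}" ?U "[y, z]"])
    show "clique {a}" by (simp add: clique_def)
    show "clique ?U" using Q(2) by (rule clique_subset) auto
    show "orth W [y, z]" using iy yz zpos by simp
    show "p + 2 \<le> real (card {a}) - 1 + (real (card ?U) - 1) - (\<Sum>y\<leftarrow>[y, z]. qA W y / ip W y y)"
    proof -
      have "p + 2 \<le> p - 1 - (- 288 / 178 + qA W z / ip W z z)" using z by linarith
      then show ?thesis by (simp add: cU qy iy)
    qed
    show "\<exists>c. \<forall>v\<in>?U. f v = c" if "f \<in> set [y, z]" for f
      using that yU zU by auto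
  qed (use fW ab U in \<open>auto simp: W_def\<close>)
  then show ?thesis by (simp add: p_def W_def)
qed

text \<open>The graph splits into two disjoint cliques, \<open>r\<close> with its neighbours and
  \<open>s\<close> with the rest of \<open>Q\<close>. Each added vertex restores the unit that a
  clique loses.\<close>

lemma pos_ge_two_cover:
  assumes Q: "finite Q" "clique Q" and r: "r \<notin> Q" "s \<notin> Q" "r \<noteq> s"
    and cover: "nbrs Q r \<union> nbrs Q s = Q"
  shows "pos_ge (Q \<union> {r, s}) (real (card Q))"
proof -
  let ?A = "insert r (nbrs Q r)" and ?B = "insert s (Q - nbrs Q r)"
  have cliq: "clique ?A" "clique ?B"
    using Q(2) cover clique_subset[OF Q(2), of "Q - nbrs Q r"] clique_subset[OF Q(2) nbrs_subset]
    by (auto simp: clique_insert nbrs_def)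
  have card: "card ?A = card (nbrs Q r) + 1" "card ?B = card (Q - nbrs Q r) + 1"
    using Q(1) r by (auto simp: nbrs_def)
  have "real (card Q) = real (card (nbrs Q r)) + real (card (Q - nbrs Q r))"
    using Q(1) nbrs_subset[of Q r] by (simp add: card_Diff_subset card_mono of_nat_diff)
  moreover have "pos_ge ?A (real (card (nbrs Q r)))" "pos_ge ?B (real (card (Q - nbrs Q r)))"
    using pos_ge_clique'[OF _ cliq(1)] pos_ge_clique'[OF _ cliq(2)] Q(1) unfolding card by simp_all
  ultimately show ?thesis
    using Q(1) r nbrs_subset[of Q r]
    by - (rule pos_ge_add[of _ ?A ?B "real (card (nbrs Q r))" "real (card (Q - nbrs Q r))"], auto)
qed

lemma adj_clique_plus_two:
  assumes Q: "clique Q" and r: "r \<notin> Q" "s \<notin> Q" "(r, s) \<notin> E"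
    and uv: "u \<in> Q \<or> u = r \<or> u = s" "v \<in> Q \<or> v = r \<or> v = s"
  shows "(u, v) \<in> E \<longleftrightarrow> (if u \<in> Q then if v \<in> Q then u \<noteq> v else u \<in> nbrs Q v else v \<in> nbrs Q u)"
  using Q r uv adj_commute[of s r] adj_commute[of u v] by (auto simp: clique_def nbrs_def)

text \<open>The case of order 3 not reached by \<open>pos_ge_pendant_and_near_twin\<close>. The two
  quotients are 8/3 and 1/3, so this certificate has no slack.\<close>

lemma pos_ge_dart:
  assumes Q: "finite Q" "clique Q" "card Q = 3" and r: "r \<notin> Q" "s \<notin> Q" "r \<noteq> s" "(r, s) \<notin> E"
    and ab: "a \<in> Q" "b \<in> Q" "a \<noteq> b" "nbrs Q r = {a}" "nbrs Q s = Q - {b}"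
  shows "pos_ge (Q \<union> {r, s}) 3"
proof -
  have "card (Q - {a, b}) = 1" using Q(1,3) ab(1-3) by (simp add: card_Diff_subset)
  then obtain c where c: "Q - {a, b} = {c}" by (auto simp: card_1_singleton_iff)
  then have Qe: "Q = {a, b, c}" and cQ: "c \<in> Q" and ne: "c \<noteq> a" "c \<noteq> b" using ab by auto
  let ?M = "[[False, True, True, True, True],
    [True, False, True, False, False],
    [True, True, False, False, True],
    [True, False, False, False, False],
    [True, False, True, False, False]]"
  have "pos_ge (set [a, b, c, r, s]) 3"
  proof (rule pos_ge_certificate)
    show "map (\<lambda>u. map (\<lambda>v. (u, v) \<in> E) [a, b, c, r, s]) [a, b, c, r, s] = ?M"
      using ab ne cQ r by (simp add: adj_clique_plus_two[OF Q(2) r(1,2,4)])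
    show "3 \<le> (\<Sum>x\<leftarrow>[[4, 3, 4, 1, 3], [1, -1, -1, 3, 0]]. qlist ?M x / iplist x x)"
      by (simp add: qlist_def iplist_def)
  qed (use ab ne cQ r in \<open>auto simp: iplist_def\<close>)
  then show ?thesis by (simp add: Qe insert_commute)
qed

lemma pos_ge_K4_double_single:
  assumes Q: "finite Q" "clique Q" "card Q = 4" and r: "r \<notin> Q" "s \<notin> Q" "r \<noteq> s" "(r, s) \<notin> E"
    and c: "card (nbrs Q r) = 2" "card (nbrs Q s) = 1"
  shows "pos_ge (Q \<union> {r, s}) 4"
proof -
  obtain x where x: "nbrs Q s = {x}" using c(2) by (auto simp: card_1_singleton_iff)
  have c2: "card (Q - nbrs Q r) = 2" using Q c(1) nbrs_subset by (simp add: card_Diff_subset)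
  obtain u v where uv: "nbrs Q r = {u, v}" "u \<noteq> v" using c(1) by (auto simp: card_2_iff)
  obtain u' v' where uv': "Q - nbrs Q r = {u', v'}" "u' \<noteq> v'" using c2 by (auto simp: card_2_iff)
  have Qe: "Q = {u, v, u', v'}" using uv uv' nbrs_subset[of Q r] by auto
  have xQ: "x \<in> Q" using x nbrs_subset[of Q s] by blast
  have ne: "u' \<noteq> u" "u' \<noteq> v" "v' \<noteq> u" "v' \<noteq> v" using uv uv' by auto
  have cases: ?thesis
    if abcd: "Q = {a, b, c, d}" "distinct [a, b, c, d]" "nbrs Q r = {a, b}" "nbrs Q s = {a} \<or> nbrs Q s = {c}" for a b c d
    using abcd(4)
  proof
    have mem: "a \<in> Q" "b \<in> Q" "c \<in> Q" "d \<in> Q" using abcd(1) by auto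
    have ne': "a \<noteq> b" "a \<noteq> c" "a \<noteq> d" "b \<noteq> c" "b \<noteq> d" "c \<noteq> d"
      "a \<noteq> r" "b \<noteq> r" "c \<noteq> r" "d \<noteq> r" "a \<noteq> s" "b \<noteq> s" "c \<noteq> s" "d \<noteq> s"
      using abcd(2) mem r by auto
    assume s: "nbrs Q s = {a}"
    let ?M = "[[False, True, True, True, True, True],
      [True, False, True, True, True, False],
      [True, True, False, True, False, False],
      [True, True, True, False, False, False],
      [True, True, False, False, False, False],
      [True, False, False, False, False, False]]"
    have "pos_ge (set [a, b, c, d, r, s]) 4"
    proof (rule pos_ge_certificate_neg)
      show "map (\<lambda>u. map (\<lambda>v. (u, v) \<in> E) [a, b, c, d, r, s]) [a, b, c, d, r, s] = ?M"
        using mem ne' ne'[symmetric] abcd(3) s r by (simp add: adj_clique_plus_two[OF Q(2) r(1,2,4)])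
      \<comment> \<open>Three negative directions with quotients -1, -6/5 and -11/6.\<close>
      show "4 \<le> - (\<Sum>x\<leftarrow>[[0, 0, 1, -1, 0, 0], [2, -3, 0, 0, 1, -1], [-2, -1, 1, 1, 2, 1]]. qlist ?M x / iplist x x)"
        by (simp add: qlist_def iplist_def)
    qed (use mem abcd(2,3) s r in \<open>auto simp: iplist_def\<close>)
    then show ?thesis by (simp add: abcd(1) insert_commute)
  next
    have mem: "a \<in> Q" "b \<in> Q" "c \<in> Q" "d \<in> Q" using abcd(1) by auto
    have ne': "a \<noteq> b" "a \<noteq> c" "a \<noteq> d" "b \<noteq> c" "b \<noteq> d" "c \<noteq> d"
      "a \<noteq> r" "b \<noteq> r" "c \<noteq> r" "d \<noteq> r" "a \<noteq> s" "b \<noteq> s" "c \<noteq> s" "d \<noteq> s"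
      using abcd(2) mem r by auto
    assume s: "nbrs Q s = {c}"
    let ?M = "[[False, True, True, True, True, False],
      [True, False, True, True, True, False],
      [True, True, False, True, False, True],
      [True, True, True, False, False, False],
      [True, True, False, False, False, False],
      [False, False, True, False, False, False]]"
    have "pos_ge (set [a, b, c, d, r, s]) 4"
    proof (rule pos_ge_certificate)
      show "map (\<lambda>u. map (\<lambda>v. (u, v) \<in> E) [a, b, c, d, r, s]) [a, b, c, d, r, s] = ?M"
        using mem ne' ne'[symmetric] abcd(3) s r by (simp add: adj_clique_plus_two[OF Q(2) r(1,2,4)])
      \<comment> \<open>Quotients 10/3 and 5/7.\<close>
      show "4 \<le> (\<Sum>x\<leftarrow>[[2, 2, 2, 2, 1, 1], [1, 1, -2, 0, 2, -2]]. qlist ?M x / iplist x x)"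
        by (simp add: qlist_def iplist_def)
    qed (use mem abcd(2,3) s r in \<open>auto simp: iplist_def\<close>)
    then show ?thesis by (simp add: abcd(1) insert_commute)
  qed
  from xQ consider "x = u" | "x = v" | "x = u'" | "x = v'" unfolding Qe by auto
  then show ?thesis
  proof cases
    case 1
    then show ?thesis using cases[of u v u' v'] Qe uv uv' ne x by simp
  next
    case 2
    then show ?thesis using cases[of v u u' v'] Qe uv uv' ne x by (simp add: insert_commute)
  next
    case 3
    then show ?thesis using cases[of u v u' v'] Qe uv uv' ne x by simp
  next
    case 4
    then show ?thesis using cases[of u v v' u'] Qe uv uv' ne x by (simp add: insert_commute)
  qed
qed

lemma pos_ge_K4_double_triple:
  assumes Q: "finite Q" "clique Q" "card Q = 4" and r: "r \<notin> Q" "s \<notin> Q" "r \<noteq> s" "(r, s) \<notin> E"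
    and T: "card (nbrs Q r) = 2" "nbrs Q s = Q - {d}" "d \<in> Q" "d \<notin> nbrs Q r"
  shows "pos_ge (Q \<union> {r, s}) 4"
proof -
  obtain a b where ab: "nbrs Q r = {a, b}" "a \<noteq> b" using T(1) by (auto simp: card_2_iff)
  have sub: "a \<in> Q" "b \<in> Q" using ab nbrs_subset[of Q r] by auto
  have dd: "d \<noteq> a" "d \<noteq> b" using T(4) ab by auto
  have "card (Q - {a, b, d}) = 1" using Q sub T(3) ab(2) dd by (subst card_Diff_subset) auto
  then obtain c where c: "Q - {a, b, d} = {c}" by (auto simp: card_1_singleton_iff)
  then have Qe: "Q = {a, b, c, d}" and cQ: "c \<in> Q" and cc: "c \<noteq> a" "c \<noteq> b" "c \<noteq> d" using sub T(3) by auto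
  let ?M = "[[False, True, True, True, True, True],
    [True, False, True, True, True, True],
    [True, True, False, True, False, True],
    [True, True, True, False, False, False],
    [True, True, False, False, False, False],
    [True, True, True, False, False, False]]"
  have "pos_ge (set [a, b, c, d, r, s]) 4"
  proof (rule pos_ge_certificate)
    show "map (\<lambda>u. map (\<lambda>v. (u, v) \<in> E) [a, b, c, d, r, s]) [a, b, c, d, r, s] = ?M"
      using ab sub T(2,3) dd cQ cc r by (simp add: adj_clique_plus_two[OF Q(2) r(1,2,4)])
    show "4 \<le> (\<Sum>x\<leftarrow>[[2, 2, 2, 2, 1, 2], [0, 1, -1, 0, 2, -1]]. qlist ?M x / iplist x x)"
      by (simp add: qlist_def iplist_def)
  qed (use ab sub T(2,3) dd cQ cc r in \<open>auto simp: iplist_def\<close>)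
  then show ?thesis by (simp add: Qe insert_commute)
qed

section \<open>Combining the two-vertex configurations into the classification\<close>

lemma eq_Diff_singleton_of_card:
  assumes "finite Q" "A \<subseteq> Q" "card A = card Q - 1" "Q \<noteq> {}"
  shows "\<exists>q\<in>Q. A = Q - {q}"
proof -
  have "0 < card Q" using assms by (simp add: card_gt_0_iff)
  then have "card (Q - A) = 1" using assms by (simp add: card_Diff_subset finite_subset)
  then obtain q where "Q - A = {q}" by (auto simp: card_1_singleton_iff)
  then show ?thesis using assms(2) by blast
qed

text \<open>The product is concave in \<open>t\<close>, so on an interval it is least at the
  ends.\<close>

lemma prod_ge_of_between:
  fixes t k :: nat
  assumes "1 \<le> t" "t < k"
  shows "k - 1 \<le> t * (k - t)" and "2 \<le> t \<Longrightarrow> t \<le> k - 2 \<Longrightarrow> 2 * (k - 2) \<le> t * (k - t)"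
proof -
  define a b where "a = t - 1" and "b = k - t - 1"
  then have "t = a + 1" "k = a + b + 2" using assms by auto
  then show "k - 1 \<le> t * (k - t)" by simp
next
  assume t: "2 \<le> t" "t \<le> k - 2"
  define a b where "a = t - 2" and "b = k - t - 2"
  then have "t = a + 2" "k = a + b + 4" using t by auto
  then show "2 * (k - 2) \<le> t * (k - t)" by (simp add: algebra_simps)
qed

text \<open>By \<open>pos_ge_clique_plus_many\<close> the products t (k - t) and u (k - u) add to
  less than 2 k, which forces both degrees to be 1 or k - 1, except for degree 2 at k = 4. The
  special configurations above eliminate everything but two pendants. Distinct attachment points
  survive only for k = 3: for k = 2 the two neighbourhoods cover \<open>Q\<close>.\<close>

lemma two_attached_classification:
  assumes Q: "finite Q" "clique Q" and k: "2 \<le> card Q" and r: "r \<notin> Q" "s \<notin> Q" "r \<noteq> s" "(r, s) \<notin> E"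
    and ne: "nbrs Q r \<noteq> {}" "nbrs Q s \<noteq> {}" "nbrs Q r \<noteq> Q" "nbrs Q s \<noteq> Q"
    and low: "\<not> pos_ge (Q \<union> {r, s}) (real (card Q))"
  shows "\<exists>a\<in>Q. \<exists>b\<in>Q. nbrs Q r = {a} \<and> nbrs Q s = {b} \<and> (a = b \<or> card Q = 3)"
proof -
  define k where "k = card Q"
  define t where "t = card (nbrs Q r)"
  define u where "u = card (nbrs Q s)"
  have sub: "nbrs Q r \<subset> Q" "nbrs Q s \<subset> Q" using ne nbrs_subset by blast+
  have fin: "finite (nbrs Q r)" "finite (nbrs Q s)" using Q(1) by simp_all
  have tk: "1 \<le> t" "t < k" "1 \<le> u" "u < k"
    using sub Q(1) ne fin by (auto simp: t_def u_def k_def psubset_card_mono card_gt_0_iff Suc_le_eq)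
  have cover: "nbrs Q r \<union> nbrs Q s \<noteq> Q" using pos_ge_two_cover[OF Q r(1-3)] low by blast
  have small: "t * (k - t) + u * (k - u) < 2 * k"
  proof (rule ccontr)
    assume "\<not> ?thesis"
    then have "2 * card Q \<le> (\<Sum>r\<in>{r, s}. card (nbrs Q r) * (card Q - card (nbrs Q r)))"
      using r(3) by (simp add: t_def u_def k_def)
    then have "pos_ge (Q \<union> {r, s}) (real (card Q))"
      using Q r sub by (intro pos_ge_clique_plus_many indep_doubleton) auto
    then show False using low by simp
  qed
  have sr: "(s, r) \<notin> E" using r(4) adj_commute by blast
  have QQ: "Q \<union> {s, r} = Q \<union> {r, s}" by auto
  have Q0: "Q \<noteq> {}" using sub by auto
  have near: False if cxy: "card (nbrs Q x) = k - 1" "card (nbrs Q y) = 1" "k \<ge> 3" "{x, y} = {r, s}" for x y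
  proof -
    have xy: "x \<notin> Q" "y \<notin> Q" "x \<noteq> y" "(y, x) \<notin> E" "Q \<union> {y, x} = Q \<union> {r, s}" "nbrs Q x \<union> nbrs Q y \<noteq> Q"
      using cxy(4) r sr cover by (auto simp: doubleton_eq_iff)
    obtain b where b: "b \<in> Q" "nbrs Q x = Q - {b}"
      using eq_Diff_singleton_of_card[OF Q(1) nbrs_subset[of Q x] _ Q0] cxy(1) k_def by metis
    obtain a where a: "nbrs Q y = {a}" using cxy(2) by (auto simp: card_1_singleton_iff)
    have aQ: "a \<in> Q" using a nbrs_subset[of Q y] by blast
    have "a \<noteq> b" using xy(6) a b by auto
    then show False
      using pos_ge_pendant_and_near_twin[OF Q _ xy(2,1) xy(3)[symmetric] xy(4) aQ b(1) _ a b(2)]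
        pos_ge_dart[OF Q _ xy(2,1) xy(3)[symmetric] xy(4) aQ b(1) _ a b(2)] low cxy(3) xy(5) k_def
      by (cases "k = 3") auto
  qed
  have twins: False if tu: "t = k - 1" "u = k - 1" "k \<ge> 3"
  proof -
    obtain a where a: "a \<in> Q" "nbrs Q r = Q - {a}"
      using eq_Diff_singleton_of_card[OF Q(1) nbrs_subset[of Q r] _ Q0] tu(1) t_def k_def by metis
    obtain b where b: "b \<in> Q" "nbrs Q s = Q - {b}"
      using eq_Diff_singleton_of_card[OF Q(1) nbrs_subset[of Q s] _ Q0] tu(2) u_def k_def by metis
    have "a = b" using cover a b by auto
    then show False using pos_ge_two_twins[OF Q _ r a] b low tu(3) k_def by auto
  qed
  have mid: False if xy: "card (nbrs Q x) = 2" "k = 4" "{x, y} = {r, s}" for x y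
  proof -
    have xy': "x \<notin> Q" "y \<notin> Q" "x \<noteq> y" "(x, y) \<notin> E" "Q \<union> {x, y} = Q \<union> {r, s}" "nbrs Q x \<union> nbrs Q y \<noteq> Q"
      using xy(3) r sr cover by (auto simp: doubleton_eq_iff)
    have c4: "card Q = 4" using xy(2) k_def by simp
    define w where "w = card (nbrs Q y)"
    have w: "1 \<le> w" "w < 4" "w * (4 - w) < 4"
      using xy tk small t_def u_def w_def by (auto simp: doubleton_eq_iff)
    then have "w = 1 \<or> w = 3" by (cases "w = 2") auto
    then show False
    proof
      assume "w = 1"
      then have "pos_ge (Q \<union> {x, y}) 4"
        by (intro pos_ge_K4_double_single[OF Q c4 xy'(1-4) xy(1)]) (simp add: w_def)
      then show False using low xy'(5) c4 by simp
    next
      assume "w = 3"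
      then have "card (nbrs Q y) = card Q - 1" using xy(2) w_def k_def by simp
      then obtain d where d: "d \<in> Q" "nbrs Q y = Q - {d}"
        using eq_Diff_singleton_of_card[OF Q(1) nbrs_subset[of Q y] _ Q0] by blast
      have "d \<notin> nbrs Q x"
      proof
        assume "d \<in> nbrs Q x"
        then have "nbrs Q x \<union> nbrs Q y = Q" using nbrs_subset[of Q x] unfolding d(2) by blast
        then show False using xy'(6) by contradiction
      qed
      then have "pos_ge (Q \<union> {x, y}) 4"
        by (rule pos_ge_K4_double_triple[OF Q c4 xy'(1-4) xy(1) d(2,1)])
      then show False using low xy'(5) c4 by simp
    qed
  qed
  have ends: "t = 1 \<or> t = k - 1" "u = 1 \<or> u = k - 1"
  proof -
    have *: "x = 1 \<or> x = k - 1" if x: "1 \<le> x" "x < k" "1 \<le> y" "y < k" "x * (k - x) + y * (k - y) < 2 * k"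
      and m: "x = 2 \<Longrightarrow> k \<noteq> 4" for x y
    proof (rule ccontr)
      assume "\<not> ?thesis"
      then have x2: "2 \<le> x" "x \<le> k - 2" using x by auto
      have "2 * (k - 2) + (k - 1) < 2 * k"
        using prod_ge_of_between(2)[OF x(1,2) x2] prod_ge_of_between(1)[OF x(3,4)] x(5) by linarith
      then have "k < 5" using x2 by linarith
      then have "k = 4" "x = 2" using x2 by auto
      then show False using m by simp
    qed
    show "t = 1 \<or> t = k - 1" using *[of t u] tk small mid[of r s] t_def by auto
    show "u = 1 \<or> u = k - 1" using *[of u t] tk small mid[of s r] u_def by (auto simp: insert_commute add.commute)
  qed
  have "t = 1 \<and> u = 1"
  proof (cases "k = 2")
    case True
    then show ?thesis using tk by auto
  next
    case False
    then have "3 \<le> k" using k k_def by simp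
    then show ?thesis
      using ends near[of r s] near[of s r] twins t_def u_def by (auto simp: insert_commute)
  qed
  then obtain a b where ab: "nbrs Q r = {a}" "nbrs Q s = {b}"
    by (auto simp: t_def u_def card_1_singleton_iff)
  have abQ: "a \<in> Q" "b \<in> Q" using ab nbrs_subset[of Q r] nbrs_subset[of Q s] by auto
  have "a = b \<or> card Q = 3"
  proof (rule ccontr)
    assume "\<not> ?thesis"
    then have "a \<noteq> b" "card Q \<noteq> 3" by auto
    have "card Q \<noteq> 2"
    proof
      assume "card Q = 2"
      then have "{a, b} = Q" using \<open>a \<noteq> b\<close> abQ Q(1) by (intro card_subset_eq) auto
      then show False using cover ab by auto
    qed
    then show False
      using pos_ge_two_pendants[OF Q _ r abQ \<open>a \<noteq> b\<close> ab] low k \<open>card Q \<noteq> 3\<close> by auto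
  qed
  then show ?thesis using ab abQ by blast
qed

text \<open>\<open>R\<close> collects the vertices outside \<open>Q\<close> that have a neighbour in
  \<open>Q\<close>; since the outside is edgeless, all remaining vertices are isolated. A single
  such vertex is governed by \<open>pos_ge_clique_plus_one\<close>, two by
  \<open>two_attached_classification\<close>, and three are impossible.\<close>

theorem low_pos_classification:
  assumes fin: "finite V" and low: "\<not> pos_ge V (real (chi V))"
  obtains (twins) Q T R where "Q \<subseteq> V" "clique Q" "Q \<noteq> {}" "T \<subseteq> Q" "R \<subseteq> V - Q" "indep R"
      "\<And>r. r \<in> R \<Longrightarrow> nbrs Q r = T"
      "\<And>u v. u \<in> V \<Longrightarrow> v \<in> V \<Longrightarrow> (u, v) \<in> E \<Longrightarrow> u \<in> Q \<union> R \<and> v \<in> Q \<union> R"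
      "R = {} \<and> T = {}
       \<or> card R = 1 \<and> 1 \<le> card T \<and> card T < card Q \<and> card T * (card Q - card T + 1) < 2 * (card Q + 1)
       \<or> card R = 2 \<and> card T = 1"
    | (bull) a b c r s where "{a, b, c, r, s} \<subseteq> V" "distinct [a, b, c, r, s]"
      "\<And>u v. u \<in> V \<Longrightarrow> v \<in> V \<Longrightarrow> (u, v) \<in> E \<longleftrightarrow>
        (u, v) \<in> {(a, b), (b, a), (a, c), (c, a), (b, c), (c, b), (a, r), (r, a), (b, s), (s, b)}"
proof -
  obtain Q where Q: "Q \<subseteq> V" "clique Q" "card Q = chi V"
    using clique_of_low_pos[OF fin low] by blast
  have fQ: "finite Q" using Q(1) fin finite_subset by blast
  have lowQ: "\<not> pos_ge (Q \<union> A) (real (card Q))" if "A \<subseteq> V" for A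
    using low pos_ge_mono[OF fin, of "Q \<union> A" "real (card Q)"] Q(1,3) that by auto
  have "Q \<noteq> {}" using lowQ[of "{}"] pos_ge_0 by auto
  have ind: "indep (V - Q)"
    unfolding indep_def
  proof (intro ballI notI)
    fix u v assume uv: "u \<in> V - Q" "v \<in> V - Q" "(u, v) \<in> E"
    have "pos_ge V (real (chi V))"
      by (rule pos_ge_add[OF fin Q(1) _ _ pos_ge_clique'[OF fQ Q(2)] pos_ge_edge[OF uv(3)]])
        (use uv Q(3) in auto)
    then show False using low by simp
  qed
  have full: "nbrs Q r \<noteq> Q" if r: "r \<in> V - Q" for r
  proof
    assume "nbrs Q r = Q"
    then have "clique (insert r Q)" using Q(2) by (auto simp: clique_insert nbrs_def)
    then have "card (insert r Q) \<le> chi V" using clique_le_chi[OF fin, of "insert r Q"] r Q(1) by auto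
    then show False using r Q(3) fQ by simp
  qed
  have pair: "\<exists>a\<in>Q. \<exists>b\<in>Q. nbrs Q r = {a} \<and> nbrs Q s = {b} \<and> (a = b \<or> card Q = 3)"
    if r: "r \<in> V - Q" "s \<in> V - Q" "r \<noteq> s" "nbrs Q r \<noteq> {}" "nbrs Q s \<noteq> {}" for r s
  proof (rule two_attached_classification[OF fQ Q(2)])
    have "0 < card (nbrs Q r)" using r(4) fQ by (simp add: card_gt_0_iff)
    moreover have "card (nbrs Q r) < card Q"
      using full[OF r(1)] fQ nbrs_subset[of Q r] by (simp add: psubset_card_mono psubsetI)
    ultimately show "2 \<le> card Q" by linarith
    show "(r, s) \<notin> E" using ind r by (auto simp: indep_def)
    show "\<not> pos_ge (Q \<union> {r, s}) (real (card Q))" by (rule lowQ) (use r in auto)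
  qed (use r full in auto)
  have triple: False
    if r: "r \<in> V - Q" "s \<in> V - Q" "x \<in> V - Q" "distinct [r, s, x]"
      "nbrs Q r \<noteq> {}" "nbrs Q s \<noteq> {}" "nbrs Q x \<noteq> {}" for r s x
  proof -
    have rs: "r \<noteq> s" "r \<noteq> x" "s \<noteq> x" using r(4) by auto
    have indr: "indep {r, s, x}" using ind r by (auto simp: indep_def)
    obtain a b where ab: "a \<in> Q" "b \<in> Q" "nbrs Q r = {a}" "nbrs Q s = {b}" "a = b \<or> card Q = 3"
      using pair[OF r(1,2) rs(1) r(5,6)] by blast
    obtain c where c: "c \<in> Q" "nbrs Q x = {c}" using pair[OF r(1,3) rs(2) r(5,7)] by blast
    show False
    proof (cases "card Q \<ge> 3")
      case True
      \<comment> \<open>All three vertices are pendant by \<open>pair\<close>, so the sum equals 3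
        (k - 1), which is at least 2 k for k \<ge> 3.\<close>
      have "2 * card Q \<le> (\<Sum>r\<in>{r, s, x}. card (nbrs Q r) * (card Q - card (nbrs Q r)))"
        using rs ab c True by simp
      then have "pos_ge (Q \<union> {r, s, x}) (real (card Q))"
        using fQ Q(2) \<open>Q \<noteq> {}\<close> indr r by (intro pos_ge_clique_plus_many) auto
      then show False using lowQ[of "{r, s, x}"] r by auto
    next
      case False
      then have "a = b" using ab by auto
      have "a = c" using pair[OF r(1,3) rs(2) r(5,7)] ab c False by auto
      have "card Q \<noteq> 1"
      proof
        assume "card Q = 1"
        then have "Q = {a}" using ab(1) by (auto simp: card_1_singleton_iff)
        then show False using full[OF r(1)] ab by simp
      qed
      moreover have "card Q \<noteq> 0" using fQ \<open>Q \<noteq> {}\<close> by simp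
      ultimately have c2: "card Q = 2" using False by linarith
      then have "card (Q - {a}) = 1" using fQ ab(1) by simp
      then obtain d where d: "Q - {a} = {d}" by (auto simp: card_1_singleton_iff)
      then have Qe: "Q = {a, d}" "a \<noteq> d" using ab(1) by auto
      have nE: "(y, v) \<in> E \<longleftrightarrow> v = a" if "y \<in> {r, s, x}" "v \<in> Q" for y v
        using that ab c \<open>a = b\<close> \<open>a = c\<close> unfolding nbrs_def by auto
      have e: "(r, a) \<in> E" "(s, a) \<in> E" "(x, a) \<in> E" "(d, a) \<in> E" "(r, d) \<notin> E" "(s, d) \<notin> E" "(x, d) \<notin> E"
        "(r, s) \<notin> E" "(r, x) \<notin> E" "(s, x) \<notin> E"
        using nE Qe Q(2) indr by (auto simp: clique_def indep_def)
      then have e': "(a, r) \<in> E" "(a, s) \<in> E" "(a, x) \<in> E" "(a, d) \<in> E" "(d, r) \<notin> E" "(d, s) \<notin> E" "(d, x) \<notin> E"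
        "(s, r) \<notin> E" "(x, r) \<notin> E" "(x, s) \<notin> E"
        using adj_commute by blast+
      let ?M = "[[False, True, True, True, True],
        [True, False, False, False, False],
        [True, False, False, False, False],
        [True, False, False, False, False],
        [True, False, False, False, False]]"
      \<comment> \<open>For k = 2 all pendants share their neighbour \<open>a\<close>, and
        \<open>a\<close> is the centre of a star with four leaves, whose largest eigenvalue is
        exactly 2.\<close>
      have "pos_ge (set [a, d, r, s, x]) 2"
      proof (rule pos_ge_certificate)
        show "map (\<lambda>u. map (\<lambda>v. (u, v) \<in> E) [a, d, r, s, x]) [a, d, r, s, x] = ?M"
          using e e' by simp
        show "2 \<le> (\<Sum>x\<leftarrow>[[2, 1, 1, 1, 1]]. qlist ?M x / iplist x x)"
          by (simp add: qlist_def iplist_def)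
      qed (use Qe rs r in \<open>auto simp: iplist_def\<close>)
      then show False using lowQ[of "{r, s, x}"] r c2 Qe by (simp add: insert_commute)
    qed
  qed
  have one: "card (nbrs Q r) * (card Q - card (nbrs Q r) + 1) < 2 * (card Q + 1)"
    and lt: "1 \<le> card (nbrs Q r)" "card (nbrs Q r) < card Q"
    if r: "r \<in> V - Q" "nbrs Q r \<noteq> {}" for r
  proof -
    show a: "1 \<le> card (nbrs Q r)" using r(2) fQ by (simp add: card_gt_0_iff Suc_le_eq)
    show b: "card (nbrs Q r) < card Q"
      using full[OF r(1)] fQ nbrs_subset[of Q r] by (simp add: psubset_card_mono psubsetI)
    show "card (nbrs Q r) * (card Q - card (nbrs Q r) + 1) < 2 * (card Q + 1)"
    proof (rule ccontr)
      assume "\<not> ?thesis"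
      then have "pos_ge (Q \<union> {r}) (real (card Q))"
        using r a b by (intro pos_ge_clique_plus_one[OF fQ Q(2) _ refl]) auto
      then show False using lowQ[of "{r}"] r by auto
    qed
  qed
  have closed: "u \<in> Q \<union> R \<and> v \<in> Q \<union> R"
    if R: "\<forall>x\<in>V - Q - R. nbrs Q x = {}" and uv: "u \<in> V" "v \<in> V" "(u, v) \<in> E" for R u v
  proof -
    have "x \<in> Q \<union> R" if xy: "x \<in> V" "y \<in> V" "(x, y) \<in> E" for x y
    proof (rule ccontr)
      assume x: "x \<notin> Q \<union> R"
      then have "y \<in> Q" using xy ind by (auto simp: indep_def)
      then have "y \<in> nbrs Q x" using xy by (simp add: nbrs_def)
      then show False using R x xy(1) by auto
    qed
    then show ?thesis using uv adj_sym by blast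
  qed
  show thesis
  proof (cases "\<forall>r\<in>V - Q. nbrs Q r = {}")
    case True
    then show thesis
      by (intro twins[OF Q(1,2) \<open>Q \<noteq> {}\<close>, of "{}" "{}"] closed) (auto simp: indep_def)
  next
    case False
    then obtain r where r: "r \<in> V - Q" "nbrs Q r \<noteq> {}" by blast
    show thesis
    proof (cases "\<forall>s\<in>V - Q - {r}. nbrs Q s = {}")
      case True
      then show thesis
        using r one[OF r] lt[OF r]
        by (intro twins[OF Q(1,2) \<open>Q \<noteq> {}\<close> nbrs_subset, of "{r}" r] closed) (auto simp: indep_def)
    next
      case False
      then obtain s where s: "s \<in> V - Q" "s \<noteq> r" "nbrs Q s \<noteq> {}" by blast
      have rs: "r \<noteq> s" using s(2) by simp
      have ind': "(r, s) \<notin> E" "(s, r) \<notin> E" using ind r s by (auto simp: indep_def)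
      have cl: "u \<in> Q \<union> {r, s} \<and> v \<in> Q \<union> {r, s}" if "u \<in> V" "v \<in> V" "(u, v) \<in> E" for u v
        by (rule closed[OF _ that]) (use triple[of r s] r s in auto)
      obtain a b where ab: "a \<in> Q" "b \<in> Q" "nbrs Q r = {a}" "nbrs Q s = {b}" "a = b \<or> card Q = 3"
        using pair[OF r(1) s(1) rs r(2) s(3)] by blast
      show thesis
      proof (cases "a = b")
        case True
        show thesis
          by (rule twins[OF Q(1,2) \<open>Q \<noteq> {}\<close> _ _ _ _ cl, of "{a}"])
            (use ab True r s rs indep_doubleton[OF rs ind'(1)] in auto)
      next
        case False
        then have "card (Q - {a, b}) = 1" using ab fQ by (simp add: card_Diff_subset)
        then obtain c where c: "Q - {a, b} = {c}" by (auto simp: card_1_singleton_iff)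
        then have Qe: "Q = {a, b, c}" "c \<in> Q" "c \<noteq> a" "c \<noteq> b" using ab by auto
        show thesis
        proof (rule bull[of a b c r s])
          show "{a, b, c, r, s} \<subseteq> V" "distinct [a, b, c, r, s]" using Qe Q(1) r s rs False by auto
          fix u v assume V: "u \<in> V" "v \<in> V"
          let ?E = "{(a, b), (b, a), (a, c), (c, a), (b, c), (c, b), (a, r), (r, a), (b, s), (s, b)}"
          have rQ: "r \<notin> Q" "s \<notin> Q" using r s by auto
          have ne: "b \<noteq> a" "c \<noteq> a" "c \<noteq> b" "r \<noteq> a" "r \<noteq> b" "r \<noteq> c" "s \<noteq> a" "s \<noteq> b" "s \<noteq> c" "r \<noteq> s"
            using Qe ab False rQ rs by auto
          have adj: "(x, y) \<in> E \<longleftrightarrow> (x, y) \<in> ?E"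
            if "x \<in> {a, b, c, r, s}" "y \<in> {a, b, c, r, s}" for x y
          proof -
            have "x \<in> Q \<or> x = r \<or> x = s" "y \<in> Q \<or> y = r \<or> y = s" using that unfolding Qe(1) by auto
            note adj_clique_plus_two[OF Q(2) rQ ind'(1) this]
            also have "(if x \<in> Q then if y \<in> Q then x \<noteq> y else x \<in> nbrs Q y else y \<in> nbrs Q x) \<longleftrightarrow> (x, y) \<in> ?E"
              using that unfolding Qe(1)
              by (elim insertE emptyE; simp add: ab(3,4)[unfolded Qe(1)] ne ne[symmetric])
            finally show ?thesis .
          qed
          have "u \<in> {a, b, c, r, s} \<and> v \<in> {a, b, c, r, s}" if "(u, v) \<in> E"
            using cl[OF V that] unfolding Qe(1) by blast
          moreover have "u \<in> {a, b, c, r, s} \<and> v \<in> {a, b, c, r, s}" if "(u, v) \<in> ?E" using that by blast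
          ultimately show "(u, v) \<in> E \<longleftrightarrow> (u, v) \<in> ?E" using adj[of u v] by argo
        qed
      qed
    qed
  qed
qed

end

section \<open>The energy of the listed graphs\<close>

text \<open>The coefficient identities behind the square completed in
  \<open>energy_clique_plus_le\<close>.\<close>

lemma fraction_identities:
  fixes b :: real
  assumes "0 < b"
  shows "(b - 1) / b * (b / (b + 1))\<^sup>2 = b * (b - 1) / (b + 1)\<^sup>2"
    and "(b - 1) / b * (b / (b + 1)) = (b - 1) / (b + 1)"
    and "2 - 4 / (b + 1) = 2 * ((b - 1) / (b + 1))"
    and "1 - 1 / b = (b - 1) / b"
proof -
  have "(b - 1) / b * (b * b / x) = b * (b - 1) / x" for x using assms by simp
  then show "(b - 1) / b * (b / (b + 1))\<^sup>2 = b * (b - 1) / (b + 1)\<^sup>2"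
    unfolding power_divide power2_eq_square[of b] .
  show "(b - 1) / b * (b / (b + 1)) = (b - 1) / (b + 1)" using assms by simp
  show "2 - 4 / (b + 1) = 2 * ((b - 1) / (b + 1))" using assms by (simp add: field_simps)
  show "1 - 1 / b = (b - 1) / b" using assms by (simp add: field_simps)
qed

section \<open>Transfer to finite graphs, and dual certificates for upper bounds\<close>

locale finite_graph =
  fixes G :: "'a pair_pre_digraph"
  assumes G: "pair_graph G"

sublocale finite_graph \<subseteq> pg: pair_graph G
  by (rule G)

sublocale finite_graph \<subseteq> simple_graph "parcs G"
proof
  show "(v, u) \<in> parcs G" if "(u, v) \<in> parcs G" for u v
    using that pg.arcs_symmetric by blast
  show "(v, v) \<notin> parcs G" for v
    using pg.pair_no_loops by force
qed

context finite_graph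
begin

abbreviation V where "V \<equiv> pverts G"

lemma finV: "finite V"
  by (rule pg.pair_finite_verts)

lemma arcs_in_verts: "(u, v) \<in> parcs G \<Longrightarrow> u \<in> V \<and> v \<in> V"
  using pg.in_arcsD1 pg.in_arcsD2 by blast

lemma chromatic_number_eq_chi: "chromatic_number G = chi V"
proof -
  have "(\<exists>c. proper_coloring G k c) \<longleftrightarrow> colorable V k" for k
    using arcs_in_verts unfolding proper_coloring_def colorable_def by (auto simp: Ball_def)
  then show ?thesis by (simp add: chromatic_number_def chi_def)
qed

lemma pos_ge_le_energy: "pos_ge V r \<Longrightarrow> r \<le> energy G / 2"
  using feasible_le_energy[OF G] by (fastforce simp: pos_ge_def adj_val_def)

text \<open>The quadratic form of the projection onto the vectors of sum zero on \<open>T\<close>,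
  of trace \<open>card T - 1\<close>. Division by zero makes it 0 on the empty set, in accordance
  with the truncated subtraction in \<open>energy_le_certificate\<close>.\<close>

definition spread :: "'a set \<Rightarrow> ('a \<Rightarrow> real) \<Rightarrow> real" where
  "spread T z = (\<Sum>v\<in>T. (z v)\<^sup>2) - (sum z T)\<^sup>2 / real (card T)"

lemma spread_nonneg: "finite T \<Longrightarrow> 0 \<le> spread T z"
proof -
  assume T: "finite T"
  show ?thesis
  proof (cases "T = {}")
    case False
    then have "0 < card T" using T by (simp add: card_gt_0_iff)
    moreover have "(sum z T)\<^sup>2 \<le> real (card T) * (\<Sum>v\<in>T. (z v)\<^sup>2)"
      using cauchy_schwarz[of T "\<lambda>_. 1" z] by (simp add: ip_def power2_eq_square)
    ultimately show ?thesis by (simp add: spread_def field_simps)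
  qed (simp add: spread_def)
qed

text \<open>The dual matrix is a sum of two such projections, which cancel the eigenvalues -1 of two
  cliques, and of rank-one terms with nonnegative weights. It is positive semidefinite by its shape,
  so \<open>cert\<close> is the only inequality left to check.\<close>

lemma energy_le_certificate:
  assumes T: "T \<subseteq> V" and U: "U \<subseteq> V" and cs: "\<And>c l. (c, l) \<in> set cs \<Longrightarrow> 0 \<le> c"
    and cert: "\<And>z. 0 \<le> qA V z + spread T z + spread U z + (\<Sum>(c, l)\<leftarrow>cs. c * (ip V l z)\<^sup>2)"
  shows "energy G / 2 \<le> real (card T - 1) + real (card U - 1) + (\<Sum>(c, l)\<leftarrow>cs. c * ip V l l)"
proof -
  define P where "P A u v = (if u \<in> A \<and> v \<in> A then (if u = v then 1 else 0) - 1 / real (card A) else 0)"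
    for A :: "'a set" and u v
  define L where "L u v = (\<Sum>(c, l)\<leftarrow>cs. c * (l u * l v))" for u v
  define Y where "Y u v = P T u v + P U u v + L u v" for u v
  have qP: "qf V (P A) z = spread A z" if "A \<subseteq> V" for A z
  proof -
    have fA: "finite A" using that finV finite_subset by blast
    have "qf V (P A) z = qf A (P A) z" by (rule qf_restrict[OF finV that]) (auto simp: P_def)
    also have "\<dots> = (\<Sum>u\<in>A. \<Sum>v\<in>A. (if u = v then z u * z v else 0) - z u * z v / real (card A))"
      unfolding qf_def by (intro sum.cong refl) (auto simp: P_def algebra_simps)
    also have "\<dots> = spread A z"
      using fA by (simp add: sum_subtractf spread_def power2_eq_square sum_product sum_divide_distrib)
    finally show ?thesis .
  qed
  have qL: "qf V L z = (\<Sum>(c, l)\<leftarrow>cs. c * (ip V l z)\<^sup>2)" for z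
    unfolding qf_def L_def
  proof (induction cs)
    case (Cons a cs)
    obtain c l where a: "a = (c, l)" by (cases a)
    have "(\<Sum>u\<in>V. \<Sum>v\<in>V. c * (l u * l v) * z u * z v) = c * (ip V l z)\<^sup>2"
      by (simp add: ip_def power2_eq_square sum_product sum_distrib_left mult_ac)
    then show ?case using Cons a by (simp add: sum.distrib distrib_right)
  qed simp
  have qY: "qf V Y z = spread T z + spread U z + (\<Sum>(c, l)\<leftarrow>cs. c * (ip V l z)\<^sup>2)" for z
    unfolding qP[OF T, symmetric] qP[OF U, symmetric] qL[symmetric]
    by (simp add: qf_def Y_def sum.distrib distrib_right)
  have fin: "finite T" "finite U" using T U finV finite_subset by blast+
  have trP: "(\<Sum>v\<in>V. P A v v) = real (card A - 1)" if "A \<subseteq> V" for A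
  proof -
    have fA: "finite A" using that finV finite_subset by blast
    have "(\<Sum>v\<in>V. P A v v) = (\<Sum>v\<in>A. 1 - 1 / real (card A))"
      using finV that by (intro sum.mono_neutral_cong_right) (auto simp: P_def)
    also have "\<dots> = real (card A - 1)"
    proof (cases "A = {}")
      case False
      then have "0 < card A" using fA by (simp add: card_gt_0_iff)
      then show ?thesis by (simp add: of_nat_diff Suc_le_eq right_diff_distrib)
    qed simp
    finally show ?thesis .
  qed
  have trL: "(\<Sum>v\<in>V. L v v) = (\<Sum>(c, l)\<leftarrow>cs. c * ip V l l)"
    unfolding L_def by (induction cs) (auto simp: sum.distrib ip_def sum_distrib_left)
  have "0 \<le> (\<Sum>(c, l)\<leftarrow>cs. c * (ip V l z)\<^sup>2)" for z
    using cs by (intro sum_list_nonneg) auto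
  then have "energy G / 2 \<le> (\<Sum>v\<in>V. Y v v)"
    using cert spread_nonneg[OF fin(1)] spread_nonneg[OF fin(2)]
    by (intro energy_le_trace[OF G]) (auto simp: qY add.assoc intro!: add_nonneg_nonneg)
  also have "\<dots> = real (card T - 1) + real (card U - 1) + (\<Sum>(c, l)\<leftarrow>cs. c * ip V l l)"
    by (simp add: Y_def sum.distrib trP T U trL)
  finally show ?thesis .
qed

lemma qA_restrict:
  assumes "W \<subseteq> V" "\<And>u v. (u, v) \<in> parcs G \<Longrightarrow> u \<in> W \<and> v \<in> W"
  shows "qA V z = qA W z"
  by (rule qf_restrict[OF finV assms(1)]) (use assms(2) in \<open>auto simp: adjf_def\<close>)

lemma qA_sum_arcs: "qA V z = (\<Sum>p\<in>parcs G. z (fst p) * z (snd p))"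
proof -
  have "qA V z = (\<Sum>p\<in>V \<times> V. if p \<in> parcs G then z (fst p) * z (snd p) else 0)"
    unfolding qf_def adjf_def sum.cartesian_product by (intro sum.cong) auto
  also have "\<dots> = (\<Sum>p\<in>parcs G. z (fst p) * z (snd p))"
    using arcs_in_verts finV by (intro sum.mono_neutral_cong_right) auto
  finally show ?thesis .
qed

text \<open>Upper bounds on the energy are compared with the order of a clique, so no colouring of
  the listed graphs has to be constructed.\<close>

lemma card_clique_le_chromatic: "Q \<subseteq> V \<Longrightarrow> clique Q \<Longrightarrow> card Q \<le> chromatic_number G"
  unfolding chromatic_number_eq_chi by (rule clique_le_chi[OF finV])

lemma ip_supported:
  assumes "W \<subseteq> V" "\<And>v. v \<notin> W \<Longrightarrow> l v = 0"
  shows "ip V l z = ip W l z"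
  unfolding ip_def using assms finV by (intro sum.mono_neutral_right) auto

text \<open>The Gram vector \<open>l\<close> is the image under the adjacency matrix of an approximate eigenvector for
  the least eigenvalue; the value of \<open>K\<close> minimises the trace of the certificate.\<close>

lemma energy_clique_plus_le:
  assumes Q: "Q \<subseteq> V" "clique Q" and T: "T \<subseteq> Q" "T \<noteq> {}" and R: "R \<subseteq> V - Q" "indep R"
    and nb: "\<And>r. r \<in> R \<Longrightarrow> nbrs Q r = T"
    and E: "\<And>u v. (u, v) \<in> parcs G \<Longrightarrow> u \<in> Q \<union> R \<and> v \<in> Q \<union> R"
  defines "a \<equiv> real (card T)" and "b \<equiv> real (card (Q - T))"
  defines "K \<equiv> 3 / a + 1 - b * (b - 1) / (b + 1)\<^sup>2"
  shows "0 < K"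
    and "energy G / 2 \<le> a - 1 + real (card (Q - T) - 1) + (4 / a + 4 * b / (b + 1)\<^sup>2 + real (card R)) / K"
proof -
  have fQ: "finite Q" and fR: "finite R" using Q(1) R(1) finV finite_subset by blast+
  have fT: "finite T" using T(1) fQ finite_subset by blast
  let ?U = "Q - T"
  have a: "1 \<le> a" using T(2) fT by (simp add: a_def Suc_le_eq card_gt_0_iff)
  have b: "0 \<le> b" by (simp add: b_def)
  define s where "s = b * (b - 1) / (b + 1)\<^sup>2"
  have Ks: "K = 3 / a + 1 - s" by (simp add: K_def s_def)
  have "b * (b - 1) < (b + 1)\<^sup>2" using b by (simp add: power2_eq_square algebra_simps)
  then have s: "s < 1" using b by (simp add: s_def divide_less_eq)
  have "0 < 3 / a" using a by simp
  then show K: "0 < K" unfolding Ks using s by linarith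
  \<comment> \<open>When \<open>R\<close> is a single vertex and \<open>Q - T\<close> is nonempty,
    this is 2 / (a (b + 1)) times the test vector of \<open>pos_ge_clique_plus_one\<close>.\<close>
  define l where "l v = (if v \<in> T then 2 / a else if v \<in> Q then - 2 / (b + 1) else if v \<in> R then -1 else 0)" for v
  have W: "Q \<union> R \<subseteq> V" and dis: "Q \<inter> R = {}" using Q R by auto
  have spl: "sum f Q = sum f T + sum f ?U" for f :: "'a \<Rightarrow> real"
    using fQ T(1) by (metis add.commute sum.subset_diff)
  have ipl: "ip V l z = 2 / a * sum z T - 2 / (b + 1) * sum z ?U - sum z R" for z
  proof -
    have "ip V l z = ip (Q \<union> R) l z" by (rule ip_supported[OF W]) (use T in \<open>auto simp: l_def\<close>)
    also have "\<dots> = (\<Sum>v\<in>T. l v * z v) + (\<Sum>v\<in>?U. l v * z v) + (\<Sum>v\<in>R. l v * z v)"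
      using fQ fR dis by (simp add: ip_def sum.union_disjoint spl)
    also have "(\<Sum>v\<in>T. l v * z v) = (\<Sum>v\<in>T. 2 / a * z v)" by (intro sum.cong) (auto simp: l_def)
    also have "(\<Sum>v\<in>?U. l v * z v) = (\<Sum>v\<in>?U. - 2 / (b + 1) * z v)" by (intro sum.cong) (auto simp: l_def)
    also have "(\<Sum>v\<in>R. l v * z v) = (\<Sum>v\<in>R. - 1 * z v)"
      using T(1) dis by (intro sum.cong) (auto simp: l_def)
    finally show ?thesis by (simp only: sum_distrib_left[symmetric])
  qed
  have ll: "ip V l l = 4 / a + 4 * b / (b + 1)\<^sup>2 + real (card R)"
  proof -
    have "sum l T = (\<Sum>v\<in>T. 2 / a)" by (intro sum.cong) (auto simp: l_def)
    moreover have "sum l ?U = (\<Sum>v\<in>?U. - 2 / (b + 1))" by (intro sum.cong) (auto simp: l_def)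
    moreover have "sum l R = (\<Sum>v\<in>R. - 1)" using T(1) dis by (intro sum.cong) (auto simp: l_def)
    ultimately have "sum l T = a * (2 / a)" "sum l ?U = b * (- 2 / (b + 1))" "sum l R = - real (card R)"
      unfolding sum_constant a_def[symmetric] b_def[symmetric] by simp_all
    then show ?thesis unfolding ipl using a by (simp add: power2_eq_square)
  qed
  have "energy G / 2 \<le> real (card T - 1) + real (card ?U - 1) + (\<Sum>(c, l)\<leftarrow>[(1 / K, l)]. c * ip V l l)"
  proof (rule energy_le_certificate)
    show "T \<subseteq> V" "?U \<subseteq> V" using T(1) Q(1) by auto
    show "0 \<le> c" if "(c, l') \<in> set [(1 / K, l)]" for c l' using that K by simp
    fix z :: "'a \<Rightarrow> real"
    define S where "S = sum z T"
    define U where "U = sum z ?U"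
    define P where "P = sum z R"
    define L where "L = 2 / a * S - 2 / (b + 1) * U"
    have "qA V z = qA (Q \<union> R) z" by (rule qA_restrict[OF W E])
    also have "\<dots> = (sum z Q)\<^sup>2 - (\<Sum>v\<in>Q. (z v)\<^sup>2) + 2 * (\<Sum>r\<in>R. z r * sum z (nbrs Q r))"
      by (rule qA_clique_indep[OF fQ Q(2) fR R(2) dis])
    also have "\<dots> = (S + U)\<^sup>2 - (\<Sum>v\<in>Q. (z v)\<^sup>2) + 2 * (P * S)"
      by (simp add: nb spl[of z] S_def U_def P_def sum_distrib_right)
    finally have "qA V z + spread T z + spread ?U z + 1 / K * (ip V l z)\<^sup>2
        = (S + U)\<^sup>2 + 2 * (P * S) - S\<^sup>2 / a - U\<^sup>2 / b + 1 / K * (L - P)\<^sup>2"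
      by (simp add: spread_def spl[of "\<lambda>v. (z v)\<^sup>2"] ipl a_def b_def S_def U_def P_def L_def)
    \<comment> \<open>Completing the square in \<open>P\<close> leaves a form in \<open>S\<close>
      and \<open>U\<close> only. The number \<open>s\<close> is the coefficient of
      \<open>S\<^sup>2\<close> at which that form degenerates to a multiple of one square, and
      \<open>K\<close> is chosen to produce it.\<close>
    also have "\<dots> = 1 / K * (L - P - K * S)\<^sup>2 + ((S + U)\<^sup>2 - S\<^sup>2 / a - U\<^sup>2 / b + 2 * L * S - K * S\<^sup>2)"
      using K by (simp add: power2_eq_square field_simps)
    also have "(S + U)\<^sup>2 - S\<^sup>2 / a - U\<^sup>2 / b + 2 * L * S - K * S\<^sup>2
        = s * S\<^sup>2 + (2 - 4 / (b + 1)) * (S * U) + (1 - 1 / b) * U\<^sup>2"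
    proof -
      have "(S + U)\<^sup>2 - S\<^sup>2 / a - U\<^sup>2 / b + 2 * L * S - K * S\<^sup>2
          = (1 - 1 / a + 4 / a - K) * S\<^sup>2 + (2 - 4 / (b + 1)) * (S * U) + (1 - 1 / b) * U\<^sup>2"
        by (simp add: L_def power2_eq_square algebra_simps)
      moreover have "1 - 1 / a + 4 / a - K = s" by (simp add: Ks)
      ultimately show ?thesis by (simp only:)
    qed
    also have "\<dots> = (b - 1) / b * (b / (b + 1) * S + U)\<^sup>2"
    proof (cases "b = 0")
      case True
      then have "?U = {}" using fQ by (simp add: b_def)
      then have "U = 0" unfolding U_def by (simp only: sum.empty)
      then show ?thesis using True by (simp add: s_def)
    next
      case False
      then have b0: "0 < b" using b by simp
      show ?thesis
        unfolding s_def fraction_identities(1)[OF b0, symmetric] fraction_identities(3,4)[OF b0]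
          fraction_identities(2)[OF b0, symmetric]
        by (simp add: power2_eq_square algebra_simps)
    qed
    also have "1 / K * (L - P - K * S)\<^sup>2 + \<dots> \<ge> 0"
    proof -
      \<comment> \<open>Integrality matters: the coefficient \<open>(b - 1) / b\<close> would be
        negative for \<open>b\<close> strictly between 0 and 1, and for \<open>b = 0\<close> it is 0
        by convention.\<close>
      have "b = 0 \<or> 1 \<le> b" by (cases "card ?U") (auto simp: b_def)
      then show ?thesis using K by (intro add_nonneg_nonneg mult_nonneg_nonneg) auto
    qed
    finally show "0 \<le> qA V z + spread T z + spread ?U z + (\<Sum>(c, l)\<leftarrow>[(1 / K, l)]. c * (ip V l z)\<^sup>2)"
      by simp
  qed
  moreover have "real (card T - 1) = a - 1" using a by (simp add: a_def of_nat_diff)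
  ultimately show "energy G / 2 \<le> a - 1 + real (card ?U - 1) + (4 / a + 4 * b / (b + 1)\<^sup>2 + real (card R)) / K"
    by (simp add: ll)
qed

text \<open>When \<open>R\<close> is nonempty, everything reduces to the rank-one part of the
  certificate having trace less than 2. When \<open>R\<close> is empty, the projection for
  \<open>Q\<close> suffices.\<close>

lemma energy_clique_plus:
  assumes Q: "Q \<subseteq> V" "clique Q" "Q \<noteq> {}" and T: "T \<subseteq> Q" and R: "R \<subseteq> V - Q" "indep R"
    and nb: "\<And>r. r \<in> R \<Longrightarrow> nbrs Q r = T"
    and E: "\<And>u v. (u, v) \<in> parcs G \<Longrightarrow> u \<in> Q \<union> R \<and> v \<in> Q \<union> R"
    and par: "R = {} \<and> T = {}
       \<or> card R = 1 \<and> 1 \<le> card T \<and> card T < card Q \<and> card T * (card Q - card T + 1) < 2 * (card Q + 1)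
       \<or> card R = 2 \<and> card T = 1"
  shows "energy G < 2 * real (chromatic_number G)"
proof -
  have fQ: "finite Q" by (rule finite_subset[OF Q(1) finV])
  have fT: "finite T" by (rule finite_subset[OF T fQ])
  have chi: "real (card Q) \<le> real (chromatic_number G)" using card_clique_le_chromatic[OF Q(1,2)] by simp
  show ?thesis
  proof (cases "R = {}")
    case True
    have n: "0 < card Q" using Q(3) fQ by (simp add: card_gt_0_iff)
    have "energy G / 2 \<le> real (card Q - 1) + real (card ({} :: 'a set) - 1) + (\<Sum>(c, l)\<leftarrow>[]. c * ip V l l)"
    proof (rule energy_le_certificate[OF Q(1)])
      fix z :: "'a \<Rightarrow> real"
      have "qA V z = (sum z Q)\<^sup>2 - (\<Sum>v\<in>Q. (z v)\<^sup>2)"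
        using qA_clique_indep[OF fQ Q(2), of "{}" z] qA_restrict[OF Q(1), of z] E True
        by (simp add: indep_def)
      moreover have "(sum z Q)\<^sup>2 / real (card Q) \<le> (sum z Q)\<^sup>2"
        using n by (simp add: divide_le_eq mult_le_cancel_left1)
      ultimately show "0 \<le> qA V z + spread Q z + spread {} z + (\<Sum>(c, l)\<leftarrow>[]. c * (ip V l z)\<^sup>2)"
        by (simp add: spread_def)
    qed auto
    also have "\<dots> < real (card Q)" using n by simp
    finally show ?thesis using chi by simp
  next
    case False
    then have T0: "T \<noteq> {}" using par by auto
    define a where "a = real (card T)"
    define b where "b = real (card (Q - T))"
    define m where "m = real (card R)"
    define K where "K = 3 / a + 1 - b * (b - 1) / (b + 1)\<^sup>2"
    note bound = energy_clique_plus_le[OF Q(1,2) T T0 R nb E, folded a_def b_def m_def, folded K_def]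
    have ab: "1 \<le> a" "0 \<le> b" "real (card Q) = a + b"
      using T T0 fT fQ card_mono[OF fQ T]
      by (simp_all add: a_def b_def Suc_le_eq card_gt_0_iff card_Diff_subset of_nat_diff)
    \<comment> \<open>The margin by which the rank-one part stays below trace 2. For one attached
      vertex it is positive exactly when t (n - t + 1) < 2 (n + 1); for two pendants at one vertex
      it is 2 - 2 b / (b + 1).\<close>
    have trace: "2 * K - (4 / a + 4 * b / (b + 1)\<^sup>2 + m) = 2 / a + 2 - 2 * b / (b + 1) - m"
    proof -
      have "4 * b / (b + 1)\<^sup>2 + 2 * (b * (b - 1) / (b + 1)\<^sup>2) = 2 * b / (b + 1)"
        using ab by (simp add: power2_eq_square divide_simps) (simp add: algebra_simps)
      then show ?thesis by (simp add: K_def)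
    qed
    have small: "m < 2 / a + 2 - 2 * b / (b + 1)"
    proof (cases "card R = 1")
      case True
      then have par': "card T * (card Q - card T + 1) < 2 * (card Q + 1)" using par by auto
      have "real (card T * (card Q - card T + 1)) < real (2 * (card Q + 1))"
        using par' by (simp only: of_nat_less_iff)
      moreover have "card Q - card T = card (Q - T)" using T fT by (simp add: card_Diff_subset)
      ultimately have "a * (b + 1) < 2 * (a + b + 1)"
        unfolding of_nat_mult of_nat_add a_def[symmetric] b_def[symmetric] using ab(3) by (simp add: a_def b_def)
      then have "0 < (2 * (a + b + 1) - a * (b + 1)) / (a * (b + 1))"
        using ab by (intro divide_pos_pos mult_pos_pos) auto
      also have "\<dots> = 2 / a + 1 - 2 * b / (b + 1)"
        using ab by (simp add: divide_simps) (simp add: algebra_simps)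
      finally show ?thesis using True by (simp add: m_def)
    next
      case False
      then have "m = 2" "a = 1" using par \<open>R \<noteq> {}\<close> by (auto simp: m_def a_def)
      moreover have "2 * b / (b + 1) < 2" using ab by (simp add: divide_less_eq)
      ultimately show ?thesis by simp
    qed
    then have quot: "(4 / a + 4 * b / (b + 1)\<^sup>2 + m) / K < 2" using bound(1) trace by (simp add: divide_less_eq)
    show ?thesis
    proof (cases "b = 0")
      case False
      then have "real (card (Q - T) - 1) = b - 1" by (cases "card (Q - T)") (auto simp: b_def)
      then show ?thesis using bound(2) quot chi ab(3) by linarith
    next
      \<comment> \<open>Here \<open>Q = T\<close> is a single vertex with two pendants, the path
        \<open>graph_B 1\<close>. The order of \<open>Q\<close> is only 1, so the chromatic number
        is bounded by an edge, while the truncated term \<open>card (Q - T) - 1\<close> is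
        0.\<close>
      case True
      then have "Q - T = {}" using fQ by (simp add: b_def)
      then have "card R \<noteq> 1" using T par \<open>R \<noteq> {}\<close> by auto
      then have "a = 1" using par \<open>R \<noteq> {}\<close> by (auto simp: a_def)
      obtain r q where rq: "r \<in> R" "q \<in> T" using \<open>R \<noteq> {}\<close> T0 by blast
      then have "clique {q, r}" using nb[of r] adj_commute by (auto simp: clique_def nbrs_def)
      moreover have "q \<noteq> r" "{q, r} \<subseteq> V" using rq T Q(1) R(1) by auto
      ultimately have "2 \<le> real (chromatic_number G)" using card_clique_le_chromatic[of "{q, r}"] by simp
      moreover have "real (card (Q - T) - 1) = 0" unfolding \<open>Q - T = {}\<close> by simp
      ultimately show ?thesis using bound(2) quot \<open>a = 1\<close> by linarith
    qed
  qed
qed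

text \<open>The certificate splits along the reflection exchanging \<open>a\<close> with
  \<open>b\<close> and \<open>r\<close> with \<open>s\<close>. Its traces 949/576 and 4/3
  approximate the negative eigenvalues -1.618 and -1.303 in modulus and still add to less than
  3.\<close>

lemma energy_H5:
  assumes V: "{a, b, c, r, s} \<subseteq> V" "distinct [a, b, c, r, s]"
    and E: "parcs G = {(a, b), (b, a), (a, c), (c, a), (b, c), (c, b), (a, r), (r, a), (b, s), (s, b)}"
  shows "energy G < 2 * real (chromatic_number G)"
proof -
  let ?W = "{a, b, c, r, s}"
  have ne: "a \<noteq> b" "a \<noteq> c" "a \<noteq> r" "a \<noteq> s" "b \<noteq> c" "b \<noteq> r" "b \<noteq> s" "c \<noteq> r" "c \<noteq> s" "r \<noteq> s"
    using V(2) by auto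
  \<comment> \<open>The Pythagorean triple 7, 24, 25 with the weight 1 / 1152 = 1 / (2 * 24^2) makes
    the antisymmetric remainder the square of a rational linear form.\<close>
  define l where "l = (\<lambda>_. 0 :: real)(a := 25, b := -25, r := -18, s := 18)"
  define m where "m = (\<lambda>_. 0 :: real)(a := -1, b := -1, c := 2, r := 1, s := 1)"
  have sumW: "sum f ?W = f a + f b + f c + f r + f s" for f :: "'a \<Rightarrow> real"
    using ne by simp
  have ipl: "ip V l z = 25 * (z a - z b) - 18 * (z r - z s)" for z
  proof -
    have "ip V l z = ip ?W l z" by (rule ip_supported[OF V(1)]) (auto simp: l_def)
    then show ?thesis using ne unfolding ip_def sumW by (simp add: l_def)
  qed
  have ipm: "ip V m z = 2 * z c + z r + z s - z a - z b" for z
  proof -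
    have "ip V m z = ip ?W m z" by (rule ip_supported[OF V(1)]) (auto simp: m_def)
    then show ?thesis using ne unfolding ip_def sumW by (simp add: m_def)
  qed
  have ll: "ip V l l = 1898" "ip V m m = 8" unfolding ipl ipm using ne by (simp_all add: l_def m_def)
  have "energy G / 2 \<le> real (card ({} :: 'a set) - 1) + real (card ({} :: 'a set) - 1)
      + (\<Sum>(c, l)\<leftarrow>[(1 / 1152, l), (1 / 6, m)]. c * ip V l l)"
  proof (rule energy_le_certificate)
    show "0 \<le> c" if "(c, l') \<in> set [(1 / 1152, l), (1 / 6, m)]" for c :: real and l' using that by auto
    fix z :: "'a \<Rightarrow> real"
    have "qA V z = (\<Sum>p\<in>parcs G. z (fst p) * z (snd p))" by (rule qA_sum_arcs)
    also have "\<dots> = 2 * (z a * z b + z a * z c + z b * z c + z a * z r + z b * z s)"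
      unfolding E using ne by (simp add: algebra_simps)
    also have "\<dots> + 1 / 1152 * (ip V l z)\<^sup>2 + 1 / 6 * (ip V m z)\<^sup>2
        = 1 / 1152 * (7 * (z a - z b) + 18 * (z r - z s))\<^sup>2 + 1 / 6 * (2 * (z a + z b) + 2 * z c + z r + z s)\<^sup>2"
      unfolding ipl ipm by (simp add: power2_eq_square field_simps)
    finally have "qA V z + 1 / 1152 * (ip V l z)\<^sup>2 + 1 / 6 * (ip V m z)\<^sup>2 \<ge> 0" by simp
    then show "0 \<le> qA V z + spread {} z + spread {} z + (\<Sum>(c, l)\<leftarrow>[(1 / 1152, l), (1 / 6, m)]. c * (ip V l z)\<^sup>2)"
      by (simp add: spread_def)
  qed auto
  also have "\<dots> < 3" by (simp add: ll)
  also have "\<dots> \<le> real (chromatic_number G)"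
  proof -
    have "card {a, b, c} \<le> chromatic_number G"
    proof (rule card_clique_le_chromatic)
      show "{a, b, c} \<subseteq> V" using V(1) by simp
      show "clique {a, b, c}" unfolding clique_def by (simp add: E)
    qed
    then show ?thesis using ne by simp
  qed
  finally show ?thesis by simp
qed

end

section \<open>Isomorphisms\<close>

lemma graph_isoI:
  assumes G: "pair_wf_digraph G" and h: "inj_on h (pverts G)"
    and H: "pverts H = h ` pverts G" "parcs H = map_prod h h ` parcs G"
  shows "graph_iso G H"
proof -
  interpret pair_wf_digraph G by fact
  let ?f = "\<lparr> iso_verts = h, iso_arcs = map_prod h h, iso_head = snd, iso_tail = fst \<rparr>"
  have "inj_on (map_prod h h) (parcs G)"
    by (rule inj_on_subset[OF map_prod_inj_on[OF h h]]) (auto intro: in_arcsD1 in_arcsD2)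
  then have "pre_digraph.digraph_isomorphism (with_proj G) ?f"
    using h wf_digraph_axioms unfolding pre_digraph.digraph_isomorphism_def by simp
  moreover have "with_proj H = app_iso ?f (with_proj G)"
    by (simp add: app_iso_def with_proj_def H)
  ultimately show ?thesis unfolding digraph_iso_def by blast
qed

text \<open>Arcs are pairs of vertices in both graphs, so preservation of heads and tails forces the
  arc map to be the product of the vertex map with itself.\<close>

lemma graph_isoE:
  assumes "graph_iso G H"
  obtains h where "inj_on h (pverts G)" "pverts H = h ` pverts G" "parcs H = map_prod h h ` parcs G"
proof -
  obtain f where f: "pre_digraph.digraph_isomorphism (with_proj G) f" "with_proj H = app_iso f (with_proj G)"
    using assms unfolding digraph_iso_def by blast
  have eqs: "pverts H = iso_verts f ` pverts G" "parcs H = iso_arcs f ` parcs G" "iso_tail f = fst" "iso_head f = snd"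
    using f(2) by (simp_all add: app_iso_def with_proj_def)
  have "iso_arcs f a = map_prod (iso_verts f) (iso_verts f) a" if "a \<in> parcs G" for a
  proof -
    have "iso_verts f (fst a) = fst (iso_arcs f a)" "iso_verts f (snd a) = snd (iso_arcs f a)"
      using f(1) that eqs(3,4) unfolding pre_digraph.digraph_isomorphism_def by (simp_all add: with_proj_def)
    then show ?thesis by (metis map_prod_def prod.collapse case_prod_beta fst_map_prod snd_map_prod prod_eqI)
  qed
  then have "parcs H = map_prod (iso_verts f) (iso_verts f) ` parcs G" using eqs(2) by auto
  moreover have "inj_on (iso_verts f) (pverts G)"
    using f(1) unfolding pre_digraph.digraph_isomorphism_def by simp
  ultimately show thesis using that eqs(1) by blast
qed

context finite_graph
begin

text \<open>The vertices outside \<open>W\<close> carry no arcs, so any numbering of them completes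
  \<open>j\<close> to an isomorphism.\<close>

lemma graph_iso_isolatedI:
  assumes W: "W \<subseteq> V" and arcs: "\<And>u v. (u, v) \<in> parcs G \<Longrightarrow> u \<in> W \<and> v \<in> W"
    and j: "bij_betw j W (pverts H)"
    and adj: "\<And>u v. u \<in> W \<Longrightarrow> v \<in> W \<Longrightarrow> (j u, j v) \<in> parcs H \<longleftrightarrow> (u, v) \<in> parcs G"
    and H: "parcs H \<subseteq> pverts H \<times> pverts H"
  shows "\<exists>k. graph_iso G (disjoint_union (isolated_vertices k) H)"
proof -
  have fin: "finite (V - W)" using finV by simp
  obtain i where i: "bij_betw i (V - W) {..<card (V - W)}"
    using ex_bij_betw_finite_nat[OF fin] by (auto simp: atLeast0LessThan)
  define h where "h v = (if v \<in> W then Inr (j v) else Inl (i v))" for v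
  have "graph_iso G (disjoint_union (isolated_vertices (card (V - W))) H)"
  proof (rule graph_isoI)
    show "pair_wf_digraph G" by unfold_locales
    show "inj_on h V"
      using i j by (auto simp: inj_on_def h_def bij_betw_def)
    have "h ` V = h ` W \<union> h ` (V - W)" using W by auto
    also have "h ` W = Inr ` pverts H" using j by (auto simp: h_def bij_betw_def)
    also have "h ` (V - W) = Inl ` i ` (V - W)" by (auto simp: h_def)
    also have "i ` (V - W) = {..<card (V - W)}" using i by (simp add: bij_betw_def)
    finally show "pverts (disjoint_union (isolated_vertices (card (V - W))) H) = h ` V"
      by (auto simp: disjoint_union_def isolated_vertices_def Plus_def)
    show "parcs (disjoint_union (isolated_vertices (card (V - W))) H) = map_prod h h ` parcs G"
    proof (rule Set.set_eqI)
      fix x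
      show "x \<in> parcs (disjoint_union (isolated_vertices (card (V - W))) H) \<longleftrightarrow> x \<in> map_prod h h ` parcs G"
      proof
        assume "x \<in> parcs (disjoint_union (isolated_vertices (card (V - W))) H)"
        then obtain p q where pq: "x = (Inr p, Inr q)" "(p, q) \<in> parcs H"
          by (auto simp: disjoint_union_def isolated_vertices_def)
        then have "p \<in> j ` W" "q \<in> j ` W" using H j by (auto simp: bij_betw_def)
        then obtain u v where uv: "u \<in> W" "v \<in> W" "j u = p" "j v = q" by auto
        then have "(u, v) \<in> parcs G" using adj[OF uv(1,2)] pq(2) by simp
        moreover have "x = map_prod h h (u, v)" using uv pq(1) by (simp add: h_def)
        ultimately show "x \<in> map_prod h h ` parcs G" by blast
      next
        assume "x \<in> map_prod h h ` parcs G"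
        then obtain u v where uv: "(u, v) \<in> parcs G" "x = (h u, h v)" by auto
        have W: "u \<in> W" "v \<in> W" using arcs[OF uv(1)] by auto
        then have "(j u, j v) \<in> parcs H" using adj uv(1) by blast
        then show "x \<in> parcs (disjoint_union (isolated_vertices (card (V - W))) H)"
          using uv(2) W by (force simp: disjoint_union_def isolated_vertices_def h_def)
      qed
    qed
  qed
  then show ?thesis by blast
qed

lemma graph_iso_isolatedE:
  assumes "graph_iso G (disjoint_union (isolated_vertices k) H)" and H: "parcs H \<subseteq> pverts H \<times> pverts H"
  obtains g where "inj_on g (pverts H)" "g ` pverts H \<subseteq> V"
    "parcs G = map_prod g g ` parcs H"
    "\<And>x y. x \<in> pverts H \<Longrightarrow> y \<in> pverts H \<Longrightarrow> (g x, g y) \<in> parcs G \<longleftrightarrow> (x, y) \<in> parcs H"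
proof -
  obtain h where h: "inj_on h V" "pverts (disjoint_union (isolated_vertices k) H) = h ` V"
    "parcs (disjoint_union (isolated_vertices k) H) = map_prod h h ` parcs G"
    using graph_isoE[OF assms(1)] by blast
  define h' where "h' = inv_into V h"
  define g where "g p = h' (Inr p)" for p
  have im: "Inr p \<in> h ` V" if "p \<in> pverts H" for p
    using that h(2) by (auto simp: disjoint_union_def)
  have hg: "h (g p) = Inr p" "g p \<in> V" if "p \<in> pverts H" for p
    using im[OF that] unfolding g_def h'_def by (simp_all add: f_inv_into_f inv_into_into)
  have h'h: "h' (h v) = v" if "v \<in> V" for v
    using h(1) that by (simp add: h'_def)
  show thesis
  proof (rule that)
    show "inj_on g (pverts H)" using hg(1) unfolding inj_on_def by (metis sum.inject(2))
    show "g ` pverts H \<subseteq> V" using hg(2) by auto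
    have par: "map_prod h h ` parcs G = map_prod Inr Inr ` parcs H"
      unfolding h(3)[symmetric] by (simp add: disjoint_union_def isolated_vertices_def)
    have "map_prod h' h' (map_prod h h x) = x" if "x \<in> parcs G" for x
      using arcs_in_verts[of "fst x" "snd x"] that h'h by (cases x) auto
    then have "parcs G = map_prod h' h' ` map_prod h h ` parcs G" by (force simp: image_image)
    also have "\<dots> = map_prod g g ` parcs H"
      unfolding par image_image by (rule image_cong) (auto simp: g_def)
    finally show PG: "parcs G = map_prod g g ` parcs H" .
    have inj: "inj_on (map_prod g g) (pverts H \<times> pverts H)"
      using hg(1) by (intro map_prod_inj_on) (metis inj_onI sum.inject(2))+
    show "(g x, g y) \<in> parcs G \<longleftrightarrow> (x, y) \<in> parcs H" if "x \<in> pverts H" "y \<in> pverts H" for x y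
      unfolding PG using inj_on_image_mem_iff[OF inj, of "(x, y)" "parcs H"] that H by simp
  qed
qed

end

section \<open>Numbered standard form of a clique with attached twins, and its parameters\<close>

lemma bij_betw_initial_segment:
  assumes "finite Q" "T \<subseteq> Q"
  obtains j where "bij_betw j Q {..<card Q}" "\<And>v. v \<in> Q \<Longrightarrow> j v < card T \<longleftrightarrow> v \<in> T"
proof -
  have fT: "finite T" using assms finite_subset by blast
  obtain a where a: "bij_betw a T {..<card T}"
    using ex_bij_betw_finite_nat[OF fT] by (auto simp: atLeast0LessThan)
  have "card {card T..<card Q} = card (Q - T)" using assms fT by (simp add: card_Diff_subset)
  then obtain b where b: "bij_betw b (Q - T) {card T..<card Q}"
    using finite_same_card_bij[of "Q - T" "{card T..<card Q}"] assms(1) by auto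
  define j where "j v = (if v \<in> T then a v else b v)" for v
  have "bij_betw j (T \<union> (Q - T)) ({..<card T} \<union> {card T..<card Q})"
  proof (rule bij_betw_combine)
    show "bij_betw j T {..<card T}" using a by (subst bij_betw_cong[of _ _ a]) (auto simp: j_def)
    show "bij_betw j (Q - T) {card T..<card Q}" using b by (subst bij_betw_cong[of _ _ b]) (auto simp: j_def)
  qed auto
  moreover have "T \<union> (Q - T) = Q" using assms(2) by auto
  moreover have "{..<card T} \<union> {card T..<card Q} = {..<card Q}"
    using card_mono[OF assms] by auto
  ultimately have "bij_betw j Q {..<card Q}" by simp
  moreover have "j v < card T \<longleftrightarrow> v \<in> T" if "v \<in> Q" for v
  proof (cases "v \<in> T")
    case True
    then show ?thesis using bij_betwE[OF a] by (auto simp: j_def)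
  next
    case False
    then have "b v \<in> {card T..<card Q}" using bij_betwE[OF b] that by blast
    then show ?thesis using False by (simp add: j_def)
  qed
  ultimately show thesis by (rule that)
qed

text \<open>Translates the spectral condition, least eigenvalue greater than -2, into the explicit
  list of (iii).\<close>

lemma graph_A_parameters:
  fixes n t :: nat
  assumes "1 \<le> t" "t < n"
  shows "t * (n - t + 1) < 2 * (n + 1) \<longleftrightarrow> n \<le> 7 \<and> (n, t) \<noteq> (7, 4) \<or> n \<ge> 8 \<and> t \<in> {1, 2, n - 1}"
proof (cases "n \<le> 7")
  case True
  have "\<forall>n\<in>{2, 3, 4, 5, 6, 7 :: nat}. \<forall>t\<in>{1, 2, 3, 4, 5, 6 :: nat}. t < n \<longrightarrow>
      (t * (n - t + 1) < 2 * (n + 1) \<longleftrightarrow> n \<le> 7 \<and> (n, t) \<noteq> (7, 4) \<or> n \<ge> 8 \<and> t \<in> {1, 2, n - 1})"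
    by simp
  moreover have "n \<in> {2, 3, 4, 5, 6, 7}" "t \<in> {1, 2, 3, 4, 5, 6}" using assms True by auto
  ultimately show ?thesis using assms(2) by blast
next
  case False
  show ?thesis
  proof (cases "t \<in> {1, 2, n - 1}")
    case True
    then show ?thesis using False assms by auto
  next
    case t: False
    \<comment> \<open>In these variables the claim becomes a b + a + b \<ge> 3, which follows from n
      \<ge> 8.\<close>
    define a b where "a = t - 3" and "b = n - t - 2"
    then have "t = a + 3" "n = a + b + 5" using t assms by auto
    moreover have "2 * (n + 1) \<le> t * (n - t + 1)"
      using False calculation by (simp add: algebra_simps)
    ultimately show ?thesis using False t by auto
  qed
qed

text \<open>Common form of the three infinite families. It mirrors the case \<open>twins\<close> of
  \<open>low_pos_classification\<close>, so that each direction treats the families at once.\<close>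

definition clique_plus :: "nat \<Rightarrow> nat \<Rightarrow> nat \<Rightarrow> nat pair_pre_digraph" where
  "clique_plus n t m =
    \<lparr> pverts = {..<n + m},
      parcs = {(x, y). x < n \<and> y < n \<and> x \<noteq> y \<or> n \<le> x \<and> x < n + m \<and> y < t \<or> n \<le> y \<and> y < n + m \<and> x < t} \<rparr>"

lemma complete_graph_eq_clique_plus: "complete_graph n = clique_plus n 0 0"
  by (auto simp: complete_graph_def clique_plus_def)

lemma graph_A_eq_clique_plus: "graph_A n t = clique_plus n t 1"
  by (auto simp: graph_A_def complete_graph_def edges_def clique_plus_def)

lemma graph_B_eq_clique_plus: "graph_B n = clique_plus n 1 2"
  by (auto simp: graph_B_def complete_graph_def edges_def clique_plus_def)

context finite_graph
begin

lemma iso_clique_plus: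
  assumes Q: "Q \<subseteq> V" "clique Q" and T: "T \<subseteq> Q" and R: "R \<subseteq> V - Q" "indep R"
    and nb: "\<And>r. r \<in> R \<Longrightarrow> nbrs Q r = T"
    and E: "\<And>u v. (u, v) \<in> parcs G \<Longrightarrow> u \<in> Q \<union> R \<and> v \<in> Q \<union> R"
  shows "\<exists>k. graph_iso G (disjoint_union (isolated_vertices k) (clique_plus (card Q) (card T) (card R)))"
proof -
  let ?n = "card Q" and ?t = "card T" and ?m = "card R"
  have fQ: "finite Q" and fR: "finite R" using Q(1) R(1) finV finite_subset by blast+
  have tn: "?t \<le> ?n" by (rule card_mono[OF fQ T])
  obtain i where i: "bij_betw i Q {..<?n}" "\<And>v. v \<in> Q \<Longrightarrow> i v < ?t \<longleftrightarrow> v \<in> T"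
    using bij_betw_initial_segment[OF fQ T] by blast
  obtain e where e: "bij_betw e R {?n..<?n + ?m}"
    using finite_same_card_bij[OF fR, of "{?n..<?n + ?m}"] by auto
  define j where "j v = (if v \<in> Q then i v else e v)" for v
  have jQ: "j v < ?n" "j v < ?t \<longleftrightarrow> v \<in> T" if "v \<in> Q" for v
    using bij_betwE[OF i(1)] i(2) that by (auto simp: j_def)
  have jR: "?n \<le> j v \<and> j v < ?n + ?m" if "v \<in> R" for v
    using bij_betwE[OF e] R(1) that by (auto simp: j_def)
  have bij: "bij_betw j (Q \<union> R) ({..<?n} \<union> {?n..<?n + ?m})"
  proof (rule bij_betw_combine)
    show "bij_betw j Q {..<?n}" using i(1) by (subst bij_betw_cong[of _ _ i]) (auto simp: j_def)
    show "bij_betw j R {?n..<?n + ?m}" using e R(1) by (subst bij_betw_cong[of _ _ e]) (auto simp: j_def)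
  qed auto
  have U: "{..<?n} \<union> {?n..<?n + ?m} = {..<?n + ?m}" by auto
  show ?thesis
  proof (rule graph_iso_isolatedI[of "Q \<union> R"])
    show "Q \<union> R \<subseteq> V" using Q(1) R(1) by auto
    show "u \<in> Q \<union> R \<and> v \<in> Q \<union> R" if "(u, v) \<in> parcs G" for u v using E[OF that] .
    show "bij_betw j (Q \<union> R) (pverts (clique_plus ?n ?t ?m))" using bij by (simp add: U clique_plus_def)
    have RQ: "(r, v) \<in> parcs G \<longleftrightarrow> j v < ?t" "(v, r) \<in> parcs G \<longleftrightarrow> j v < ?t" if "r \<in> R" "v \<in> Q" for r v
      using nb[OF that(1)] jQ(2)[OF that(2)] that adj_commute by (auto simp: nbrs_def)
    fix u v assume uv: "u \<in> Q \<union> R" "v \<in> Q \<union> R"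
    show "(j u, j v) \<in> parcs (clique_plus ?n ?t ?m) \<longleftrightarrow> (u, v) \<in> parcs G"
    proof (cases "u \<in> Q"; cases "v \<in> Q")
      assume "u \<in> Q" "v \<in> Q"
      moreover from this have "j u = j v \<longleftrightarrow> u = v"
        using i(1) by (auto simp: j_def bij_betw_def inj_on_def)
      ultimately show ?thesis
        using jQ(1)[of u] jQ(1)[of v] Q(2) by (auto simp: clique_plus_def clique_def)
    next
      assume "u \<in> Q" "v \<notin> Q"
      then show ?thesis using uv jQ(1)[of u] jR[of v] RQ[of v u] tn by (auto simp: clique_plus_def)
    next
      assume "u \<notin> Q" "v \<in> Q"
      then show ?thesis using uv jQ(1)[of v] jR[of u] RQ[of u v] tn by (auto simp: clique_plus_def)
    next
      assume "u \<notin> Q" "v \<notin> Q"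
      then have "u \<in> R" "v \<in> R" using uv by auto
      then show ?thesis using jR[of u] jR[of v] R(2) tn by (auto simp: clique_plus_def indep_def)
    qed
  qed (use tn in \<open>auto simp: clique_plus_def\<close>)
qed

lemma clique_plus_of_iso:
  assumes iso: "graph_iso G (disjoint_union (isolated_vertices k) (clique_plus n t m))" and t: "t \<le> n"
  obtains Q T R where "Q \<subseteq> V" "clique Q" "card Q = n" "T \<subseteq> Q" "card T = t" "R \<subseteq> V - Q" "indep R"
    "card R = m" "\<And>r. r \<in> R \<Longrightarrow> nbrs Q r = T"
    "\<And>u v. (u, v) \<in> parcs G \<Longrightarrow> u \<in> Q \<union> R \<and> v \<in> Q \<union> R"
proof -
  let ?H = "clique_plus n t m"
  have VH: "pverts ?H = {..<n + m}" by (simp add: clique_plus_def)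
  have sub: "parcs ?H \<subseteq> pverts ?H \<times> pverts ?H" using t by (auto simp: clique_plus_def)
  obtain g where inj: "inj_on g {..<n + m}" and im: "g ` {..<n + m} \<subseteq> V"
    and PG: "parcs G = map_prod g g ` parcs ?H"
    and gE: "\<And>x y. x < n + m \<Longrightarrow> y < n + m \<Longrightarrow> (g x, g y) \<in> parcs G \<longleftrightarrow> (x, y) \<in> parcs ?H"
    using graph_iso_isolatedE[OF iso sub] unfolding VH by auto
  have card: "card (g ` A) = card A" if "A \<subseteq> {..<n + m}" for A
    by (rule card_image[OF inj_on_subset[OF inj that]])
  have gQ: "(g x, g y) \<in> parcs G \<longleftrightarrow> x \<noteq> y" if "x < n" "y < n" for x y
    using gE[of x y] that t by (auto simp: clique_plus_def)
  show thesis
  proof (rule that[of "g ` {..<n}" "g ` {..<t}" "g ` {n..<n + m}"])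
    show "g ` {..<n} \<subseteq> V" using im by auto
    show "clique (g ` {..<n})" unfolding clique_def using gQ by auto
    show "card (g ` {..<n}) = n" "card (g ` {..<t}) = t" "card (g ` {n..<n + m}) = m"
      using t by (subst card; force)+
    show "g ` {..<t} \<subseteq> g ` {..<n}" using t by auto
    have "g x \<noteq> g y" if "n \<le> x" "x < n + m" "y < n" for x y
      using inj_on_eq_iff[OF inj, of x y] that by simp
    then show "g ` {n..<n + m} \<subseteq> V - g ` {..<n}" using im by fastforce
    have "(g x, g y) \<notin> parcs G" if "n \<le> x" "x < n + m" "n \<le> y" "y < n + m" for x y
      using gE[of x y] that t by (simp add: clique_plus_def)
    then show "indep (g ` {n..<n + m})" unfolding indep_def by auto
    show "nbrs (g ` {..<n}) r = g ` {..<t}" if r: "r \<in> g ` {n..<n + m}" for r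
    proof -
      obtain x where x: "r = g x" "n \<le> x" "x < n + m" using r by auto
      have "(g x, g y) \<in> parcs G \<longleftrightarrow> y < t" if "y < n" for y
        using gE[of x y] x that t by (simp add: clique_plus_def)
      then show ?thesis using t by (auto simp: nbrs_def x(1))
    qed
    have lt: "x < n + m \<and> y < n + m" if "(x, y) \<in> parcs ?H" for x y using sub that by (auto simp: VH)
    have mem: "x < n + m \<Longrightarrow> g x \<in> g ` {..<n} \<union> g ` {n..<n + m}" for x by (cases "x < n") auto
    show "u \<in> g ` {..<n} \<union> g ` {n..<n + m} \<and> v \<in> g ` {..<n} \<union> g ` {n..<n + m}"
      if "(u, v) \<in> parcs G" for u v
    proof -
      obtain x y where "u = g x" "v = g y" "(x, y) \<in> parcs ?H" using \<open>(u, v) \<in> parcs G\<close> unfolding PG by auto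
      then show ?thesis using lt mem by blast
    qed
  qed
qed

lemma iso_graph_H5:
  assumes V: "{a, b, c, r, s} \<subseteq> V" "distinct [a, b, c, r, s]"
    and E: "parcs G = {(a, b), (b, a), (a, c), (c, a), (b, c), (c, b), (a, r), (r, a), (b, s), (s, b)}"
  shows "\<exists>k. graph_iso G (disjoint_union (isolated_vertices k) graph_H5)"
proof (rule graph_iso_isolatedI[OF V(1)])
  define j where "j = (\<lambda>_. 0 :: nat)(b := 1, c := 2, r := 3, s := 4)"
  have j: "j a = 0" "j b = 1" "j c = 2" "j r = 3" "j s = 4" using V(2) by (auto simp: j_def)
  have p5: "{..<5 :: nat} = {0, 1, 2, 3, 4}" by auto
  show bij: "bij_betw j {a, b, c, r, s} (pverts graph_H5)"
    using V(2) by (auto simp: bij_betw_def graph_H5_def p5 j)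
  have inj: "inj_on (map_prod j j) ({a, b, c, r, s} \<times> {a, b, c, r, s})"
    using bij by (intro map_prod_inj_on) (auto simp: bij_betw_def)
  have sub: "parcs G \<subseteq> {a, b, c, r, s} \<times> {a, b, c, r, s}" unfolding E by simp
  have eq: "parcs graph_H5 = map_prod j j ` parcs G"
    unfolding E graph_H5_def edges_def by (simp add: j) auto
  show "(j u, j v) \<in> parcs graph_H5 \<longleftrightarrow> (u, v) \<in> parcs G" if "u \<in> {a, b, c, r, s}" "v \<in> {a, b, c, r, s}" for u v
    using inj_on_image_mem_iff[OF inj SigmaI[OF that] sub] unfolding eq map_prod_simp .
  show "u \<in> {a, b, c, r, s} \<and> v \<in> {a, b, c, r, s}" if "(u, v) \<in> parcs G" for u v
    using sub that by blast
  show "parcs graph_H5 \<subseteq> pverts graph_H5 \<times> pverts graph_H5"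
    by (auto simp: graph_H5_def edges_def)
qed

end

definition member_of_family :: "nat pair_pre_digraph \<Rightarrow> bool" where
  "member_of_family H \<longleftrightarrow> (\<exists>n\<ge>1. H = complete_graph n) \<or> (\<exists>n\<ge>1. H = graph_B n) \<or>
     (\<exists>n t. 1 \<le> t \<and> t \<le> n - 1 \<and> H = graph_A n t \<and>
        (n \<le> 7 \<and> (n, t) \<noteq> (7, 4) \<or> n \<ge> 8 \<and> t \<in> {1, 2, n - 1})) \<or> H = graph_H5"

context finite_graph
begin

lemma family_of_low_energy:
  assumes low: "energy G < 2 * real (chromatic_number G)"
  shows "\<exists>k H. graph_iso G (disjoint_union (isolated_vertices k) H) \<and> member_of_family H"
proof -
  have "\<not> pos_ge V (real (chi V))"
    using low pos_ge_le_energy[of "real (chi V)"] by (auto simp: chromatic_number_eq_chi)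
  from finV this show ?thesis
  proof (cases rule: low_pos_classification)
    case (twins Q T R)
    have "\<exists>k. graph_iso G (disjoint_union (isolated_vertices k) (clique_plus (card Q) (card T) (card R)))"
      by (rule iso_clique_plus[OF twins(1,2,4-7)]) (use twins(8) arcs_in_verts in auto)
    moreover have "member_of_family (clique_plus (card Q) (card T) (card R))"
    proof -
      have "finite Q" using twins(1) finV finite_subset by blast
      then have n: "1 \<le> card Q" using twins(3) by (simp add: Suc_le_eq card_gt_0_iff)
      from twins(9) show ?thesis
      proof (elim disjE conjE)
        assume "R = {}" "T = {}"
        then show ?thesis
          using n unfolding member_of_family_def by (auto simp: complete_graph_eq_clique_plus)
      next
        assume m: "card R = 1" and t: "1 \<le> card T" "card T < card Q"
          "card T * (card Q - card T + 1) < 2 * (card Q + 1)"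
        have "clique_plus (card Q) (card T) (card R) = graph_A (card Q) (card T)"
          by (simp add: m graph_A_eq_clique_plus)
        moreover have "card T \<le> card Q - 1" using t(2) by simp
        ultimately show ?thesis
          using t(1) t(3)[unfolded graph_A_parameters[OF t(1,2)]] unfolding member_of_family_def by blast
      next
        assume "card R = 2" "card T = 1"
        then show ?thesis
          using n unfolding member_of_family_def by (auto simp: graph_B_eq_clique_plus)
      qed
    qed
    ultimately show ?thesis by blast
  next
    case (bull a b c r s)
    have "parcs G = {(a, b), (b, a), (a, c), (c, a), (b, c), (c, b), (a, r), (r, a), (b, s), (s, b)}" (is "_ = ?E")
    proof (rule Set.set_eqI)
      fix x :: "'a \<times> 'a"
      obtain u v where x: "x = (u, v)" by fastforce
      have "u \<in> V \<and> v \<in> V" if "(u, v) \<in> parcs G" using arcs_in_verts that by blast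
      moreover have "u \<in> V \<and> v \<in> V" if "(u, v) \<in> ?E" using that bull(1) by blast
      ultimately show "x \<in> parcs G \<longleftrightarrow> x \<in> ?E" using bull(3)[of u v] unfolding x by argo
    qed
    then have "\<exists>k. graph_iso G (disjoint_union (isolated_vertices k) graph_H5)"
      by (rule iso_graph_H5[OF bull(1,2)])
    then show ?thesis unfolding member_of_family_def by blast
  qed
qed

lemma low_energy_of_family:
  assumes iso: "graph_iso G (disjoint_union (isolated_vertices k) H)" and H: "member_of_family H"
  shows "energy G < 2 * real (chromatic_number G)"
proof (cases "H = graph_H5")
  case True
  have "parcs H \<subseteq> pverts H \<times> pverts H" by (auto simp: True graph_H5_def edges_def)
  then obtain g where g: "inj_on g (pverts H)" "g ` pverts H \<subseteq> V" "parcs G = map_prod g g ` parcs H"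
    by (rule graph_iso_isolatedE[OF iso])
  have VH: "pverts H = {..<5}" by (simp add: True graph_H5_def)
  show ?thesis
  proof (rule energy_H5[of "g 0" "g 1" "g 2" "g 3" "g 4"])
    show "{g 0, g 1, g 2, g 3, g 4} \<subseteq> V" using g(2) by (auto simp: VH image_subset_iff)
    show "distinct [g 0, g 1, g 2, g 3, g 4]" using inj_on_eq_iff[OF g(1)] by (simp add: VH)
    show "parcs G = {(g 0, g 1), (g 1, g 0), (g 0, g 2), (g 2, g 0), (g 1, g 2), (g 2, g 1),
        (g 0, g 3), (g 3, g 0), (g 1, g 4), (g 4, g 1)}"
      unfolding g(3) by (simp add: True graph_H5_def edges_def) auto
  qed
next
  case False
  obtain n t m where H': "H = clique_plus n t m" "t \<le> n" "1 \<le> n"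
    and par: "m = 0 \<and> t = 0 \<or> m = 1 \<and> 1 \<le> t \<and> t < n \<and> t * (n - t + 1) < 2 * (n + 1) \<or> m = 2 \<and> t = 1"
  proof -
    consider n where "1 \<le> n" "H = complete_graph n" | n where "1 \<le> n" "H = graph_B n"
      | n t where "1 \<le> t" "t \<le> n - 1" "H = graph_A n t"
        "n \<le> 7 \<and> (n, t) \<noteq> (7, 4) \<or> n \<ge> 8 \<and> t \<in> {1, 2, n - 1}"
      using H False unfolding member_of_family_def by blast
    then show thesis
    proof cases
      case (1 n)
      then show thesis using that[of n 0 0] by (simp add: complete_graph_eq_clique_plus)
    next
      case (2 n)
      then show thesis using that[of n 1 2] by (simp add: graph_B_eq_clique_plus)
    next
      case (3 n t)
      then have "t < n" by simp
      moreover have "t * (n - t + 1) < 2 * (n + 1)"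
        using graph_A_parameters[OF 3(1) \<open>t < n\<close>] 3(4) by blast
      ultimately show thesis using that[of n t 1] 3 by (simp add: graph_A_eq_clique_plus)
    qed
  qed
  obtain Q T R where Q: "Q \<subseteq> V" "clique Q" "card Q = n" "T \<subseteq> Q" "card T = t" "R \<subseteq> V - Q" "indep R"
    "card R = m" "\<And>r. r \<in> R \<Longrightarrow> nbrs Q r = T"
    "\<And>u v. (u, v) \<in> parcs G \<Longrightarrow> u \<in> Q \<union> R \<and> v \<in> Q \<union> R"
    using clique_plus_of_iso[OF iso[unfolded H'(1)] H'(2)] by blast
  have "finite Q" using finite_subset[OF Q(1) finV] .
  moreover have "finite R" using finite_subset[OF Q(6)] finV by simp
  ultimately have fin: "finite T" "finite R" using finite_subset[OF Q(4)] by simp_all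
  show ?thesis
  proof (rule energy_clique_plus[OF Q(1,2) _ Q(4,6,7,9,10)])
    show "Q \<noteq> {}" using Q(3) H'(3) by auto
    show "R = {} \<and> T = {}
       \<or> card R = 1 \<and> 1 \<le> card T \<and> card T < card Q \<and> card T * (card Q - card T + 1) < 2 * (card Q + 1)
       \<or> card R = 2 \<and> card T = 1"
      using par unfolding Q(3,5,8)[symmetric] using fin by auto
  qed
qed

end

theorem theorem13:
  fixes G :: "'a pair_pre_digraph"
  assumes "pair_graph G"
  shows "energy G < 2 * real (chromatic_number G) \<longleftrightarrow>
    (\<exists>k H. graph_iso G (disjoint_union (isolated_vertices k) H) \<and>
      ((\<exists>n\<ge>1. H = complete_graph n) \<or>
       (\<exists>n\<ge>1. H = graph_B n) \<or>
       (\<exists>n t. 1 \<le> t \<and> t \<le> n - 1 \<and> H = graph_A n t \<and>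
          (n \<le> 7 \<and> (n, t) \<noteq> (7, 4) \<or> n \<ge> 8 \<and> t \<in> {1, 2, n - 1})) \<or>
       H = graph_H5))"
proof -
  interpret finite_graph G by (rule finite_graph.intro) (rule assms)
  show ?thesis
    using family_of_low_energy low_energy_of_family unfolding member_of_family_def by blast
qed

end
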